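(* Let $G$ be a finite group and let $A$ and $B$ be submodular subgroups of $G$ such that $G=AB$ and $A,B\in\mathfrak{Z}$. Then $G\in\mathfrak{Z}$ whenever one of the following conditions holds: (1) $(|G:AF(G)|,\,|G:BF(G)|)=1$; (2) $(|A/A^{\mathcal{A}_1}|,\,|B/B^{\mathcal{A}_1}|)=1$.
   Context: All groups are finite. $G=AB$ means $G=\{ab: a\in A,\ b\in B\}$; $F(G)$ is the Fitting subgroup of $G$; $(m,n)$ denotes the greatest common divisor. A subgroup $M$ of a group $G$ is modular in $G$ if it is a modular element of the subgroup lattice of $G$, i.e. $\langle X, M\cap Z\rangle=\langle X,M\rangle\cap Z$ for all subgroups $X\le Z\le G$, and $\langle M, Y\cap Z\rangle=\langle M,Y\rangle\cap Z$ for all subgroups $Y,Z\le G$ with $M\le Z$. A subgroup $H$ of $G$ is submodular in $G$ if there is a chain $H=H_0\le H_1\le\dots\le H_n=G$ such that $H_i$ is a modular subgroup of $H_{i+1}$ for every $i$. $\mathfrak{Z}$ is the class of all finite groups in which every Sylow subgroup is submodular. $\mathcal{A}$ is the class of all finite groups with abelian Sylow subgroups, and $\mathcal{A}_1$ is the class of all groups in $\mathcal{A}$ whose exponent is square-free; both are formations. For a formation $\mathfrak{F}$ (a nonempty class of groups closed under quotients and such that $G/N_1,G/N_2\in\mathfrak{F}$ implies $G/(N_1\cap N_2)\in\mathfrak{F}$), $X^{\mathfrak{F}}$ denotes the $\mathfrak{F}$-residual of $X$, the smallest normal subgroup $N$ of $X$ with $X/N\in\mathfrak{F}$. *)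

theory Defs
  imports
    "HOL-Algebra.Coset"
    "HOL-Algebra.Generated_Groups"
    "HOL-Computational_Algebra.Squarefree"
begin

definition modular_subgroup :: "'a set \<Rightarrow> ('a, 'b) monoid_scheme \<Rightarrow> bool" where
  "modular_subgroup M G \<longleftrightarrow> subgroup M G \<and>
     (\<forall>X Z. subgroup X G \<and> subgroup Z G \<and> X \<subseteq> Z \<longrightarrow>
        generate G (X \<union> (M \<inter> Z)) = generate G (X \<union> M) \<inter> Z) \<and>
     (\<forall>Y Z. subgroup Y G \<and> subgroup Z G \<and> M \<subseteq> Z \<longrightarrow>
        generate G (M \<union> (Y \<inter> Z)) = generate G (M \<union> Y) \<inter> Z)"

definition submodular_subgroup :: "'a set \<Rightarrow> ('a, 'b) monoid_scheme \<Rightarrow> bool" where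
  "submodular_subgroup H G \<longleftrightarrow>
     (\<exists>n (C :: nat \<Rightarrow> 'a set). C 0 = H \<and> C n = carrier G \<and>
        (\<forall>i\<le>n. subgroup (C i) G) \<and>
        (\<forall>i<n. modular_subgroup (C i) (G\<lparr>carrier := C (Suc i)\<rparr>)))"

(* For a prime p not dividing the order of G, the trivial subgroup is the Sylow p-subgroup. *)
definition sylow_subgroup :: "nat \<Rightarrow> 'a set \<Rightarrow> ('a, 'b) monoid_scheme \<Rightarrow> bool" where
  "sylow_subgroup p P G \<longleftrightarrow>
     Factorial_Ring.prime p \<and> subgroup P G \<and> card P = p ^ multiplicity p (Coset.order G)"

definition class_Z :: "('a, 'b) monoid_scheme \<Rightarrow> bool" where
  "class_Z G \<longleftrightarrow> group G \<and> finite (carrier G) \<and>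
     (\<forall>p P. sylow_subgroup p P G \<longrightarrow> submodular_subgroup P G)"

definition class_A :: "('a, 'b) monoid_scheme \<Rightarrow> bool" where
  "class_A G \<longleftrightarrow> group G \<and> finite (carrier G) \<and>
     (\<forall>p P. sylow_subgroup p P G \<longrightarrow> comm_group (G\<lparr>carrier := P\<rparr>))"

definition group_exponent :: "('a, 'b) monoid_scheme \<Rightarrow> nat" where
  "group_exponent G = (LEAST n. 0 < n \<and> (\<forall>x\<in>carrier G. x [^]\<^bsub>G\<^esub> n = \<one>\<^bsub>G\<^esub>))"

definition class_A1 :: "('a, 'b) monoid_scheme \<Rightarrow> bool" where
  "class_A1 G \<longleftrightarrow> class_A G \<and> squarefree (group_exponent G)"

(* LEAST is taken with respect to inclusion. *)
definition residual :: "('a set monoid \<Rightarrow> bool) \<Rightarrow> ('a, 'b) monoid_scheme \<Rightarrow> 'a set" where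
  "residual \<FF> G = (LEAST N. N \<lhd> G \<and> \<FF> (G Mod N))"

primrec lower_central :: "('a, 'b) monoid_scheme \<Rightarrow> nat \<Rightarrow> 'a set" where
  "lower_central G 0 = carrier G"
| "lower_central G (Suc n) = generate G
     (\<Union>x \<in> lower_central G n. \<Union>y \<in> carrier G.
        {x \<otimes>\<^bsub>G\<^esub> y \<otimes>\<^bsub>G\<^esub> inv\<^bsub>G\<^esub> x \<otimes>\<^bsub>G\<^esub> inv\<^bsub>G\<^esub> y})"

definition nilpotent_group :: "('a, 'b) monoid_scheme \<Rightarrow> bool" where
  "nilpotent_group G \<longleftrightarrow> group G \<and> (\<exists>n. lower_central G n = {\<one>\<^bsub>G\<^esub>})"

(* For finite G this is the largest nilpotent normal subgroup, by Fitting's theorem. *)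
definition fitting_subgroup :: "('a, 'b) monoid_scheme \<Rightarrow> 'a set" where
  "fitting_subgroup G = generate G (\<Union>{N. N \<lhd> G \<and> nilpotent_group (G\<lparr>carrier := N\<rparr>)})"

definition subgroup_index :: "('a, 'b) monoid_scheme \<Rightarrow> 'a set \<Rightarrow> nat" where
  "subgroup_index G H = card (rcosets\<^bsub>G\<^esub> H)"

end

theory Submission
  imports Defs "HOL-Algebra.Sylow" "HOL-Algebra.Multiplicative_Group"
begin

text \<open>
  Submodularity is preserved by images and preimages of homomorphisms and by intersection with
  subgroups. It therefore suffices to exhibit, for each prime \<open>p\<close>, one submodular Sylow
  \<open>p\<close>-subgroup of \<open>G\<close>. Let \<open>A\<^sub>p\<close> be a Sylow \<open>p\<close>-subgroup of \<open>A\<close>; it is submodular in \<open>G\<close>, and so is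
  \<open>A\<^sub>p O\<^sub>p(G)\<close>. Under condition (1) \<open>p\<close> does not divide, say, \<open>|G : A F(G)|\<close>, and then \<open>A\<^sub>p O\<^sub>p(G)\<close> is a
  Sylow subgroup of \<open>G\<close>.

  Condition (2) implies that \<open>A\<close> and \<open>B\<close> have coprime orders, because every prime divisor \<open>q\<close> of the
  order of a group \<open>X\<close> in the class \<open>class_Z\<close> divides the order of its largest quotient in \<open>class_A1\<close>. To see
  this, pass to a quotient all of whose proper quotients have order prime to \<open>q\<close>. As the Sylow
  subgroup for the largest prime is normal, the Sylow \<open>q\<close>-subgroup \<open>Q\<close> is normal, elementary abelian
  and equal to its own centralizer; and commutators and \<open>p\<close>-th powers in a submodular \<open>p\<close>-subgroup
  \<open>P\<close> act trivially on a series of \<open>Q\<close>, hence on \<open>Q\<close>.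

  Normality of the Sylow subgroup \<open>S\<close> of the largest prime \<open>r\<close> is shown on a minimal counterexample.
  This is a simple group in which \<open>|S| = r\<close> and every modular maximal subgroup \<open>M\<close> of order prime to
  \<open>r\<close> is, like the normalizer of \<open>S\<close>, a Frobenius group with kernel \<open>T\<close> of prime order \<open>t < r\<close>, both
  with complements of the same order. If \<open>c\<close> of the \<open>n\<close> conjugates of \<open>M\<close> contain a common nontrivial
  element of both complements, letting \<open>S\<close> and \<open>T\<close> act on these conjugates gives \<open>n = r c\<close> and
  \<open>n - 1 = t (c - 1)\<close>, which is impossible; if the complements are trivial, the conjugates of \<open>S\<close> and
  \<open>T\<close> contain too many elements.
\<close>

text \<open>The driving consequence of the modular law: if \<open>M\<close> is modular and
  \<open>Z \<inter> M \<subseteq> Y \<subseteq> Z\<close>, then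
  \<open>join Y M \<inter> Z = Y\<close>. So \<open>Z \<inter> M\<close> is maximal in
  \<open>Z\<close> once every subgroup outside \<open>M\<close> generates the whole group together
  with \<open>M\<close>. In the minimal counterexample the normalizer of a Sylow
  \<open>r\<close>-subgroup shares this behaviour, because it contains a proper modular subgroup
  above that Sylow subgroup. Intersecting such a normalizer with a modular maximal subgroup
  therefore gives a subgroup maximal in both, and this is where the equal complements come from. For
  condition (2) the law says that, modulo \<open>Q \<inter> M\<close>, the part of \<open>Q\<close>
  generated by \<open>u\<close> and \<open>M\<close> is cyclic. Elements of \<open>M\<close> act on
  it by raising to powers; powers commute, which disposes of commutators, while \<open>p\<close>-th
  powers require a separate comparison inside a cyclic \<open>p\<close>-group. Normality, Sylow
  subgroups and modularity are expressed between subsets of one ambient group, so that members of a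
  chain, conjugates and intersections can be compared directly; quotients enter only through
  epimorphisms.\<close>

abbreviation prime_nat :: "nat \<Rightarrow> bool" where "prime_nat \<equiv> Factorial_Ring.prime"

section \<open>Counting by fibres and fixed points of \<open>p\<close>-groups\<close>

lemma card_eq_sum_fibres:
  assumes "finite A"
  shows "card A = (\<Sum>z\<in>f ` A. card {x \<in> A. f x = z})"
proof -
  have "A = (\<Union>z\<in>f ` A. {x \<in> A. f x = z})" by auto
  then have "card A = card (\<Union>z\<in>f ` A. {x \<in> A. f x = z})" by simp
  also have "\<dots> = (\<Sum>z\<in>f ` A. card {x \<in> A. f x = z})"
    using assms by (intro card_UN_disjoint) auto
  finally show ?thesis .
qed

locale finite_group = group +
  assumes fin [simp]: "finite (carrier G)"

context group
begin

lemma inv_mult_cancel [simp]: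
  assumes "x \<in> carrier G" "y \<in> carrier G"
  shows "inv x \<otimes> (x \<otimes> y) = y" "x \<otimes> (inv x \<otimes> y) = y"
  using assms by (simp_all add: m_assoc[symmetric])

text \<open>Fibres of the multiplication map on \<open>H \<times> K\<close>: the pairs with product
  \<open>h \<otimes> k\<close> are exactly the pairs
  \<open>(h \<otimes> x, inv x \<otimes> k)\<close> with
  \<open>x \<in> H \<inter> K\<close>.\<close>

lemma card_set_mult:
  assumes "subgroup H G" "subgroup K G" "finite H" "finite K"
  shows "card (H <#> K) * card (H \<inter> K) = card H * card K"
proof -
  interpret H: subgroup H G by fact
  interpret K: subgroup K G by fact
  let ?f = "\<lambda>(h, k). h \<otimes> k"
  have im: "?f ` (H \<times> K) = H <#> K" by (auto simp: set_mult_def)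
  have "card {x \<in> H \<times> K. ?f x = z} = card (H \<inter> K)" if z: "z \<in> H <#> K" for z
  proof -
    obtain h k where hk: "h \<in> H" "k \<in> K" "z = h \<otimes> k" using z by (auto simp: set_mult_def)
    have "bij_betw (\<lambda>x. (h \<otimes> x, inv x \<otimes> k)) (H \<inter> K) {x \<in> H \<times> K. ?f x = z}"
    proof (rule bij_betwI[where g = "\<lambda>(a, b). inv h \<otimes> a"])
      show "(\<lambda>x. (h \<otimes> x, inv x \<otimes> k)) \<in> H \<inter> K \<rightarrow> {x \<in> H \<times> K. ?f x = z}"
      proof
        fix x assume "x \<in> H \<inter> K"
        then have "h \<otimes> x \<otimes> (inv x \<otimes> k) = h \<otimes> k"
          using hk by (simp add: m_assoc)
        with \<open>x \<in> H \<inter> K\<close> hk show "(h \<otimes> x, inv x \<otimes> k) \<in> {x \<in> H \<times> K. ?f x = z}" by auto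
      qed
      show "(\<lambda>(a, b). inv h \<otimes> a) \<in> {x \<in> H \<times> K. ?f x = z} \<rightarrow> H \<inter> K"
      proof
        fix y assume "y \<in> {x \<in> H \<times> K. ?f x = z}"
        then obtain a b where y: "y = (a, b)" "a \<in> H" "b \<in> K" "a \<otimes> b = h \<otimes> k" using hk by auto
        have "inv h \<otimes> a = inv h \<otimes> (a \<otimes> b) \<otimes> inv b" using y(1-3) hk by (simp add: m_assoc)
        also have "\<dots> = k \<otimes> inv b" using y(4) hk by simp
        finally have "inv h \<otimes> a = k \<otimes> inv b" .
        moreover have "inv h \<otimes> a \<in> H" "k \<otimes> inv b \<in> K" using y hk by auto
        ultimately show "(\<lambda>(a, b). inv h \<otimes> a) y \<in> H \<inter> K" using y by simp
      qed
      show "(\<lambda>(a, b). inv h \<otimes> a) (h \<otimes> x, inv x \<otimes> k) = x" if "x \<in> H \<inter> K" for x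
        using that hk by simp
      show "(\<lambda>x. (h \<otimes> x, inv x \<otimes> k)) ((\<lambda>(a, b). inv h \<otimes> a) y) = y"
        if yy: "y \<in> {x \<in> H \<times> K. ?f x = z}" for y
      proof -
        obtain a b where y: "y = (a, b)" "a \<in> H" "b \<in> K" "a \<otimes> b = h \<otimes> k" using yy hk by auto
        have c: "a \<in> carrier G" "b \<in> carrier G" "h \<in> carrier G" "k \<in> carrier G" using y hk by auto
        have "h \<otimes> (inv h \<otimes> a) = a" using c by simp
        moreover have "inv (inv h \<otimes> a) \<otimes> k = b"
          using c by (simp add: inv_mult_group m_assoc y(4)[symmetric])
        ultimately show ?thesis using y by simp
      qed
    qed
    then show ?thesis using bij_betw_same_card by fastforce
  qed
  then have "(\<Sum>z\<in>?f ` (H \<times> K). card {x \<in> H \<times> K. ?f x = z}) = card (H <#> K) * card (H \<inter> K)"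
    unfolding im by simp
  then show ?thesis
    using card_eq_sum_fibres[of "H \<times> K" ?f] assms by (simp add: card_cartesian_product)
qed

end

context finite_group
begin

lemma finite_sub [simp]: "H \<subseteq> carrier G \<Longrightarrow> finite H"
  using fin finite_subset by blast

lemma finite_subgroup: "subgroup H G \<Longrightarrow> finite H"
  by (simp add: subgroup.subset)

lemma card_subgroup_pos: "subgroup H G \<Longrightarrow> 0 < card H"
  by (simp add: subgroup.finite_imp_card_positive)

lemma sub_finite_group: "subgroup H G \<Longrightarrow> finite_group (G\<lparr>carrier := H\<rparr>)"
  by (simp add: finite_group_axioms_def finite_group_def subgroup.subset subgroup_imp_group)

lemma card_dvd:
  assumes "subgroup H G" "subgroup K G" "H \<subseteq> K"
  shows "card H dvd card K"
proof -
  interpret K: finite_group "G\<lparr>carrier := K\<rparr>" using sub_finite_group assms by auto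
  have "subgroup H (G\<lparr>carrier := K\<rparr>)" using assms subgroup_incl by auto
  from K.lagrange[OF this] have "card (rcosets\<^bsub>G\<lparr>carrier := K\<rparr>\<^esub> H) * card H = card K" by (simp add: order_def)
  then show ?thesis by (metis dvd_triv_right)
qed

text \<open>Orbit lengths divide \<open>p ^ k\<close>, so each orbit that is not a single fixed
  point has length divisible by \<open>p\<close>. The action is a bare function \<open>a\<close>
  with its laws as hypotheses, because it is used both on cosets and for conjugation of
  elements.\<close>

lemma p_group_fixed_points:
  assumes p: "prime_nat p" "order G = p ^ k" and X: "finite X"
    and cl: "\<And>g x. g \<in> carrier G \<Longrightarrow> x \<in> X \<Longrightarrow> a g x \<in> X"
    and one: "\<And>x. x \<in> X \<Longrightarrow> a \<one> x = x"
    and mul: "\<And>g h x. g \<in> carrier G \<Longrightarrow> h \<in> carrier G \<Longrightarrow> x \<in> X \<Longrightarrow> a (g \<otimes> h) x = a g (a h x)"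
  shows "card X mod p = card {x \<in> X. \<forall>g\<in>carrier G. a g x = x} mod p"
proof -
  let ?O = "\<lambda>x. (\<lambda>g. a g x) ` carrier G"
  let ?F = "{x \<in> X. \<forall>g\<in>carrier G. a g x = x}"
  have self: "x \<in> ?O x" if "x \<in> X" for x using one[OF that] by (metis image_eqI one_closed)
  have Osub: "?O x \<subseteq> X" if "x \<in> X" for x using cl that by auto
  have inv: "a (inv g) (a g x) = x" if "x \<in> X" "g \<in> carrier G" for g x
    using mul[of "inv g" g x] that one by simp
  have Oeq: "?O y = ?O x" if xX: "x \<in> X" and yO: "y \<in> ?O x" for x y
  proof -
    obtain g where g: "g \<in> carrier G" "y = a g x" using yO by auto
    have "a h y \<in> ?O x" if "h \<in> carrier G" for h
      using mul[of h g x] g xX that by (intro image_eqI[of _ _ "h \<otimes> g"]) auto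
    moreover have "a h x \<in> ?O y" if "h \<in> carrier G" for h
      using mul[of h "inv g" y] g xX that inv[OF xX g(1)] cl by (intro image_eqI[of _ _ "h \<otimes> inv g"]) auto
    ultimately show ?thesis by (intro equalityI image_subsetI)
  qed
  have cardO: "card (?O x) dvd p ^ k" if x: "x \<in> X" for x
  proof -
    let ?S = "{g \<in> carrier G. a g x = x}"
    \<comment> \<open>Orbit-stabilizer: the elements moving \<open>x\<close> to \<open>z\<close>
      form a left translate of the stabilizer \<open>?S\<close>.\<close>
    have "card {g \<in> carrier G. a g x = z} = card ?S" if zO: "z \<in> ?O x" for z
    proof -
      obtain g where g: "g \<in> carrier G" "z = a g x" using zO by auto
      have "bij_betw (\<lambda>h. g \<otimes> h) ?S {h \<in> carrier G. a h x = z}"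
      proof (rule bij_betwI[where g = "\<lambda>h. inv g \<otimes> h"])
        show "(\<otimes>) g \<in> ?S \<rightarrow> {h \<in> carrier G. a h x = z}" using g mul x by auto
        show "(\<otimes>) (inv g) \<in> {h \<in> carrier G. a h x = z} \<rightarrow> ?S" using g mul x inv by auto
      qed (use g in \<open>auto simp: m_assoc[symmetric]\<close>)
      then show ?thesis using bij_betw_same_card by fastforce
    qed
    then have "order G = card (?O x) * card ?S"
      unfolding order_def using card_eq_sum_fibres[OF fin, of "\<lambda>g. a g x"] by simp
    then show ?thesis using p by (metis dvd_triv_left)
  qed
  let ?C = "?O ` X"
  have UC: "\<Union>?C = X" using self Osub by blast
  have disj: "pairwise disjnt ?C"
  proof (rule pairwiseI)
    fix A B assume "A \<in> ?C" "B \<in> ?C" "A \<noteq> B"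
    then obtain x y where xy: "x \<in> X" "y \<in> X" "A = ?O x" "B = ?O y" by blast
    have "z \<notin> B" if "z \<in> A" for z
    proof
      assume "z \<in> B"
      then have "?O z = ?O y" using Oeq xy(2,4) by simp
      moreover have "?O z = ?O x" using Oeq xy(1,3) that by simp
      ultimately show False using xy(3,4) \<open>A \<noteq> B\<close> by simp
    qed
    then show "disjnt A B" unfolding disjnt_def by blast
  qed
  have "finite A" if "A \<in> ?C" for A
  proof -
    have "A \<subseteq> X" using that Osub by blast
    then show ?thesis using X finite_subset by blast
  qed
  from card_Union_disjoint[OF disj this] have "card X = (\<Sum>A\<in>?C. card A)"
    unfolding UC .
  also have "\<dots> = (\<Sum>A\<in>{A\<in>?C. card A = 1}. card A) + (\<Sum>A\<in>{A\<in>?C. card A \<noteq> 1}. card A)"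
    using X by (subst sum.union_disjoint[symmetric]) (auto intro!: sum.cong)
  also have "(\<Sum>A\<in>{A\<in>?C. card A = 1}. card A) = card {A\<in>?C. card A = 1}" by simp
  also have "{A\<in>?C. card A = 1} = (\<lambda>x. {x}) ` ?F"
  proof (intro equalityI subsetI)
    fix A assume "A \<in> {A\<in>?C. card A = 1}"
    then obtain x where x: "x \<in> X" "A = ?O x" "card A = 1" by auto
    then obtain y where y: "A = {y}" by (auto simp: card_1_singleton_iff)
    have "x \<in> A" using self[OF x(1)] x(2) by (simp only:)
    then have Ax: "A = {x}" using y by simp
    have "a g x = x" if "g \<in> carrier G" for g
    proof -
      have "a g x \<in> A" unfolding x(2) using that by (rule imageI)
      then show ?thesis using Ax by simp
    qed
    then have "x \<in> ?F" using x(1) by blast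
    then show "A \<in> (\<lambda>x. {x}) ` ?F" unfolding Ax by (rule imageI)
  next
    fix A assume "A \<in> (\<lambda>x. {x}) ` ?F"
    then obtain x where x: "x \<in> ?F" "A = {x}" by auto
    have "?O x = (\<lambda>g. x) ` carrier G" by (rule image_cong) (use x in auto)
    then have "?O x = {x}" using one_closed by auto
    moreover have "?O x \<in> ?C" using x(1) by blast
    ultimately show "A \<in> {A\<in>?C. card A = 1}" using x(2) by simp
  qed
  also have "card ((\<lambda>x. {x}) ` ?F) = card ?F" by (rule card_image) (auto simp: inj_on_def)
  finally have eq: "card X = card ?F + (\<Sum>A\<in>{A\<in>?C. card A \<noteq> 1}. card A)" .
  have "p dvd (\<Sum>A\<in>{A\<in>?C. card A \<noteq> 1}. card A)"
  proof (rule dvd_sum)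
    fix A assume "A \<in> {A\<in>?C. card A \<noteq> 1}"
    then have "card A dvd p ^ k" "card A \<noteq> 1" using cardO by auto
    then obtain j where "card A = p ^ j" using p(1) divides_primepow_nat by blast
    with \<open>card A \<noteq> 1\<close> show "p dvd card A" by (cases j) auto
  qed
  then show ?thesis using eq by (auto simp: dvd_def)
qed

end

section \<open>Conjugates, normalizers and Sylow subgroups\<close>

context group
begin

definition cj :: "'a \<Rightarrow> 'a set \<Rightarrow> 'a set" where
  "cj g H = (\<lambda>h. g \<otimes> h \<otimes> inv g) ` H"

text \<open>The inclusion \<open>cj k N \<subseteq> N\<close> for all \<open>k \<in> K\<close> is
  enough, since \<open>K\<close> is closed under inverses; \<open>normal_in_cj\<close> recovers
  equality.\<close>

definition normal_in :: "'a set \<Rightarrow> 'a set \<Rightarrow> bool" where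
  "normal_in N K \<longleftrightarrow> subgroup N G \<and> subgroup K G \<and> N \<subseteq> K \<and> (\<forall>k\<in>K. cj k N \<subseteq> N)"

definition nrm :: "'a set \<Rightarrow> 'a set" where
  "nrm H = {g \<in> carrier G. cj g H = H}"

definition syl :: "nat \<Rightarrow> 'a set \<Rightarrow> 'a set \<Rightarrow> bool" where
  "syl p P K \<longleftrightarrow> prime_nat p \<and> subgroup K G \<and> subgroup P G \<and> P \<subseteq> K
     \<and> card P = p ^ multiplicity p (card K)"

definition maximal_in :: "'a set \<Rightarrow> 'a set \<Rightarrow> bool" where
  "maximal_in H K \<longleftrightarrow> subgroup H G \<and> subgroup K G \<and> H \<subset> K
     \<and> (\<forall>Y. subgroup Y G \<longrightarrow> H \<subset> Y \<longrightarrow> Y \<subseteq> K \<longrightarrow> Y = K)"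

lemma cj_mem: "h \<in> H \<Longrightarrow> g \<otimes> h \<otimes> inv g \<in> cj g H"
  by (simp add: cj_def)

lemma cj_mono: "H \<subseteq> K \<Longrightarrow> cj g H \<subseteq> cj g K"
  by (auto simp: cj_def)

lemma cj_closed: "H \<subseteq> carrier G \<Longrightarrow> g \<in> carrier G \<Longrightarrow> cj g H \<subseteq> carrier G"
  by (auto simp: cj_def)

lemma cj_one: "H \<subseteq> carrier G \<Longrightarrow> cj \<one> H = H"
  by (force simp: cj_def)

lemma cj_cj:
  assumes "H \<subseteq> carrier G" "g \<in> carrier G" "h \<in> carrier G"
  shows "cj g (cj h H) = cj (g \<otimes> h) H"
proof -
  have "g \<otimes> (h \<otimes> x \<otimes> inv h) \<otimes> inv g = g \<otimes> h \<otimes> x \<otimes> inv (g \<otimes> h)" if "x \<in> H" for x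
    using assms that by (simp add: m_assoc inv_mult_group subset_iff)
  then show ?thesis by (simp add: cj_def image_image)
qed

lemma cj_inv:
  assumes "H \<subseteq> carrier G" "g \<in> carrier G"
  shows "cj (inv g) (cj g H) = H" "cj g (cj (inv g) H) = H"
  using assms by (simp_all add: cj_cj cj_one)

lemma cj_inj: "g \<in> carrier G \<Longrightarrow> H \<subseteq> carrier G \<Longrightarrow> inj_on (\<lambda>h. g \<otimes> h \<otimes> inv g) H"
  by (rule inj_onI) (auto simp: subset_iff)

lemma card_cj: "g \<in> carrier G \<Longrightarrow> H \<subseteq> carrier G \<Longrightarrow> card (cj g H) = card H"
  unfolding cj_def by (rule card_image) (rule cj_inj)

lemma cj_hom: "g \<in> carrier G \<Longrightarrow> group_hom G G (\<lambda>h. g \<otimes> h \<otimes> inv g)"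
  by (unfold_locales) (auto simp: hom_def m_assoc)

lemma cj_subgroup: "g \<in> carrier G \<Longrightarrow> subgroup H G \<Longrightarrow> subgroup (cj g H) G"
  unfolding cj_def using cj_hom group_hom.subgroup_img_is_subgroup by blast

lemma cj_subset_iff:
  assumes "H \<subseteq> carrier G" "K \<subseteq> carrier G" "g \<in> carrier G"
  shows "cj g H \<subseteq> K \<longleftrightarrow> H \<subseteq> cj (inv g) K"
proof
  assume "cj g H \<subseteq> K"
  from cj_mono[OF this, of "inv g"] show "H \<subseteq> cj (inv g) K" using assms by (simp add: cj_inv)
next
  assume "H \<subseteq> cj (inv g) K"
  from cj_mono[OF this, of g] show "cj g H \<subseteq> K" using assms by (simp add: cj_inv)
qed

lemma cj_subgroup_eq:
  assumes "subgroup H G" "g \<in> H" shows "cj g H = H"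
proof -
  interpret subgroup H G by fact
  have sub: "cj x H \<subseteq> H" if "x \<in> H" for x using that by (auto simp: cj_def)
  have "cj g (cj (inv g) H) \<subseteq> cj g H" using sub assms by (intro cj_mono) auto
  moreover have "cj g (cj (inv g) H) = H" using assms by (intro cj_inv) auto
  ultimately show ?thesis using sub[OF assms(2)] by simp
qed

lemma normal_in_cj:
  assumes "normal_in N K" "k \<in> K" shows "cj k N = N"
proof -
  have s: "subgroup N G" "subgroup K G" "N \<subseteq> K" and n: "\<And>k. k \<in> K \<Longrightarrow> cj k N \<subseteq> N"
    using assms by (auto simp: normal_in_def)
  have kc: "k \<in> carrier G" "inv k \<in> K" using s assms
    by (auto simp: subgroup.mem_carrier subgroup.m_inv_closed)
  have "cj k (cj (inv k) N) \<subseteq> cj k N" by (intro cj_mono n kc)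
  then show ?thesis using cj_inv(2)[of N k] s kc n[OF assms(2)]
    by (simp add: subgroup.subset)
qed

lemma normal_inD:
  assumes "normal_in N K"
  shows "subgroup N G" "subgroup K G" "N \<subseteq> K" "\<And>k n. k \<in> K \<Longrightarrow> n \<in> N \<Longrightarrow> k \<otimes> n \<otimes> inv k \<in> N"
  using assms by (auto simp: normal_in_def cj_def)

lemma normal_in_inv:
  assumes "normal_in N K" "k \<in> K" "n \<in> N" shows "inv k \<otimes> n \<otimes> k \<in> N"
  using normal_inD(4)[OF assms(1), of "inv k" n] normal_inD(2)[OF assms(1)] assms(2,3)
  by (simp add: subgroup.m_inv_closed subgroup.mem_carrier)

lemma normal_inI:
  assumes "subgroup N G" "subgroup K G" "N \<subseteq> K" "\<And>k n. k \<in> K \<Longrightarrow> n \<in> N \<Longrightarrow> k \<otimes> n \<otimes> inv k \<in> N"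
  shows "normal_in N K"
  using assms by (auto simp: normal_in_def cj_def)

lemma normal_in_iff: "normal_in N (carrier G) \<longleftrightarrow> N \<lhd> G"
  unfolding normal_inv_iff normal_in_def using subgroup_self
  by (auto simp: cj_def subgroup.mem_carrier)

lemma normal_in_subset:
  "normal_in N K \<Longrightarrow> subgroup H G \<Longrightarrow> N \<subseteq> H \<Longrightarrow> H \<subseteq> K \<Longrightarrow> normal_in N H"
  by (auto simp: normal_in_def)

lemma normal_in_Int:
  assumes "normal_in N K" "subgroup H G" "H \<subseteq> K" shows "normal_in (N \<inter> H) H"
proof (rule normal_inI)
  show "subgroup (N \<inter> H) G" using assms normal_inD subgroups_Inter_pair by blast
next
  fix k n assume "k \<in> H" "n \<in> N \<inter> H"
  then show "k \<otimes> n \<otimes> inv k \<in> N \<inter> H"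
    using normal_inD(4)[OF assms(1)] assms by (auto simp: subgroup.m_closed subgroup.m_inv_closed)
qed (use assms in auto)

lemma nrm_subgroup:
  assumes "H \<subseteq> carrier G" shows "subgroup (nrm H) G"
proof (rule subgroupI)
  show "nrm H \<noteq> {}" using assms by (auto simp: nrm_def cj_one)
next
  fix a assume "a \<in> nrm H"
  then show "inv a \<in> nrm H" using assms cj_inv(1)[of H a] by (auto simp: nrm_def)
next
  fix a b assume "a \<in> nrm H" "b \<in> nrm H"
  then show "a \<otimes> b \<in> nrm H" using assms cj_cj[of H a b] by (auto simp: nrm_def)
qed (auto simp: nrm_def)

lemma subset_nrm: "subgroup H G \<Longrightarrow> H \<subseteq> nrm H"
  by (auto simp: nrm_def cj_subgroup_eq subgroup.mem_carrier)

lemma normal_in_nrm: "subgroup H G \<Longrightarrow> normal_in H (nrm H)"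
  unfolding normal_in_def by (auto simp: nrm_subgroup subgroup.subset subset_nrm) (auto simp: nrm_def)

lemma normal_in_iff_nrm:
  "normal_in H K \<longleftrightarrow> subgroup H G \<and> subgroup K G \<and> H \<subseteq> K \<and> K \<subseteq> nrm H"
proof
  assume a: "normal_in H K"
  then show "subgroup H G \<and> subgroup K G \<and> H \<subseteq> K \<and> K \<subseteq> nrm H"
    using normal_in_cj[OF a] normal_inD[OF a] by (auto simp: nrm_def subgroup.mem_carrier)
qed (auto simp: normal_in_def nrm_def)

lemma nrm_cj:
  assumes "H \<subseteq> carrier G" "g \<in> carrier G" shows "nrm (cj g H) = cj g (nrm H)"
proof -
  have 1: "cj g (nrm H) \<subseteq> nrm (cj g H)" if "H \<subseteq> carrier G" "g \<in> carrier G" for g H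
  proof
    fix y assume "y \<in> cj g (nrm H)"
    then obtain x where x: "x \<in> carrier G" "cj x H = H" "y = g \<otimes> x \<otimes> inv g" by (auto simp: cj_def nrm_def)
    have "cj y (cj g H) = cj (g \<otimes> x) H" using x that by (simp add: cj_cj m_assoc)
    also have "\<dots> = cj g (cj x H)" by (rule cj_cj[symmetric]) (use x that in auto)
    also have "\<dots> = cj g H" using x by simp
    finally have "cj y (cj g H) = cj g H" .
    then show "y \<in> nrm (cj g H)" using x that by (auto simp: nrm_def)
  qed
  have "cj (inv g) (nrm (cj g H)) \<subseteq> nrm (cj (inv g) (cj g H))" using assms by (intro 1 cj_closed) auto
  then have "cj (inv g) (nrm (cj g H)) \<subseteq> nrm H" using assms cj_inv by simp
  then have "nrm (cj g H) \<subseteq> cj g (nrm H)"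
    using cj_subset_iff[of "nrm (cj g H)" "nrm H" "inv g"] assms by (auto simp: nrm_def)
  with 1[OF assms] show ?thesis by blast
qed

lemma subgroup_set_mult_normal:
  assumes "normal_in N K" "subgroup H G" "H \<subseteq> K"
  shows "subgroup (H <#> N) G" "H \<subseteq> H <#> N" "N \<subseteq> H <#> N" "H <#> N \<subseteq> K"
proof -
  interpret N: subgroup N G using assms normal_inD by blast
  interpret K: subgroup K G using assms normal_inD by blast
  interpret H: subgroup H G by fact
  show "subgroup (H <#> N) G"
  proof (rule subgroupI)
    show "H <#> N \<subseteq> carrier G" by (auto simp: set_mult_def)
    show "H <#> N \<noteq> {}" using H.one_closed N.one_closed unfolding set_mult_def by blast
  next
    fix a assume "a \<in> H <#> N"
    then obtain h n where a: "a = h \<otimes> n" "h \<in> H" "n \<in> N" by (auto simp: set_mult_def)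
    have "h \<otimes> inv n \<otimes> inv h \<in> N" using a assms normal_inD(4)[OF assms(1)] by blast
    moreover have "inv a = inv h \<otimes> (h \<otimes> inv n \<otimes> inv h)" using a by (simp add: inv_mult_group m_assoc)
    ultimately show "inv a \<in> H <#> N" using a by (auto simp: set_mult_def)
  next
    fix a b assume "a \<in> H <#> N" "b \<in> H <#> N"
    then obtain h n h' n' where a: "a = h \<otimes> n" "h \<in> H" "n \<in> N" "b = h' \<otimes> n'" "h' \<in> H" "n' \<in> N"
      by (auto simp: set_mult_def)
    have "inv h' \<otimes> n \<otimes> h' \<in> N" using a assms normal_in_inv[OF assms(1)] by blast
    moreover have "a \<otimes> b = h \<otimes> h' \<otimes> (inv h' \<otimes> n \<otimes> h' \<otimes> n')" using a by (simp add: m_assoc)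
    ultimately show "a \<otimes> b \<in> H <#> N" using a unfolding set_mult_def by blast
  qed
  show "H \<subseteq> H <#> N"
  proof
    fix h assume h: "h \<in> H"
    then have "h \<otimes> \<one> \<in> H <#> N" unfolding set_mult_def using N.one_closed by blast
    then show "h \<in> H <#> N" using h by simp
  qed
  show "N \<subseteq> H <#> N"
  proof
    fix h assume h: "h \<in> N"
    then have "\<one> \<otimes> h \<in> H <#> N" unfolding set_mult_def using H.one_closed by blast
    then show "h \<in> H <#> N" using h by simp
  qed
  show "H <#> N \<subseteq> K" using assms normal_inD(3)[OF assms(1)] by (auto simp: set_mult_def)
qed

lemma syl_iff:
  assumes "subgroup K G"
  shows "sylow_subgroup p P (G\<lparr>carrier := K\<rparr>) \<longleftrightarrow> syl p P K"
  using assms incl_subgroup[of K P] subgroup_incl[of P K] subgroup.subset[of P "G\<lparr>carrier := K\<rparr>"]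
  by (auto simp: sylow_subgroup_def syl_def order_def)

lemma syl_carrier_iff: "sylow_subgroup p P G \<longleftrightarrow> syl p P (carrier G)"
  using subgroup_self subgroup.subset by (auto simp: sylow_subgroup_def syl_def order_def)

lemma sylD:
  assumes "syl p P K"
  shows "prime_nat p" "subgroup K G" "subgroup P G" "P \<subseteq> K" "card P = p ^ multiplicity p (card K)"
  using assms by (auto simp: syl_def)

lemma cj_syl:
  assumes "syl p P K" "k \<in> K" shows "syl p (cj k P) K"
proof -
  have "cj k P \<subseteq> cj k K" using sylD[OF assms(1)] cj_mono by blast
  moreover have "cj k K = K" using sylD[OF assms(1)] assms(2) cj_subgroup_eq by blast
  ultimately show ?thesis
    using assms unfolding syl_def
    by (auto simp: card_cj cj_subgroup subgroup.mem_carrier subgroup.subset)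
qed

end

section \<open>Sylow theory by fixed points on cosets\<close>

context finite_group
begin

lemma card_le: "subgroup K G \<Longrightarrow> H \<subseteq> K \<Longrightarrow> card H \<le> card K"
  by (simp add: card_mono finite_subgroup)

lemma subgroup_card_eq: "subgroup K G \<Longrightarrow> H \<subseteq> K \<Longrightarrow> card K \<le> card H \<Longrightarrow> H = K"
  by (simp add: card_seteq finite_subgroup)

lemma card_eq_1: "subgroup H G \<Longrightarrow> card H = 1 \<longleftrightarrow> H = {\<one>}"
  by (auto simp: card_1_singleton_iff dest: subgroup.one_closed)

text \<open>Right cosets carry a right action; letting \<open>h\<close> act as right multiplication
  by \<open>inv h\<close> turns it into the left action that \<open>p_group_fixed_points\<close>
  expects.\<close>

lemma fixed_cosets:
  assumes P: "subgroup P G" and H: "subgroup H G" and p: "prime_nat p" "card H = p ^ k"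
  shows "card (rcosets P) mod p = card {C \<in> rcosets P. \<forall>h\<in>H. C #> inv h = C} mod p"
proof -
  interpret H: finite_group "G\<lparr>carrier := H\<rparr>" using sub_finite_group H by auto
  interpret H': subgroup H G by fact
  have sub: "C \<subseteq> carrier G" if "C \<in> rcosets P" for C using that P
    using rcosets_part_G by blast
  have "card (rcosets P) mod p = card {C \<in> rcosets P. \<forall>h\<in>carrier (G\<lparr>carrier := H\<rparr>). C #> inv h = C} mod p"
  proof (rule H.p_group_fixed_points[where a = "\<lambda>h C. C #> inv h" and k = k])
    show "finite (rcosets P)" using finite_subset[OF rcosets_subset_PowG[OF P]] by simp
    show "order (G\<lparr>carrier := H\<rparr>) = p ^ k" using p by (simp add: order_def)
  next
    fix h C assume "h \<in> carrier (G\<lparr>carrier := H\<rparr>)" "C \<in> rcosets P"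
    then obtain x where "h \<in> carrier G" "x \<in> carrier G" "C = P #> x" by (auto simp: RCOSETS_def)
    then show "C #> inv h \<in> rcosets P" using P
      by (simp add: coset_mult_assoc rcosetsI subgroup.subset)
  next
    fix C assume "C \<in> rcosets P"
    then show "C #> inv \<one>\<^bsub>G\<lparr>carrier := H\<rparr>\<^esub> = C" using sub by simp
  next
    fix g h C assume "g \<in> carrier (G\<lparr>carrier := H\<rparr>)" "h \<in> carrier (G\<lparr>carrier := H\<rparr>)" "C \<in> rcosets P"
    then show "C #> inv (g \<otimes>\<^bsub>G\<lparr>carrier := H\<rparr>\<^esub> h) = C #> inv h #> inv g" using sub
      by (simp add: inv_mult_group coset_mult_assoc)
  qed (use p in auto)
  then show ?thesis by simp
qed

text \<open>If \<open>P #> x\<close> absorbs \<open>h\<close> on the right, then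
  \<open>x \<otimes> h \<otimes> inv x\<close> lies in \<open>P\<close>. Fixed points of the coset
  action thus become containments between conjugates.\<close>

lemma fixed_coset_cj:
  assumes P: "subgroup P G" and H: "subgroup H G" and x: "x \<in> carrier G"
    and f: "\<forall>h\<in>H. (P #> x) #> inv h = P #> x"
  shows "cj x H \<subseteq> P"
proof -
  interpret P: subgroup P G by fact
  interpret H: subgroup H G by fact
  have "x \<otimes> h \<otimes> inv x \<in> P" if h: "h \<in> H" for h
  proof -
    have "(P #> x) #> inv (inv h) = P #> x" using f h by blast
    then have "P #> (x \<otimes> h) = P #> x" using h x coset_mult_assoc[of P x h] P.subset by simp
    then have "x \<otimes> h \<in> P #> x" using rcos_self[of "x \<otimes> h" P] h x P by simp
    then obtain q where "q \<in> P" "x \<otimes> h = q \<otimes> x" by (auto simp: r_coset_def)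
    then show ?thesis using x by (simp add: m_assoc)
  qed
  then show ?thesis by (auto simp: cj_def)
qed

lemma card_rcosets: "subgroup P G \<Longrightarrow> card (rcosets P) * card P = order G"
  using lagrange by simp

text \<open>The number of cosets of \<open>P\<close> is prime to \<open>p\<close>, so the
  \<open>p\<close>-group \<open>H\<close> fixes one of them. This is the conjugacy part of Sylow's
  theorem.\<close>

lemma p_subgroup_cj:
  assumes P: "subgroup P G" and H: "subgroup H G" and p: "prime_nat p" "card H = p ^ k"
    and i: "\<not> p dvd order G div card P"
  shows "\<exists>g\<in>carrier G. H \<subseteq> cj g P"
proof -
  have "card (rcosets P) = order G div card P" using card_subgroup_pos[OF P]
    by (simp flip: card_rcosets[OF P])
  then have "card (rcosets P) mod p \<noteq> 0" using i by (simp add: dvd_eq_mod_eq_0)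
  then have "{C \<in> rcosets P. \<forall>h\<in>H. C #> inv h = C} \<noteq> {}"
    using fixed_cosets[OF P H p] by (intro notI) simp
  then obtain x where x: "x \<in> carrier G" "\<forall>h\<in>H. (P #> x) #> inv h = P #> x" by (auto simp: RCOSETS_def)
  from fixed_coset_cj[OF P H this] have "H \<subseteq> cj (inv x) P"
    using cj_subset_iff P H x by (simp add: subgroup.subset)
  then show ?thesis using x by blast
qed

end

lemma (in group) cj_consistent:
  "subgroup K G \<Longrightarrow> k \<in> K \<Longrightarrow> group.cj (G\<lparr>carrier := K\<rparr>) k H = cj k H"
  by (simp add: group.cj_def subgroup_imp_group cj_def)

lemma not_dvd_div_power_multiplicity:
  assumes "prime_nat p" "0 < n" shows "\<not> p dvd n div p ^ multiplicity p n"
  using assms multiplicity_decompose[of n p] by (metis not_prime_unit less_not_refl)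

context finite_group
begin

lemma syl_exists:
  assumes "subgroup K G" "prime_nat p" shows "\<exists>P. syl p P K"
proof -
  interpret K: finite_group "G\<lparr>carrier := K\<rparr>" using sub_finite_group assms by auto
  obtain m where "order (G\<lparr>carrier := K\<rparr>) = p ^ multiplicity p (card K) * m"
    using multiplicity_dvd[of p "card K"] by (auto simp: order_def)
  from sylow_thm[OF assms(2) K.is_group this K.fin] obtain P
    where P: "subgroup P (G\<lparr>carrier := K\<rparr>)" "card P = p ^ multiplicity p (card K)" by blast
  then have "syl p P K" using incl_subgroup[OF assms(1)] subgroup.subset[OF P(1)] assms by (auto simp: syl_def)
  then show ?thesis ..
qed

lemma syl_index: "syl p P K \<Longrightarrow> \<not> p dvd card K div card P"
  using not_dvd_div_power_multiplicity sylD card_subgroup_pos by metis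

lemma sylI:
  assumes "prime_nat p" "subgroup K G" "subgroup P G" "P \<subseteq> K" "card P = p ^ a" "\<not> p dvd card K div card P"
  shows "syl p P K"
proof -
  have "card K = p ^ a * (card K div card P)" using card_dvd[OF assms(3,2,4)] assms(5) by simp
  then have "multiplicity p (card K) = a"
    using assms by (intro multiplicity_decomposeI[where x' = "card K div card P"]) auto
  then show ?thesis using assms by (simp add: syl_def)
qed

lemma syl_contains:
  assumes P: "syl p P K" and H: "subgroup H G" "H \<subseteq> K" "card H = p ^ j"
  shows "\<exists>k\<in>K. H \<subseteq> cj k P"
proof -
  note P' = sylD[OF P]
  interpret K: finite_group "G\<lparr>carrier := K\<rparr>" using sub_finite_group P' by auto
  have "\<exists>g\<in>carrier (G\<lparr>carrier := K\<rparr>). H \<subseteq> K.cj g P"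
    by (rule K.p_subgroup_cj[of _ _ p j]) (use P' H subgroup_incl syl_index[OF P] in \<open>auto simp: order_def\<close>)
  then show ?thesis using cj_consistent P' by auto
qed

lemma syl_conj:
  assumes "syl p P K" "syl p Q K" shows "\<exists>k\<in>K. Q = cj k P"
proof -
  note P = sylD[OF assms(1)] and Q = sylD[OF assms(2)]
  obtain k where k: "k \<in> K" "Q \<subseteq> cj k P" using syl_contains[OF assms(1) Q(3,4,5)] by blast
  have "k \<in> carrier G" using P(2) k(1) by (rule subgroup.mem_carrier)
  then have "Q = cj k P"
    by (intro subgroup_card_eq) (use k P Q in \<open>auto simp: cj_subgroup card_cj subgroup.subset\<close>)
  then show ?thesis using k by blast
qed

lemma p_subgroup_in_syl:
  assumes "subgroup K G" "prime_nat p" "subgroup H G" "H \<subseteq> K" "card H = p ^ j"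
  shows "\<exists>P. syl p P K \<and> H \<subseteq> P"
proof -
  obtain P where P: "syl p P K" using syl_exists assms by blast
  obtain k where "k \<in> K" "H \<subseteq> cj k P" using syl_contains[OF P assms(3,4,5)] by blast
  then show ?thesis using cj_syl[OF P] by blast
qed

lemma normal_syl_contains:
  assumes "syl p P K" "normal_in P K" "subgroup H G" "H \<subseteq> K" "card H = p ^ j"
  shows "H \<subseteq> P"
  using syl_contains[OF assms(1,3,4,5)] normal_in_cj[OF assms(2)] by blast

lemma normal_syl_unique: "syl p P K \<Longrightarrow> normal_in P K \<Longrightarrow> syl p Q K \<Longrightarrow> Q = P"
  using syl_conj normal_in_cj by metis

text \<open>Conjugates of \<open>S\<close> under \<open>K\<close> stay in \<open>N\<close> and have
  \<open>p\<close>-power order, so the normal Sylow subgroup \<open>S\<close> contains them. This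
  takes the place of "characteristic in normal is normal".\<close>

lemma normal_syl_trans:
  assumes S: "syl p S N" "normal_in S N" and N: "normal_in N K"
  shows "normal_in S K"
  unfolding normal_in_def
proof (intro conjI ballI)
  fix k assume k: "k \<in> K"
  note s = sylD[OF S(1)] and n = normal_inD[OF N]
  have kc: "k \<in> carrier G" using n(2) k by (rule subgroup.mem_carrier)
  have "cj k S \<subseteq> cj k N" using s(4) cj_mono by blast
  also have "\<dots> = N" using normal_in_cj[OF N k] .
  finally have "cj k S \<subseteq> N" .
  then show "cj k S \<subseteq> S"
    by (intro normal_syl_contains[OF S]) (use s kc in \<open>auto simp: cj_subgroup card_cj subgroup.subset\<close>)
qed (use sylD[OF S(1)] normal_inD[OF N] in auto)

text \<open>\<open>H\<close> acts on its own cosets in \<open>P\<close>. Their number is a power of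
  \<open>p\<close> other than 1, so the number of fixed cosets is a multiple of \<open>p\<close>;
  \<open>H\<close> is one of them, hence there is another, and a representative of it normalizes
  \<open>H\<close> without lying in \<open>H\<close>.\<close>

lemma p_group_normalizer_grows:
  assumes p: "prime_nat p" and P: "subgroup P G" "card P = p ^ k" and H: "subgroup H G" "H \<subset> P"
  shows "\<exists>x\<in>P - H. cj x H = H"
proof -
  interpret K: finite_group "G\<lparr>carrier := P\<rparr>" using sub_finite_group P by auto
  have H': "subgroup H (G\<lparr>carrier := P\<rparr>)" using H P subgroup_incl by auto
  let ?R = "rcosets\<^bsub>G\<lparr>carrier := P\<rparr>\<^esub> H"
  let ?F = "{C \<in> ?R. \<forall>h\<in>H. C #>\<^bsub>G\<lparr>carrier := P\<rparr>\<^esub> inv\<^bsub>G\<lparr>carrier := P\<rparr>\<^esub> h = C}"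
  have c: "card ?R * card H = p ^ k" using K.card_rcosets[OF H'] P by (simp add: order_def)
  obtain j where j: "card H = p ^ j" using card_dvd[OF H(1) P(1)] H P p divides_primepow_nat by auto
  have "card H < card P" using H P by (intro psubset_card_mono finite_subgroup)
  then have "card H \<noteq> p ^ k" using P by simp
  then have "card ?R \<noteq> 1" using c by auto
  moreover have "card ?R dvd p ^ k" using c[symmetric] by simp
  then obtain i where i: "card ?R = p ^ i" using p divides_primepow_nat by blast
  ultimately have "p dvd card ?R" by (cases i) auto
  then have "card ?F mod p = 0" using K.fixed_cosets[OF H' H' p j] by auto
  moreover have HF: "H \<in> ?F"
  proof -
    have "H #>\<^bsub>G\<lparr>carrier := P\<rparr>\<^esub> x = H" if "x \<in> H" for x
      by (rule K.coset_join2) (use H' that H in auto)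
    moreover have "H \<in> ?R" using subgroup.subgroup_in_rcosets[OF H' K.is_group] .
    moreover have "inv\<^bsub>G\<lparr>carrier := P\<rparr>\<^esub> x \<in> H" if "x \<in> H" for x
      using subgroup.m_inv_closed[OF H' that] .
    ultimately show ?thesis by blast
  qed
  moreover have "?F \<noteq> {H}"
  proof
    assume "?F = {H}"
    then have "card ?F = 1" by simp
    then show False using \<open>card ?F mod p = 0\<close> prime_gt_1_nat[OF p] by simp
  qed
  ultimately obtain C where C: "C \<in> ?F" "C \<noteq> H" by blast
  then obtain x where x: "x \<in> P" "C = H #>\<^bsub>G\<lparr>carrier := P\<rparr>\<^esub> x" by (auto simp: RCOSETS_def)
  have "K.cj x H \<subseteq> H" by (rule K.fixed_coset_cj) (use H' x C in auto)
  then have sub: "cj x H \<subseteq> H" using cj_consistent P x by simp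
  have xc: "x \<in> carrier G" using P(1) x(1) by (rule subgroup.mem_carrier)
  have "cj x H = H" by (intro subgroup_card_eq) (use sub H xc in \<open>auto simp: card_cj subgroup.subset\<close>)
  moreover have "x \<notin> H" using C x K.coset_join2[of x H] H' by auto
  ultimately show ?thesis using x by blast
qed

lemma p_group_maximal_normal:
  assumes p: "prime_nat p" "card P = p ^ k" and H: "maximal_in H P"
  shows "normal_in H P"
proof -
  have h: "subgroup H G" "subgroup P G" "H \<subset> P" using H by (auto simp: maximal_in_def)
  obtain x where x: "x \<in> P - H" "cj x H = H" using p_group_normalizer_grows[OF p(1) h(2) p(2) h(1,3)] by blast
  have sub: "subgroup (nrm H \<inter> P) G"
    using h(1,2) by (intro subgroups_Inter_pair nrm_subgroup subgroup.subset)
  have "x \<in> nrm H" using x h by (auto simp: nrm_def subgroup.mem_carrier)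
  then have "H \<subset> nrm H \<inter> P" using subset_nrm[OF h(1)] h x by blast
  then have "nrm H \<inter> P = P" using H sub by (auto simp: maximal_in_def)
  then show ?thesis using h by (auto simp: normal_in_iff_nrm)
qed

lemma cauchy:
  assumes "subgroup K G" "prime_nat p" "p dvd card K"
  shows "\<exists>H. subgroup H G \<and> H \<subseteq> K \<and> card H = p"
proof -
  interpret K: finite_group "G\<lparr>carrier := K\<rparr>" using sub_finite_group assms by auto
  obtain m where "order (G\<lparr>carrier := K\<rparr>) = p ^ 1 * m"
    using assms by (auto simp: order_def)
  from sylow_thm[OF assms(2) K.is_group this K.fin] obtain H where H: "subgroup H (G\<lparr>carrier := K\<rparr>)" "card H = p ^ 1" by blast
  then show ?thesis using incl_subgroup[OF assms(1)] subgroup.subset[OF H(1)] by auto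
qed

text \<open>Cauchy's theorem supplies a subgroup of order \<open>p\<close> strictly above
  \<open>{\<one>}\<close>, and maximality makes it all of \<open>P\<close>. This is how Sylow
  subgroups are later shown to have prime order.\<close>

lemma p_group_trivial_maximal:
  assumes p: "prime_nat p" "card P = p ^ k" and H: "maximal_in {\<one>} P"
  shows "card P = p"
proof -
  have h: "subgroup P G" "{\<one>} \<subset> P" using H by (auto simp: maximal_in_def)
  have "card P \<noteq> 1" using h card_eq_1 by auto
  then have "p dvd card P" using p by (cases k) auto
  then obtain Y where Y: "subgroup Y G" "Y \<subseteq> P" "card Y = p" using cauchy h p by blast
  have "Y \<noteq> {\<one>}" using Y p by auto
  then have "{\<one>} \<subset> Y" using Y subgroup.one_closed by blast
  then have "Y = P" using H Y by (auto simp: maximal_in_def)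
  then show ?thesis using Y by simp
qed

end

section \<open>Modular and submodular subgroups\<close>

context group
begin

abbreviation join :: "'a set \<Rightarrow> 'a set \<Rightarrow> 'a set" where
  "join A B \<equiv> generate G (A \<union> B)"

text \<open>In the first law \<open>X\<close> is confined to \<open>K\<close> by
  \<open>X \<subseteq> Z \<subseteq> K\<close>. Joins are formed in \<open>G\<close>, which gives
  the same sets as forming them in \<open>K\<close>.\<close>

definition modular_in :: "'a set \<Rightarrow> 'a set \<Rightarrow> bool" where
  "modular_in M K \<longleftrightarrow> subgroup M G \<and> subgroup K G \<and> M \<subseteq> K \<and>
     (\<forall>X Z. subgroup X G \<longrightarrow> subgroup Z G \<longrightarrow> X \<subseteq> Z \<longrightarrow> Z \<subseteq> K \<longrightarrow> join X (M \<inter> Z) = join X M \<inter> Z) \<and>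
     (\<forall>Y Z. subgroup Y G \<longrightarrow> subgroup Z G \<longrightarrow> Y \<subseteq> K \<longrightarrow> Z \<subseteq> K \<longrightarrow> M \<subseteq> Z \<longrightarrow> join M (Y \<inter> Z) = join M Y \<inter> Z)"

text \<open>The chain is a reflexive transitive closure, so that proofs can proceed by induction
  along it. The \<open>subgroup\<close> clauses matter for the chain of length 0, about which the
  closure says nothing.\<close>

definition submodular_in :: "'a set \<Rightarrow> 'a set \<Rightarrow> bool" where
  "submodular_in H K \<longleftrightarrow> subgroup H G \<and> subgroup K G \<and> modular_in\<^sup>*\<^sup>* H K"

lemma subgroup_sub_iff:
  "subgroup K G \<Longrightarrow> subgroup H (G\<lparr>carrier := K\<rparr>) \<longleftrightarrow> subgroup H G \<and> H \<subseteq> K"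
  using incl_subgroup[of K H] subgroup_incl[of H K] subgroup.subset[of H "G\<lparr>carrier := K\<rparr>"] by auto

lemma modular_in_iff:
  assumes K: "subgroup K G"
  shows "modular_subgroup M (G\<lparr>carrier := K\<rparr>) \<longleftrightarrow> modular_in M K"
proof -
  have g: "generate (G\<lparr>carrier := K\<rparr>) (A \<union> B) = join A B" if "A \<subseteq> K" "B \<subseteq> K" for A B
    using that K by (intro generate_consistent) auto
  have "(\<forall>X Z. (subgroup X G \<and> X \<subseteq> K) \<and> (subgroup Z G \<and> Z \<subseteq> K) \<and> X \<subseteq> Z \<longrightarrow>
        generate (G\<lparr>carrier := K\<rparr>) (X \<union> (M \<inter> Z)) = generate (G\<lparr>carrier := K\<rparr>) (X \<union> M) \<inter> Z)
      \<longleftrightarrow> (\<forall>X Z. subgroup X G \<longrightarrow> subgroup Z G \<longrightarrow> X \<subseteq> Z \<longrightarrow> Z \<subseteq> K \<longrightarrow> join X (M \<inter> Z) = join X M \<inter> Z)"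
    if "M \<subseteq> K" using that g
    by (intro iff_allI) (metis (no_types, lifting) inf.coboundedI1 subset_trans)
  moreover have "(\<forall>Y Z. (subgroup Y G \<and> Y \<subseteq> K) \<and> (subgroup Z G \<and> Z \<subseteq> K) \<and> M \<subseteq> Z \<longrightarrow>
        generate (G\<lparr>carrier := K\<rparr>) (M \<union> (Y \<inter> Z)) = generate (G\<lparr>carrier := K\<rparr>) (M \<union> Y) \<inter> Z)
      \<longleftrightarrow> (\<forall>Y Z. subgroup Y G \<longrightarrow> subgroup Z G \<longrightarrow> Y \<subseteq> K \<longrightarrow> Z \<subseteq> K \<longrightarrow> M \<subseteq> Z \<longrightarrow> join M (Y \<inter> Z) = join M Y \<inter> Z)"
    if "M \<subseteq> K" using that g
    by (intro iff_allI) (metis (no_types, lifting) inf.coboundedI1 subset_trans)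
  ultimately show ?thesis
    unfolding modular_subgroup_def modular_in_def subgroup_sub_iff[OF K] using K by argo
qed

lemma submodular_in_iff:
  assumes K: "subgroup K G"
  shows "submodular_subgroup H (G\<lparr>carrier := K\<rparr>) \<longleftrightarrow> submodular_in H K"
proof
  assume "submodular_subgroup H (G\<lparr>carrier := K\<rparr>)"
  then obtain n C where C: "C 0 = H" "C n = K" "\<And>i. i \<le> n \<Longrightarrow> subgroup (C i) G \<and> C i \<subseteq> K"
    "\<And>i. i < n \<Longrightarrow> modular_subgroup (C i) (G\<lparr>carrier := C (Suc i)\<rparr>)"
    unfolding submodular_subgroup_def subgroup_sub_iff[OF K] by auto
  have "modular_in (C i) (C (Suc i))" if "i < n" for i
    using C(4)[OF that] C(3)[of "Suc i"] that modular_in_iff by auto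
  then have "(modular_in ^^ n) H K" using C(1,2) unfolding relpowp_fun_conv by blast
  then show "submodular_in H K" unfolding submodular_in_def rtranclp_power using C(1) C(3)[of 0] K by auto
next
  assume "submodular_in H K"
  then obtain n where "subgroup H G" "(modular_in ^^ n) H K"
    unfolding submodular_in_def rtranclp_power by blast
  then obtain C where C: "C 0 = H" "C n = K" "\<And>i. i < n \<Longrightarrow> modular_in (C i) (C (Suc i))"
    unfolding relpowp_fun_conv by blast
  have s: "subgroup (C i) G \<and> C i \<subseteq> K" if "i \<le> n" for i
    using that
  proof (induction rule: inc_induct)
    case base show ?case using C K by auto
  next
    case (step m) then show ?case using C(3)[of m] by (auto simp: modular_in_def)
  qed
  then have "modular_subgroup (C i) (G\<lparr>carrier := C (Suc i)\<rparr>)" if "i < n" for i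
    using C(3)[OF that] modular_in_iff that by auto
  then show "submodular_subgroup H (G\<lparr>carrier := K\<rparr>)"
    unfolding submodular_subgroup_def subgroup_sub_iff[OF K] using C s
    by (intro exI[of _ n] exI[of _ C]) auto
qed

lemma submodular_carrier_iff: "submodular_subgroup H G \<longleftrightarrow> submodular_in H (carrier G)"
  using submodular_in_iff[OF subgroup_self] by simp

lemma join_least: "subgroup Z G \<Longrightarrow> A \<subseteq> Z \<Longrightarrow> B \<subseteq> Z \<Longrightarrow> join A B \<subseteq> Z"
  by (rule generate_subgroup_incl) auto

lemma join_subgroup: "A \<subseteq> carrier G \<Longrightarrow> B \<subseteq> carrier G \<Longrightarrow> subgroup (join A B) G"
  by (rule generate_is_subgroup) auto

lemma join_upper: "A \<subseteq> join A B" "B \<subseteq> join A B"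
  by (auto intro: generate.incl)

lemma join_mono: "A \<subseteq> A' \<Longrightarrow> B \<subseteq> B' \<Longrightarrow> join A B \<subseteq> join A' B'"
  by (rule mono_generate) auto

lemma join_commute: "join A B = join B A"
  by (simp add: Un_commute)

lemma modular_inI:
  assumes s: "subgroup M G" "subgroup K G" "M \<subseteq> K"
    and 1: "\<And>X Z z. subgroup X G \<Longrightarrow> subgroup Z G \<Longrightarrow> X \<subseteq> Z \<Longrightarrow> Z \<subseteq> K \<Longrightarrow> z \<in> join X M \<Longrightarrow> z \<in> Z
      \<Longrightarrow> z \<in> join X (M \<inter> Z)"
    and 2: "\<And>Y Z z. subgroup Y G \<Longrightarrow> subgroup Z G \<Longrightarrow> Y \<subseteq> K \<Longrightarrow> Z \<subseteq> K \<Longrightarrow> M \<subseteq> Z \<Longrightarrow> z \<in> join M Y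
      \<Longrightarrow> z \<in> Z \<Longrightarrow> z \<in> join M (Y \<inter> Z)"
  shows "modular_in M K"
  unfolding modular_in_def
proof (intro conjI allI impI s)
  fix X Z assume h: "subgroup X G" "subgroup Z G" "X \<subseteq> Z" "Z \<subseteq> K"
  have "join X (M \<inter> Z) \<subseteq> Z" using h by (intro join_least) auto
  moreover have "join X (M \<inter> Z) \<subseteq> join X M" by (intro join_mono) auto
  ultimately show "join X (M \<inter> Z) = join X M \<inter> Z" using 1[OF h] by blast
next
  fix Y Z assume h: "subgroup Y G" "subgroup Z G" "Y \<subseteq> K" "Z \<subseteq> K" "M \<subseteq> Z"
  have "join M (Y \<inter> Z) \<subseteq> Z" using h by (intro join_least) auto
  moreover have "join M (Y \<inter> Z) \<subseteq> join M Y" by (intro join_mono) auto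
  ultimately show "join M (Y \<inter> Z) = join M Y \<inter> Z" using 2[OF h] by blast
qed

lemma modular_inD:
  assumes "modular_in M K"
  shows "subgroup M G" "subgroup K G" "M \<subseteq> K"
    "\<And>X Z. subgroup X G \<Longrightarrow> subgroup Z G \<Longrightarrow> X \<subseteq> Z \<Longrightarrow> Z \<subseteq> K \<Longrightarrow> join X M \<inter> Z = join X (M \<inter> Z)"
    "\<And>Y Z. subgroup Y G \<Longrightarrow> subgroup Z G \<Longrightarrow> Y \<subseteq> K \<Longrightarrow> Z \<subseteq> K \<Longrightarrow> M \<subseteq> Z \<Longrightarrow> join M Y \<inter> Z = join M (Y \<inter> Z)"
  using assms unfolding modular_in_def by simp_all

text \<open>The first law is inherited directly. In the second, \<open>Z\<close> contains
  \<open>M \<inter> L\<close> but perhaps not \<open>M\<close>, so the law for \<open>M\<close> is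
  applied with \<open>join Z M\<close> in place of \<open>Z\<close>. The first law shows
  \<open>join Z M \<inter> L = Z\<close>, hence nothing changes inside \<open>L\<close>, and one
  more use of it cuts the result back to \<open>L\<close>.\<close>

lemma modular_in_Int:
  assumes M: "modular_in M K" and L: "subgroup L G" "L \<subseteq> K"
  shows "modular_in (M \<inter> L) L"
proof (rule modular_inI)
  note m = modular_inD[OF M]
  show s: "subgroup (M \<inter> L) G" by (rule subgroups_Inter_pair[OF m(1) L(1)])
  show "subgroup L G" by fact
  show "M \<inter> L \<subseteq> L" by auto
  fix X Z z assume h: "subgroup X G" "subgroup Z G" "X \<subseteq> Z" "Z \<subseteq> L" "z \<in> join X (M \<inter> L)" "z \<in> Z"
  have "join X (M \<inter> L) \<subseteq> join X M" by (intro join_mono) auto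
  then have "z \<in> join X M \<inter> Z" using h by auto
  also have "join X M \<inter> Z = join X (M \<inter> Z)" using h L by (intro m(4)) auto
  also have "M \<inter> Z = M \<inter> L \<inter> Z" using h by auto
  finally show "z \<in> join X (M \<inter> L \<inter> Z)" .
next
  note m = modular_inD[OF M]
  fix Y Z z assume h: "subgroup Y G" "subgroup Z G" "Y \<subseteq> L" "Z \<subseteq> L" "M \<inter> L \<subseteq> Z"
    "z \<in> join (M \<inter> L) Y" "z \<in> Z"
  have MZ: "subgroup (join Z M) G" using m(1) h by (intro join_subgroup) (auto simp: subgroup.subset)
  have MZK: "join Z M \<subseteq> K" using m(2,3) h L by (intro join_least) auto
  have "join Z M \<inter> L = join Z (M \<inter> L)" using h L by (intro m(4)) auto
  also have "\<dots> \<subseteq> Z" using h by (intro join_least) auto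
  finally have YZ: "Y \<inter> join Z M = Y \<inter> Z" using h join_upper(1)[of Z M] by blast
  have "join (M \<inter> L) Y \<subseteq> join M Y" by (intro join_mono) auto
  then have "z \<in> join M Y \<inter> join Z M" using h join_upper(1)[of Z M] by auto
  also have "\<dots> = join M (Y \<inter> join Z M)" using h L MZ MZK join_upper by (intro m(5)) auto
  also have "\<dots> = join (Y \<inter> Z) M" unfolding YZ by (rule join_commute)
  finally have "z \<in> join (Y \<inter> Z) M \<inter> L" using h by auto
  also have "\<dots> = join (Y \<inter> Z) (M \<inter> L)" using h L subgroups_Inter_pair by (intro m(4)) auto
  finally show "z \<in> join (M \<inter> L) (Y \<inter> Z)" by (simp add: join_commute)
qed

lemma submodular_inD:
  assumes "submodular_in H K"
  shows "subgroup H G" "subgroup K G" "H \<subseteq> K"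
proof -
  show "subgroup H G" "subgroup K G" using assms by (auto simp: submodular_in_def)
  have "modular_in\<^sup>*\<^sup>* H K" using assms by (auto simp: submodular_in_def)
  then show "H \<subseteq> K" by (induction) (auto simp: modular_in_def)
qed

lemma submodular_in_trans: "submodular_in H K \<Longrightarrow> submodular_in K L \<Longrightarrow> submodular_in H L"
  by (auto simp: submodular_in_def)

lemma submodular_in_Int:
  assumes H: "submodular_in H K" and L: "subgroup L G" "L \<subseteq> K"
  shows "submodular_in (H \<inter> L) L"
proof -
  note h = submodular_inD[OF H]
  have "modular_in\<^sup>*\<^sup>* H K" using H by (auto simp: submodular_in_def)
  then have "modular_in\<^sup>*\<^sup>* (H \<inter> L) (K \<inter> L)"
  proof (induction)
    case (step y z)
    have "modular_in (y \<inter> (z \<inter> L)) (z \<inter> L)"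
      using step(2) modular_inD(2)[OF step(2)] L subgroups_Inter_pair by (intro modular_in_Int) auto
    moreover have "y \<inter> (z \<inter> L) = y \<inter> L" using modular_inD(3)[OF step(2)] by auto
    ultimately show ?case using step(3) by simp
  qed auto
  moreover have "K \<inter> L = L" using L by auto
  ultimately show ?thesis using subgroups_Inter_pair[OF h(1) L(1)] L by (simp add: submodular_in_def)
qed

text \<open>The last member of the chain that differs from \<open>K\<close> serves as
  \<open>M\<close>; submodularity is thereby reduced to a single proper modular subgroup above
  \<open>H\<close>.\<close>

lemma submodular_in_proper:
  assumes "submodular_in H K" "H \<noteq> K"
  shows "\<exists>M. modular_in M K \<and> M \<noteq> K \<and> H \<subseteq> M"
proof -
  have "modular_in\<^sup>*\<^sup>* H K" "subgroup H G" using assms by (auto simp: submodular_in_def)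
  then show ?thesis using assms(2)
  proof (induction)
    case (step y z)
    show ?case
    proof (cases "y = z")
      case False
      have "submodular_in H y" using step modular_inD(1)[OF step(2)] by (auto simp: submodular_in_def)
      from submodular_inD(3)[OF this] False step(2) show ?thesis by blast
    next
      case True
      then show ?thesis using step by blast
    qed
  qed auto
qed

end

section \<open>Images and preimages of modular and submodular subgroups\<close>

context group_hom
begin

lemma img_join: "A \<subseteq> carrier G \<Longrightarrow> B \<subseteq> carrier G \<Longrightarrow> h ` G.join A B = H.join (h ` A) (h ` B)"
  using generate_img[of "A \<union> B"] by (simp add: image_Un)

lemma preimage_subgroup:
  assumes "subgroup L H" shows "subgroup {x \<in> carrier G. h x \<in> L} G"
proof -
  interpret L: subgroup L H by fact
  show ?thesis by (rule G.subgroupI) (auto intro: exI[of _ "\<one>"])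
qed

text \<open>Every subgroup of the image of \<open>K\<close> is the image of its preimage
  \<open>?p L\<close> in \<open>K\<close>. Each law is therefore applied to preimages and pushed
  forward, since \<open>h\<close> commutes with joins.\<close>

lemma modular_in_image:
  assumes M: "G.modular_in M K" shows "H.modular_in (h ` M) (h ` K)"
proof (rule H.modular_inI)
  note m = G.modular_inD[OF M]
  note mc = subgroup.subset[OF m(1)] subgroup.subset[OF m(2)]
  show "subgroup (h ` M) H" "subgroup (h ` K) H" using m subgroup_img_is_subgroup by auto
  show "h ` M \<subseteq> h ` K" using m by auto
  let ?p = "\<lambda>L. {x \<in> carrier G. h x \<in> L} \<inter> K"
  have ps: "subgroup (?p L) G" if "subgroup L H" for L
    by (intro subgroups_Inter_pair preimage_subgroup that m G.subgroups_Inter_pair)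
  have hp: "h ` ?p L = L" if "L \<subseteq> h ` K" for L using that mc by blast
  have lift: "z \<in> h ` (A \<inter> ?p L)" if "z \<in> h ` A" "z \<in> L" "A \<subseteq> K" for z A L
    using that mc by blast
  have hI: "h ` (M \<inter> ?p L) \<subseteq> h ` M \<inter> L" for L by auto
  fix X Z z assume a: "subgroup X H" "subgroup Z H" "X \<subseteq> Z" "Z \<subseteq> h ` K" "z \<in> H.join X (h ` M)" "z \<in> Z"
  have c: "?p X \<subseteq> carrier G" "?p Z \<subseteq> carrier G" by auto
  have "z \<in> H.join (h ` ?p X) (h ` M)" using a by (subst hp) auto
  then have "z \<in> h ` G.join (?p X) M" using c mc by (simp add: img_join)
  moreover have "G.join (?p X) M \<subseteq> K" using m by (intro G.join_least) auto
  ultimately have "z \<in> h ` (G.join (?p X) M \<inter> ?p Z)" using a by (intro lift)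
  also have "G.join (?p X) M \<inter> ?p Z = G.join (?p X) (M \<inter> ?p Z)"
    using a by (intro m(4) ps) auto
  also have "h ` \<dots> = H.join (h ` ?p X) (h ` (M \<inter> ?p Z))" using mc by (intro img_join) auto
  also have "\<dots> = H.join X (h ` (M \<inter> ?p Z))" using a by (subst hp) auto
  also have "\<dots> \<subseteq> H.join X (h ` M \<inter> Z)" by (intro H.join_mono hI order_refl)
  finally show "z \<in> H.join X (h ` M \<inter> Z)" .
next
  note m = G.modular_inD[OF M]
  note mc = subgroup.subset[OF m(1)] subgroup.subset[OF m(2)]
  let ?p = "\<lambda>L. {x \<in> carrier G. h x \<in> L} \<inter> K"
  have ps: "subgroup (?p L) G" if "subgroup L H" for L
    by (intro subgroups_Inter_pair preimage_subgroup that m G.subgroups_Inter_pair)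
  have hp: "h ` ?p L = L" if "L \<subseteq> h ` K" for L using that mc by blast
  have lift: "z \<in> h ` (A \<inter> ?p L)" if "z \<in> h ` A" "z \<in> L" "A \<subseteq> K" for z A L
    using that mc by blast
  fix Y Z z assume a: "subgroup Y H" "subgroup Z H" "Y \<subseteq> h ` K" "Z \<subseteq> h ` K" "h ` M \<subseteq> Z"
    "z \<in> H.join (h ` M) Y" "z \<in> Z"
  have "z \<in> H.join (h ` M) (h ` ?p Y)" using a by (subst hp) auto
  then have "z \<in> h ` G.join M (?p Y)" using mc by (subst img_join) auto
  moreover have "G.join M (?p Y) \<subseteq> K" using m by (intro G.join_least) auto
  ultimately have "z \<in> h ` (G.join M (?p Y) \<inter> ?p Z)" using a by (intro lift)
  also have "G.join M (?p Y) \<inter> ?p Z = G.join M (?p Y \<inter> ?p Z)"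
    using a m mc by (intro m(5) ps) auto
  also have "h ` \<dots> = H.join (h ` M) (h ` (?p Y \<inter> ?p Z))" using mc by (intro img_join) auto
  also have "\<dots> \<subseteq> H.join (h ` M) (Y \<inter> Z)" by (intro H.join_mono) auto
  finally show "z \<in> H.join (h ` M) (Y \<inter> Z)" .
qed

lemma submodular_in_image:
  assumes "G.submodular_in M K" shows "H.submodular_in (h ` M) (h ` K)"
proof -
  have "G.modular_in\<^sup>*\<^sup>* M K" using assms by (auto simp: G.submodular_in_def)
  then have "H.modular_in\<^sup>*\<^sup>* (h ` M) (h ` K)"
    by (induction) (auto intro: rtranclp.rtrancl_into_rtrancl modular_in_image)
  then show ?thesis using G.submodular_inD[OF assms] subgroup_img_is_subgroup
    by (simp add: H.submodular_in_def)
qed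

text \<open>The law in \<open>H\<close> determines \<open>z\<close> up to a factor \<open>n\<close>
  in the kernel, and the preimage of \<open>M\<close> contains the kernel. The factor is absorbed by
  the join: it lies in \<open>?M\<close>, and in the first law also in \<open>Z\<close>, because
  both \<open>z\<close> and the approximating element \<open>y\<close> do.\<close>

lemma modular_in_preimage:
  assumes M: "H.modular_in M K" and K: "K \<subseteq> h ` carrier G"
  shows "G.modular_in {x \<in> carrier G. h x \<in> M} {x \<in> carrier G. h x \<in> K}"
proof -
  note m = H.modular_inD[OF M]
  let ?M = "{x \<in> carrier G. h x \<in> M}" and ?K = "{x \<in> carrier G. h x \<in> K}"
  have hM: "h ` ?M = M"
  proof (intro equalityI subsetI)
    fix y assume "y \<in> M"
    then have "y \<in> h ` carrier G" using m(3) K by (intro subsetD[OF K] subsetD[OF m(3)])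
    then show "y \<in> h ` ?M" using \<open>y \<in> M\<close> by (elim imageE) simp
  qed (elim imageE, simp)
  have split: "\<exists>y\<in>A. \<exists>n\<in>carrier G. z = y \<otimes> n \<and> h n = \<one>\<^bsub>H\<^esub>"
    if zA: "h z \<in> h ` A" "z \<in> carrier G" "A \<subseteq> carrier G" for z A
  proof -
    obtain y where y: "y \<in> A" "h y = h z" using zA(1) by (elim imageE) simp
    then have "h (inv y \<otimes> z) = \<one>\<^bsub>H\<^esub>" "z = y \<otimes> (inv y \<otimes> z)" "inv y \<otimes> z \<in> carrier G"
      using zA by (auto simp: subset_iff)
    then show ?thesis using y by blast
  qed
  show ?thesis
  proof (rule G.modular_inI)
    show s: "subgroup ?M G" "subgroup ?K G" using m preimage_subgroup by auto
    show "?M \<subseteq> ?K" using m by auto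
    fix X Z z assume a: "subgroup X G" "subgroup Z G" "X \<subseteq> Z" "Z \<subseteq> ?K" "z \<in> G.join X ?M" "z \<in> Z"
    note c = subgroup.subset[OF a(1)] subgroup.subset[OF a(2)]
    have "h z \<in> h ` G.join X ?M" using a(5) by (rule imageI)
    also have "\<dots> = H.join (h ` X) M" using c by (subst img_join) (auto simp: hM)
    finally have "h z \<in> H.join (h ` X) M \<inter> h ` Z" using a(6) by (intro IntI imageI)
    also have "\<dots> = H.join (h ` X) (M \<inter> h ` Z)"
      using a(1-4) by (intro m(4) subgroup_img_is_subgroup image_mono) auto
    also have "M \<inter> h ` Z = h ` (?M \<inter> Z)" using c(2) by blast
    also have "H.join (h ` X) (h ` (?M \<inter> Z)) = h ` G.join X (?M \<inter> Z)"
      using c by (subst img_join) auto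
    finally have hz: "h z \<in> h ` G.join X (?M \<inter> Z)" .
    have js: "subgroup (G.join X (?M \<inter> Z)) G" using c by (intro G.join_subgroup) auto
    have jZ: "G.join X (?M \<inter> Z) \<subseteq> Z" using a by (intro G.join_least) auto
    obtain y n where y: "y \<in> G.join X (?M \<inter> Z)" "n \<in> carrier G" "z = y \<otimes> n" "h n = \<one>\<^bsub>H\<^esub>"
      using split[OF hz _ subgroup.subset[OF js]] a(6) c by auto
    have yc: "y \<in> carrier G" "y \<in> Z" using y jZ c by auto
    have "inv y \<otimes> z \<in> Z" using yc a by (simp add: subgroup.m_closed subgroup.m_inv_closed)
    then have "n \<in> Z" using y yc by simp
    moreover have "n \<in> ?M" using y subgroup.one_closed[OF m(1)] by simp
    ultimately have "n \<in> G.join X (?M \<inter> Z)" using G.join_upper(2)[where A = X and B = "?M \<inter> Z"] by auto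
    then show "z \<in> G.join X (?M \<inter> Z)" using y js by (simp add: subgroup.m_closed)
  next
    fix Y Z z assume a: "subgroup Y G" "subgroup Z G" "Y \<subseteq> ?K" "Z \<subseteq> ?K" "?M \<subseteq> Z" "z \<in> G.join ?M Y" "z \<in> Z"
    note c = subgroup.subset[OF a(1)] subgroup.subset[OF a(2)]
    have "h z \<in> h ` G.join ?M Y" using a(6) by (rule imageI)
    also have "\<dots> = H.join M (h ` Y)" using c by (subst img_join) (auto simp: hM)
    finally have "h z \<in> H.join M (h ` Y) \<inter> h ` Z" using a(7) by (intro IntI imageI)
    also have "\<dots> = H.join M (h ` Y \<inter> h ` Z)"
    proof (intro m(5))
      show "M \<subseteq> h ` Z" using image_mono[OF a(5), of h] by (simp add: hM)
    next
      show "h ` Y \<subseteq> K" "h ` Z \<subseteq> K" using a(3,4) by auto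
    qed (intro subgroup_img_is_subgroup a)+
    also have "h ` Y \<inter> h ` Z = h ` (Y \<inter> Z)"
    proof (intro equalityI subsetI)
      fix w assume "w \<in> h ` Y \<inter> h ` Z"
      then obtain y z where w: "y \<in> Y" "z \<in> Z" "w = h y" "h y = h z" by auto
      have "h y \<in> h ` Z" unfolding w(4) using w(2) by (rule imageI)
      from split[OF this _ c(2)] obtain z' n where n: "z' \<in> Z" "n \<in> carrier G" "y = z' \<otimes> n" "h n = \<one>\<^bsub>H\<^esub>"
        using w(1) c(1) by blast
      have "n \<in> Z" using a(5) n subgroup.one_closed[OF m(1)] by auto
      then have "y \<in> Z" using n a(2) by (simp add: subgroup.m_closed)
      then show "w \<in> h ` (Y \<inter> Z)" unfolding w(3) using w(1) by (intro imageI IntI)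
    qed auto
    also have "H.join M (h ` (Y \<inter> Z)) = h ` G.join ?M (Y \<inter> Z)"
      using c by (subst img_join) (auto simp: hM)
    finally have hz: "h z \<in> h ` G.join ?M (Y \<inter> Z)" .
    have js: "subgroup (G.join ?M (Y \<inter> Z)) G" using c by (intro G.join_subgroup) auto
    obtain y n where y: "y \<in> G.join ?M (Y \<inter> Z)" "n \<in> carrier G" "z = y \<otimes> n" "h n = \<one>\<^bsub>H\<^esub>"
      using split[OF hz _ subgroup.subset[OF js]] a(7) c by auto
    have "n \<in> ?M" using y subgroup.one_closed[OF m(1)] by simp
    then have "n \<in> G.join ?M (Y \<inter> Z)" using G.join_upper(1)[where A = ?M and B = "Y \<inter> Z"] by auto
    then show "z \<in> G.join ?M (Y \<inter> Z)" using y js by (simp add: subgroup.m_closed)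
  qed
qed

lemma submodular_in_preimage:
  assumes M: "H.submodular_in M K" and K: "K \<subseteq> h ` carrier G"
  shows "G.submodular_in {x \<in> carrier G. h x \<in> M} {x \<in> carrier G. h x \<in> K}"
proof -
  have "H.modular_in\<^sup>*\<^sup>* M K" using M by (auto simp: H.submodular_in_def)
  then have "G.modular_in\<^sup>*\<^sup>* {x \<in> carrier G. h x \<in> M} {x \<in> carrier G. h x \<in> K}" using K
  proof (induction)
    case (step y z)
    have "y \<subseteq> z" using step(2) by (rule H.modular_inD(3))
    then show ?case using step modular_in_preimage[OF step(2)]
      by (auto intro: rtranclp.rtrancl_into_rtrancl)
  qed auto
  then show ?thesis using H.submodular_inD[OF M] preimage_subgroup by (simp add: G.submodular_in_def)
qed

end

section \<open>The class \<open>class_Z\<close> under conjugation, subgroups and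
  epimorphisms\<close>

context group
begin

lemma submodular_in_cj:
  assumes "submodular_in H K" "g \<in> carrier G" shows "submodular_in (cj g H) (cj g K)"
  using group_hom.submodular_in_image[OF cj_hom[OF assms(2)] assms(1)] by (simp add: cj_def)

lemma modular_in_cj:
  assumes "modular_in H K" "g \<in> carrier G" shows "modular_in (cj g H) (cj g K)"
  using group_hom.modular_in_image[OF cj_hom[OF assms(2)] assms(1)] by (simp add: cj_def)

definition Z_in :: "'a set \<Rightarrow> bool" where
  "Z_in K \<longleftrightarrow> subgroup K G \<and> (\<forall>p P. syl p P K \<longrightarrow> submodular_in P K)"

end

context finite_group
begin

lemma Z_in_iff: "subgroup K G \<Longrightarrow> class_Z (G\<lparr>carrier := K\<rparr>) \<longleftrightarrow> Z_in K"
  by (simp add: class_Z_def Z_in_def syl_iff submodular_in_iff subgroup_imp_group finite_subgroup)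

lemma class_Z_iff: "class_Z G \<longleftrightarrow> Z_in (carrier G)"
  using Z_in_iff[OF subgroup_self] by simp

text \<open>A Sylow subgroup \<open>Q\<close> of \<open>L\<close> lies in a Sylow subgroup
  \<open>P\<close> of \<open>K\<close>, and \<open>Q = P \<inter> L\<close> since the latter is a
  \<open>p\<close>-subgroup of \<open>L\<close>. Submodularity then restricts by
  intersection.\<close>

lemma Z_in_subgroup:
  assumes K: "Z_in K" and L: "subgroup L G" "L \<subseteq> K" shows "Z_in L"
  unfolding Z_in_def
proof (intro conjI L allI impI)
  fix p Q assume Q: "syl p Q L"
  note q = sylD[OF Q]
  have Ks: "subgroup K G" using K by (simp add: Z_in_def)
  obtain P where P: "syl p P K" "Q \<subseteq> P"
    using p_subgroup_in_syl[OF Ks q(1,3) _ q(5)] q(4) L by blast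
  note P' = sylD[OF P(1)]
  have s: "subgroup (P \<inter> L) G" using P'(3) L(1) by (rule subgroups_Inter_pair)
  have "card (P \<inter> L) dvd card P" using s P' by (intro card_dvd) auto
  then obtain j where j: "card (P \<inter> L) = p ^ j" using P'(1,5) divides_primepow_nat by auto
  obtain k where k: "k \<in> L" "P \<inter> L \<subseteq> cj k Q" using syl_contains[OF Q s _ j] by auto
  have "k \<in> carrier G" using L(1) k(1) by (rule subgroup.mem_carrier)
  then have "card (P \<inter> L) \<le> card Q"
    using card_le[OF cj_subgroup k(2)] q by (simp add: card_cj subgroup.subset)
  then have "Q = P \<inter> L" using s P q by (intro subgroup_card_eq) auto
  moreover have "submodular_in P K" using K P by (auto simp: Z_in_def)
  ultimately show "submodular_in Q L" using submodular_in_Int[of P K L] L by simp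
qed

end

lemma (in group_hom) card_img:
  assumes P: "subgroup P G" and f: "finite P"
  shows "card P = card (h ` P) * card (P \<inter> kernel G H h)"
proof -
  interpret P: subgroup P G by fact
  have "card {x \<in> P. h x = z} = card (P \<inter> kernel G H h)" if "z \<in> h ` P" for z
  proof -
    obtain g where g: "g \<in> P" "z = h g" using \<open>z \<in> h ` P\<close> by auto
    have "bij_betw (\<lambda>x. g \<otimes> x) (P \<inter> kernel G H h) {x \<in> P. h x = z}"
    proof (rule bij_betwI[where g = "\<lambda>x. inv g \<otimes> x"])
      show "(\<otimes>) g \<in> P \<inter> kernel G H h \<rightarrow> {x \<in> P. h x = z}" using g by (auto simp: kernel_def)
      show "(\<otimes>) (inv g) \<in> {x \<in> P. h x = z} \<rightarrow> P \<inter> kernel G H h" using g by (auto simp: kernel_def)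
    qed (use g in auto)
    then show ?thesis using bij_betw_same_card by fastforce
  qed
  then show ?thesis using card_eq_sum_fibres[OF f, of h] by simp
qed

locale finite_group_epi = group_hom + G: finite_group G + H: finite_group H +
  assumes onto: "h ` carrier G = carrier H"
begin

text \<open>The order of the image divides that of \<open>P\<close> and is a power of
  \<open>p\<close>; the index \<open>a\<close> of the image divides the index \<open>a * b\<close>
  of \<open>P\<close> and is prime to \<open>p\<close>.\<close>

lemma syl_image:
  assumes P: "G.syl p P (carrier G)" shows "H.syl p (h ` P) (carrier H)"
proof -
  note p = G.sylD[OF P]
  let ?N = "kernel G H h"
  have N: "subgroup ?N G" by (rule subgroup_kernel)
  have PN: "subgroup (P \<inter> ?N) G" using p(3) N by (rule G.subgroups_Inter_pair)
  have cG: "card (carrier G) = card (carrier H) * card ?N"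
    using card_img[OF G.subgroup_self] onto by (simp add: kernel_def Int_def)
  have cP: "card P = card (h ` P) * card (P \<inter> ?N)" using card_img[OF p(3)] p G.finite_subgroup by simp
  have hP: "subgroup (h ` P) H" using p subgroup_img_is_subgroup by simp
  obtain a where a: "card (carrier H) = card (h ` P) * a"
    using H.card_dvd[OF hP H.subgroup_self] subgroup.subset[OF hP] by (auto simp: dvd_def)
  obtain b where b: "card ?N = card (P \<inter> ?N) * b" using G.card_dvd[OF PN N] by (auto simp: dvd_def)
  have pos: "card (h ` P) > 0" "card (P \<inter> ?N) > 0" using H.card_subgroup_pos[OF hP] G.card_subgroup_pos[OF PN] by auto
  have "card (carrier G) = card P * (a * b)" unfolding cG cP a b by simp
  then have "\<not> p dvd a" using G.syl_index[OF P] G.card_subgroup_pos[OF p(3)] by auto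
  moreover obtain j where "card (h ` P) = p ^ j"
    using cP p(1,5) divides_primepow_nat[OF p(1), of "card (h ` P)"] by (metis dvd_triv_left)
  ultimately show ?thesis using p a pos hP subgroup.subset[OF hP] H.subgroup_self
    by (intro H.sylI) auto
qed

text \<open>\<open>P'\<close> is conjugate to the image of some Sylow subgroup; conjugating that
  Sylow subgroup by a preimage of the conjugating element gives one that maps onto
  \<open>P'\<close>.\<close>

lemma syl_lift:
  assumes P': "H.syl p P' (carrier H)"
  shows "\<exists>P. G.syl p P (carrier G) \<and> P' = h ` P"
proof -
  have "prime_nat p" using H.sylD[OF P'] by simp
  then obtain P0 where P0: "G.syl p P0 (carrier G)" using G.syl_exists[OF G.subgroup_self] by blast
  note p = subgroup.subset[OF G.sylD(3)[OF P0]]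
  obtain k where k: "k \<in> carrier H" "P' = H.cj k (h ` P0)" using H.syl_conj[OF syl_image[OF P0] P'] by blast
  obtain g where g: "g \<in> carrier G" "k = h g" using k onto by auto
  have "P' = h ` G.cj g P0" unfolding k g G.cj_def H.cj_def image_image
    using p g by (intro image_cong) auto
  then show ?thesis using G.cj_syl[OF P0 g(1)] by blast
qed

lemma class_Z_image:
  assumes "class_Z G" shows "class_Z H"
  unfolding H.class_Z_iff H.Z_in_def
proof (intro conjI allI impI H.subgroup_self)
  fix p P' assume "H.syl p P' (carrier H)"
  then obtain P where P: "G.syl p P (carrier G)" "P' = h ` P" using syl_lift by blast
  have "G.submodular_in P (carrier G)" using assms P by (auto simp: G.class_Z_iff G.Z_in_def)
  from submodular_in_image[OF this] show "H.submodular_in P' (carrier H)" using P onto by simp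
qed

end

section \<open>Maximal subgroups, subgroups of prime order and orbit counts\<close>

context group
begin

lemma subgroup_cj_carrier: "g \<in> carrier G \<Longrightarrow> cj g (carrier G) = carrier G"
  by (rule cj_subgroup_eq[OF subgroup_self])

lemma maximal_inD:
  assumes "maximal_in H K"
  shows "subgroup H G" "subgroup K G" "H \<subseteq> K" "H \<noteq> K"
    "\<And>Y. subgroup Y G \<Longrightarrow> H \<subseteq> Y \<Longrightarrow> Y \<subseteq> K \<Longrightarrow> Y \<noteq> H \<Longrightarrow> Y = K"
  using assms unfolding maximal_in_def by auto

lemma maximal_in_cj_carrier:
  assumes M: "maximal_in M (carrier G)" and g: "g \<in> carrier G"
  shows "maximal_in (cj g M) (carrier G)"
  unfolding maximal_in_def
proof (intro conjI allI impI)
  note m = maximal_inD[OF M]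
  show "subgroup (cj g M) G" using m(1) g by (simp add: cj_subgroup)
  have ne: "cj g M \<noteq> carrier G"
  proof
    assume "cj g M = carrier G"
    then have "cj (inv g) (cj g M) = carrier G" using g by (simp add: subgroup_cj_carrier)
    then show False using m(3,4) g by (simp add: cj_inv)
  qed
  then show "cj g M \<subset> carrier G" using m(3) g cj_closed[of M g] by auto
  fix Y assume Y: "subgroup Y G" "cj g M \<subset> Y" "Y \<subseteq> carrier G"
  have "M \<subseteq> cj (inv g) Y" using cj_subset_iff[of M Y g] Y m(3) g by auto
  moreover have "cj (inv g) Y \<noteq> M"
  proof
    assume "cj (inv g) Y = M"
    then have "cj g M = Y" using cj_inv(2)[of Y g] Y(3) g by simp
    then show False using Y(2) by simp
  qed
  moreover have "subgroup (cj (inv g) Y) G" using Y g by (simp add: cj_subgroup)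
  moreover have "cj (inv g) Y \<subseteq> carrier G" using Y(3) g by (simp add: cj_closed)
  ultimately have "cj (inv g) Y = carrier G" by (intro m(5))
  then have "cj g (carrier G) = Y" using cj_inv(2)[of Y g] Y(3) g by simp
  then show "Y = carrier G" using subgroup_cj_carrier[OF g] by simp
qed (rule subgroup_self)

text \<open>A subgroup \<open>Y\<close> of \<open>Z\<close> properly above
  \<open>Z \<inter> M\<close> is not inside \<open>M\<close>, so \<open>join Y M\<close> is the
  whole group, and the modular law gives
  \<open>Z = join Y (M \<inter> Z) \<subseteq> Y\<close>.\<close>

lemma modular_maximal_Int:
  assumes M: "modular_in M (carrier G)" "maximal_in M (carrier G)"
    and Z: "subgroup Z G" "\<not> Z \<subseteq> M"
  shows "maximal_in (Z \<inter> M) Z"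
  unfolding maximal_in_def
proof (intro conjI allI impI)
  note m = maximal_inD[OF M(2)]
  show "subgroup (Z \<inter> M) G" by (rule subgroups_Inter_pair[OF Z(1) m(1)])
  show "Z \<inter> M \<subset> Z" using Z(2) by blast
  fix Y assume Y: "subgroup Y G" "Z \<inter> M \<subset> Y" "Y \<subseteq> Z"
  have "join Y M = carrier G"
  proof (rule m(5))
    show "subgroup (join Y M) G" using Y(1) m(1) by (simp add: join_subgroup subgroup.subset)
    show "M \<subseteq> join Y M" by (rule join_upper)
    show "join Y M \<subseteq> carrier G" using Y(1) m(1) by (intro join_least subgroup_self subgroup.subset)
    have "Y \<subseteq> join Y M" by (rule join_upper)
    then show "join Y M \<noteq> M" using Y(2,3) by blast
  qed
  moreover have "join Y M \<inter> Z = join Y (M \<inter> Z)"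
    using Y Z subgroup.subset[OF Z(1)] by (intro modular_inD(4)[OF M(1)])
  moreover have "join Y (M \<inter> Z) \<subseteq> Y" using Y by (intro join_least) auto
  ultimately show "Y = Z" using Y(3) subgroup.subset[OF Z(1)] by auto
qed (rule Z(1))

lemma centralizer_Int_subgroup:
  assumes "subgroup S G" "h \<in> carrier G"
  shows "subgroup {x \<in> S. h \<otimes> x = x \<otimes> h} G"
proof -
  interpret S: subgroup S G by fact
  show ?thesis
  proof (rule subgroupI)
    have "\<one> \<in> {x \<in> S. h \<otimes> x = x \<otimes> h}" using assms(2) by simp
    then show "{x \<in> S. h \<otimes> x = x \<otimes> h} \<noteq> {}" by blast
  next
    fix a assume "a \<in> {x \<in> S. h \<otimes> x = x \<otimes> h}"
    then have a: "a \<in> S" "h \<otimes> a = a \<otimes> h" by auto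
    have "inv a \<otimes> (a \<otimes> h) \<otimes> inv a = inv a \<otimes> (h \<otimes> a) \<otimes> inv a" using a(2) by simp
    then have "h \<otimes> inv a = inv a \<otimes> h" using a(1) assms(2) by (simp add: m_assoc)
    then show "inv a \<in> {x \<in> S. h \<otimes> x = x \<otimes> h}" using a(1) by simp
  next
    fix a b assume "a \<in> {x \<in> S. h \<otimes> x = x \<otimes> h}" "b \<in> {x \<in> S. h \<otimes> x = x \<otimes> h}"
    then have a: "a \<in> S" "h \<otimes> a = a \<otimes> h" "b \<in> S" "h \<otimes> b = b \<otimes> h" by auto
    have "h \<otimes> (a \<otimes> b) = (h \<otimes> a) \<otimes> b" using a(1,3) assms(2) by (simp add: m_assoc)
    also have "\<dots> = a \<otimes> (h \<otimes> b)" unfolding a(2) using a(1,3) assms(2) by (simp add: m_assoc)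
    also have "\<dots> = a \<otimes> b \<otimes> h" unfolding a(4) using a(1,3) assms(2) by (simp add: m_assoc)
    finally show "a \<otimes> b \<in> {x \<in> S. h \<otimes> x = x \<otimes> h}" using a by simp
  qed auto
qed

end

context finite_group
begin

lemma index_mult:
  assumes "subgroup H G" "subgroup L G" "subgroup K G" "H \<subseteq> L" "L \<subseteq> K"
  shows "card K div card H = (card K div card L) * (card L div card H)"
proof -
  obtain a where a: "card L = card H * a" using card_dvd[OF assms(1,2,4)] by (auto simp: dvd_def)
  obtain b where b: "card K = card L * b" using card_dvd[OF assms(2,3,5)] by (auto simp: dvd_def)
  show ?thesis using a b card_subgroup_pos[OF assms(1)] card_subgroup_pos[OF assms(2)] by simp
qed

lemma syl_intermediate:
  assumes P: "syl p P K" and L: "subgroup L G" "P \<subseteq> L" "L \<subseteq> K"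
  shows syl_mono: "syl p P L" and syl_not_dvd_index: "\<not> p dvd card K div card L"
proof -
  note p = sylD[OF P]
  have "\<not> p dvd (card K div card L) * (card L div card P)"
    using syl_index[OF P] index_mult[OF p(3) L(1) p(2) L(2,3)] by simp
  then have "\<not> p dvd card L div card P" and i: "\<not> p dvd card K div card L" by auto
  then show "syl p P L" using p L by (intro sylI)
  show "\<not> p dvd card K div card L" by (rule i)
qed

lemma syl_nontrivial:
  assumes P: "syl p P K" and d: "p dvd card K" shows "p dvd card P" "P \<noteq> {\<one>}"
proof -
  note p = sylD[OF P]
  have "card K \<noteq> 0" using card_subgroup_pos[OF p(2)] by simp
  then have "multiplicity p (card K) > 0" using p(1) d by (simp add: prime_multiplicity_gt_zero_iff)
  then show "p dvd card P" using p(5) by simp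
  then show "P \<noteq> {\<one>}" using p(1) by auto
qed

lemma p_subgroup_card:
  assumes "subgroup H G" "H \<subseteq> P" "subgroup P G" "card P = p ^ k" "prime_nat p"
  shows "\<exists>j. card H = p ^ j"
proof -
  have "card H dvd p ^ k" using card_dvd[OF assms(1,3,2)] assms(4) by simp
  then show ?thesis using divides_primepow_nat[OF assms(5)] by auto
qed

lemma normal_syl_Int:
  assumes P: "syl p P K" "normal_in P K" and H: "subgroup H G" "H \<subseteq> K"
  shows "syl p (P \<inter> H) H" "normal_in (P \<inter> H) H"
proof -
  note p = sylD[OF P(1)]
  show n: "normal_in (P \<inter> H) H" by (rule normal_in_Int[OF P(2) H])
  obtain Q where Q: "syl p Q H" using syl_exists[OF H(1) p(1)] by blast
  note q = sylD[OF Q]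
  have "Q \<subseteq> P" using normal_syl_contains[OF P q(3) _ q(5)] q(4) H(2) by auto
  then have QP: "Q \<subseteq> P \<inter> H" using q(4) by auto
  have s: "subgroup (P \<inter> H) G" by (rule normal_inD(1)[OF n])
  obtain j where j: "card (P \<inter> H) = p ^ j" using p_subgroup_card[OF s _ p(3,5,1)] by auto
  obtain k where k: "k \<in> H" "P \<inter> H \<subseteq> cj k Q" using syl_contains[OF Q s _ j] by auto
  have "k \<in> carrier G" by (rule subgroup.mem_carrier[OF H(1) k(1)])
  then have "card (P \<inter> H) \<le> card Q"
    using card_le[OF cj_subgroup k(2)] q(3) by (simp add: card_cj subgroup.subset)
  then have "Q = P \<inter> H" using s QP by (intro subgroup_card_eq)
  then show "syl p (P \<inter> H) H" using Q by simp
qed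

lemma prime_card_subgroup:
  assumes "subgroup S G" "prime_nat (card S)" "subgroup H G" "H \<subseteq> S" "H \<noteq> {\<one>}"
  shows "H = S"
proof -
  have "card H dvd card S" using assms by (intro card_dvd)
  moreover have "card H \<noteq> 1" using assms card_eq_1 by auto
  ultimately have "card H = card S" using assms(2) by (auto simp: prime_nat_iff)
  then show ?thesis using assms by (intro subgroup_card_eq) auto
qed

text \<open>The elements of \<open>S\<close> commuting with \<open>h\<close> form a subgroup of a
  group of prime order; as it contains \<open>s \<noteq> \<one>\<close>, it is all of
  \<open>S\<close>.\<close>

lemma prime_card_centralizes:
  assumes "subgroup S G" "prime_nat (card S)" "h \<in> carrier G" "s \<in> S" "s \<noteq> \<one>" "h \<otimes> s = s \<otimes> h" "x \<in> S"
  shows "h \<otimes> x = x \<otimes> h"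
proof -
  have "{x \<in> S. h \<otimes> x = x \<otimes> h} = S"
    by (rule prime_card_subgroup[OF assms(1,2) centralizer_Int_subgroup[OF assms(1,3)]]) (use assms in auto)
  then show ?thesis using assms(7) by blast
qed

text \<open>The congruence between the numbers of cosets and of fixed cosets is an equality when
  both are below \<open>p\<close>. So \<open>S\<close> fixes every coset, which means that every
  conjugate of \<open>S\<close> lies in \<open>S\<close>.\<close>

lemma p_subgroup_small_index_normal:
  assumes S: "subgroup S G" "card S = p ^ k" "prime_nat p" and i: "card (rcosets S) < p"
  shows "normal_in S (carrier G)"
proof -
  let ?F = "{C \<in> rcosets S. \<forall>h\<in>S. C #> inv h = C}"
  have f: "finite (rcosets S)" using finite_subset[OF rcosets_subset_PowG[OF S(1)]] by simp
  have le: "card ?F \<le> card (rcosets S)" using f by (intro card_mono) auto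
  have "card (rcosets S) mod p = card ?F mod p" by (rule fixed_cosets[OF S(1,1,3,2)])
  then have "card ?F = card (rcosets S)" using i le by simp
  then have F: "?F = rcosets S" using f by (intro card_subset_eq) auto
  have "cj x S \<subseteq> S" if x: "x \<in> carrier G" for x
  proof (rule fixed_coset_cj[OF S(1,1) x])
    have "S #> x \<in> ?F" unfolding F using x S(1) by (simp add: rcosetsI subgroup.subset)
    then show "\<forall>h\<in>S. S #> x #> inv h = S #> x" by blast
  qed
  then show ?thesis using S(1) subgroup_self by (simp add: normal_in_def subgroup.subset)
qed

lemma exists_max_prime:
  assumes "1 < (n :: nat)"
  shows "\<exists>r. prime_nat r \<and> r dvd n \<and> (\<forall>s. prime_nat s \<longrightarrow> s dvd n \<longrightarrow> s \<le> r)"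
proof -
  let ?A = "{s. prime_nat s \<and> s dvd n}"
  have f: "finite ?A" using assms by (intro finite_subset[of ?A "{..n}"]) (auto dest: dvd_imp_le)
  have "?A \<noteq> {}" using prime_factor_nat[of n] assms by auto
  then have "Max ?A \<in> ?A" using f by (rule Max_in[rotated])
  then show ?thesis using f by (intro exI[of _ "Max ?A"]) auto
qed

lemma card_conjugates:
  assumes "subgroup H G"
  shows "card ((\<lambda>g. cj g H) ` carrier G) * card (nrm H) = order G"
proof -
  have Hc: "H \<subseteq> carrier G" by (rule subgroup.subset[OF assms])
  have "card {x \<in> carrier G. cj x H = z} = card (nrm H)" if "z \<in> (\<lambda>g. cj g H) ` carrier G" for z
  proof -
    obtain g where g: "g \<in> carrier G" "z = cj g H" using \<open>z \<in> _\<close> by blast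
    have "bij_betw (\<lambda>h. g \<otimes> h) (nrm H) {h \<in> carrier G. cj h H = z}"
    proof (rule bij_betwI[where g = "\<lambda>h. inv g \<otimes> h"])
      show "(\<otimes>) g \<in> nrm H \<rightarrow> {h \<in> carrier G. cj h H = z}"
        using g Hc by (auto simp: nrm_def cj_cj[symmetric])
      show "(\<otimes>) (inv g) \<in> {h \<in> carrier G. cj h H = z} \<rightarrow> nrm H"
        using g Hc by (auto simp: nrm_def cj_cj[symmetric] cj_inv)
    qed (use g in \<open>auto simp: nrm_def\<close>)
    then show ?thesis using bij_betw_same_card by fastforce
  qed
  then show ?thesis
    unfolding order_def using card_eq_sum_fibres[OF fin, of "\<lambda>g. cj g H"] by simp
qed

text \<open>A quotient living on coset representatives has the type of \<open>G\<close>, so that inductions on the order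
  may pass to quotients.\<close>

lemma coset_representative_quotient:
  assumes N: "N \<lhd> G"
  shows "\<exists>(G' :: ('a, 'b) monoid_scheme) \<rho>. finite_group_epi G G' \<rho> \<and> kernel G G' \<rho> = N"
proof -
  interpret N: normal N G by fact
  define \<rho> where "\<rho> = (\<lambda>x. SOME y. y \<in> N #> x)"
  have \<rho>: "\<rho> x \<in> N #> x" if "x \<in> carrier G" for x
    unfolding \<rho>_def using rcos_self[OF that N.subgroup_axioms] by (rule someI)
  have \<rho>c: "\<rho> x \<in> carrier G" if "x \<in> carrier G" for x
    using \<rho>[OF that] r_coset_subset_G[OF N.subset that] by blast
  have \<rho>N: "N #> \<rho> x = N #> x" if "x \<in> carrier G" for x
    using repr_independence[OF \<rho>[OF that] that N.subgroup_axioms] by simp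
  have \<rho>eq: "\<rho> x = \<rho> y \<longleftrightarrow> N #> x = N #> y" if "x \<in> carrier G" "y \<in> carrier G" for x y
  proof
    assume "\<rho> x = \<rho> y"
    then show "N #> x = N #> y" using \<rho>N[OF that(1)] \<rho>N[OF that(2)] by simp
  qed (simp add: \<rho>_def)
  have mult: "\<rho> (x \<otimes> y) = \<rho> (\<rho> x \<otimes> \<rho> y)" if "x \<in> carrier G" "y \<in> carrier G" for x y
    using that by (simp add: \<rho>eq \<rho>c N.rcos_sum[symmetric] \<rho>N)
  define H0 where "H0 = G\<lparr>mult := \<lambda>a b. \<rho> (a \<otimes> b)\<rparr>"
  have hom0: "\<rho> \<in> hom G H0" unfolding H0_def using mult \<rho>c by (auto simp: hom_def)
  define G' where "G' = H0\<lparr>carrier := \<rho> ` carrier G, one := \<rho> \<one>\<rparr>"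
  have grp: "group G'" unfolding G'_def using hom_imp_img_group[OF hom0] .
  have hom: "\<rho> \<in> hom G G'" using hom0 by (auto simp: hom_def G'_def)
  have c: "carrier G' = \<rho> ` carrier G" by (simp add: G'_def)
  have "finite_group_epi G G' \<rho>"
    by (intro finite_group_epi.intro group_hom.intro group_hom_axioms.intro finite_group.intro
        finite_group_axioms.intro finite_group_epi_axioms.intro)
      (use grp hom c in auto)
  moreover have "kernel G G' \<rho> = N"
  proof -
    have "\<rho> x = \<rho> \<one> \<longleftrightarrow> x \<in> N" if "x \<in> carrier G" for x
      using that coset_join1[OF _ that N.subgroup_axioms] coset_join2[OF that N.subgroup_axioms]
      by (auto simp: \<rho>eq N.subset)
    then show ?thesis using N.subset by (auto simp: kernel_def G'_def)
  qed
  ultimately show ?thesis by blast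
qed

text \<open>\<open>N\<close> is a Frobenius group with kernel \<open>S\<close> of prime order, and
  each member of the family meets \<open>N\<close> in a complement. Sending \<open>(s, X)\<close> to
  \<open>cj s X\<close>, for \<open>s \<in> S\<close> and members \<open>X\<close> containing
  \<open>h\<close>, is a bijection onto the family. It is applied to \<open>nrm S\<^sub>0\<close>
  with all conjugates of a subgroup \<open>M\<close>, and to \<open>M\<close> with all conjugates
  except \<open>M\<close>.\<close>

lemma card_conj_orbit:
  assumes N: "subgroup N G" and S: "normal_in S N" and p: "prime_nat p" "card S = p" and cN: "card N = p * l"
    and faithful: "\<And>h s. h \<in> N - S \<Longrightarrow> s \<in> S \<Longrightarrow> h \<otimes> s = s \<otimes> h \<Longrightarrow> s = \<one>"
    and X: "\<And>X. X \<in> \<X> \<Longrightarrow> subgroup X G" "\<And>X s. X \<in> \<X> \<Longrightarrow> s \<in> S \<Longrightarrow> cj s X \<in> \<X>"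
      "\<And>X. X \<in> \<X> \<Longrightarrow> S \<inter> X = {\<one>}" "\<And>X. X \<in> \<X> \<Longrightarrow> card (N \<inter> X) = l"
    and h: "h \<in> N - S"
  shows "card \<X> = p * card {X \<in> \<X>. h \<in> X}"
proof -
  note s = normal_inD[OF S]
  have Nc: "x \<in> carrier G" if "x \<in> N" for x using subgroup.mem_carrier[OF N that] .
  have Sc: "x \<in> carrier G" "x \<in> N" if "x \<in> S" for x using s(3) that Nc by auto
  have Ssub: "inv x \<otimes> y \<in> S" if "x \<in> S" "y \<in> S" for x y
    using that s(1) by (simp add: subgroup.m_closed subgroup.m_inv_closed)
  \<comment> \<open>the commutator of \<open>u\<close> and \<open>y\<close> lies in \<open>S \<inter> X = {\<one>}\<close>\<close>
  have key: "u = \<one>" if u: "u \<in> S" and y: "y \<in> N - S" "y \<in> X" "u \<otimes> y \<otimes> inv u \<in> X" and X': "X \<in> \<X>" for u y X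
  proof -
    note Xs = X(1)[OF X']
    have c: "u \<in> carrier G" "y \<in> carrier G" using Sc u Nc y by auto
    have "u \<otimes> y \<otimes> inv u \<otimes> inv y \<in> X"
      using y(2,3) Xs by (simp add: subgroup.m_closed subgroup.m_inv_closed)
    moreover have "y \<otimes> inv u \<otimes> inv y \<in> S"
      using s(4)[of y "inv u"] u y(1) s(1) by (auto simp: subgroup.m_inv_closed)
    then have "u \<otimes> (y \<otimes> inv u \<otimes> inv y) \<in> S" using u s(1) by (simp add: subgroup.m_closed)
    then have "u \<otimes> y \<otimes> inv u \<otimes> inv y \<in> S" using c by (simp add: m_assoc)
    ultimately have e: "u \<otimes> y \<otimes> inv u \<otimes> inv y = \<one>" using X(3)[OF X'] by blast
    have "u \<otimes> y = (u \<otimes> y \<otimes> inv u \<otimes> inv y) \<otimes> (y \<otimes> u)" using c by (simp add: m_assoc)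
    then have "y \<otimes> u = u \<otimes> y" unfolding e using c by simp
    then show ?thesis using faithful[OF y(1) u] by simp
  qed
  have conj_shift: "(inv s' \<otimes> s) \<otimes> y \<otimes> inv (inv s' \<otimes> s) = y'"
    if "s \<otimes> y \<otimes> inv s = s' \<otimes> y' \<otimes> inv s'" "s \<in> carrier G" "s' \<in> carrier G" "y \<in> carrier G" "y' \<in> carrier G" for s s' y y'
  proof -
    have "(inv s' \<otimes> s) \<otimes> y \<otimes> inv (inv s' \<otimes> s) = inv s' \<otimes> (s \<otimes> y \<otimes> inv s) \<otimes> s'"
      using that(2-) by (simp add: m_assoc inv_mult_group)
    also have "\<dots> = y'" unfolding that(1) using that(2-) by (simp add: m_assoc)
    finally show ?thesis .
  qed
  have eqI: "s = s'" if "inv s' \<otimes> s = \<one>" "s \<in> S" "s' \<in> S" for s s'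
  proof -
    have "s = s' \<otimes> (inv s' \<otimes> s)" using that(2,3) Sc(1) by simp
    then show ?thesis using that(1,3) Sc(1) by simp
  qed
  have surj: "\<exists>s\<in>S. h \<in> cj s X" if X': "X \<in> \<X>" for X
  proof -
    let ?Y = "N \<inter> X - {\<one>}" and ?g = "\<lambda>(s, y). s \<otimes> y \<otimes> inv s"
    have sNX: "subgroup (N \<inter> X) G" by (rule subgroups_Inter_pair[OF N X(1)[OF X']])
    have YS: "y \<in> N - S" if "y \<in> ?Y" for y using that X(3)[OF X'] by auto
    have "inj_on ?g (S \<times> ?Y)"
    proof (rule inj_onI)
      fix a b assume ab: "a \<in> S \<times> ?Y" "b \<in> S \<times> ?Y" "?g a = ?g b"
      obtain s y s' y' where a: "a = (s, y)" "b = (s', y')" by (cases a, cases b)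
      have m: "s \<in> S" "s' \<in> S" "y \<in> ?Y" "y' \<in> ?Y" using ab a by auto
      have e: "(inv s' \<otimes> s) \<otimes> y \<otimes> inv (inv s' \<otimes> s) = y'"
        using ab(3) a m Sc Nc by (intro conj_shift) auto
      have "inv s' \<otimes> s = \<one>"
        by (rule key[OF _ YS[OF m(3)] _ _ X']) (use m e Ssub in auto)
      then have ss: "s = s'" using eqI m by blast
      have "y = y'" using e m Sc Nc unfolding ss by (simp add: l_inv)
      then show "a = b" using a ss by simp
    qed
    \<comment> \<open>The conjugates of the complement \<open>N \<inter> X\<close> under
      \<open>S\<close> cover \<open>N - S\<close>, because both sets have \<open>p * (l - 1)\<close>
      elements; so \<open>h\<close> lies in one of these conjugates.\<close>
    then have "card (?g ` (S \<times> ?Y)) = p * (l - 1)"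
      using p X(4)[OF X'] subgroup.one_closed[OF sNX] finite_subgroup[OF sNX] finite_subgroup[OF s(1)]
      by (simp add: card_image card_cartesian_product)
    moreover have "card (N - S) = p * (l - 1)"
      using card_Diff_subset[of S N] finite_subgroup[OF s(1)] s(3) p cN by (simp add: diff_mult_distrib2)
    moreover have "?g ` (S \<times> ?Y) \<subseteq> N - S"
    proof
      fix z assume "z \<in> ?g ` (S \<times> ?Y)"
      then obtain s y where z: "s \<in> S" "y \<in> ?Y" "z = s \<otimes> y \<otimes> inv s" by auto
      have sy: "s \<in> N" "y \<in> N" "y \<notin> S" using Sc z YS by auto
      have zN: "z \<in> N" using sy z(3) N by (simp add: subgroup.m_closed subgroup.m_inv_closed)
      have "y = inv s \<otimes> z \<otimes> s" using z(3) sy Nc by (simp add: m_assoc)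
      then have "z \<notin> S" using normal_in_inv[OF S sy(1)] sy(3) by auto
      then show "z \<in> N - S" using zN by simp
    qed
    ultimately have "?g ` (S \<times> ?Y) = N - S"
      using finite_subgroup[OF N] by (intro card_subset_eq) auto
    then have "h \<in> ?g ` (S \<times> ?Y)" using h by simp
    then obtain s y where "s \<in> S" "y \<in> X" "h = s \<otimes> y \<otimes> inv s" by auto
    then show ?thesis unfolding cj_def by blast
  qed
  let ?f = "\<lambda>(s, X). cj s X" and ?Xh = "{X \<in> \<X>. h \<in> X}"
  have "inj_on ?f (S \<times> ?Xh)"
  proof (rule inj_onI)
    fix a b assume ab: "a \<in> S \<times> ?Xh" "b \<in> S \<times> ?Xh" "?f a = ?f b"
    obtain s Y s' Y' where a: "a = (s, Y)" "b = (s', Y')" by (cases a, cases b)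
    have m: "s \<in> S" "s' \<in> S" "Y \<in> \<X>" "Y' \<in> \<X>" "h \<in> Y" "h \<in> Y'" using ab a by auto
    have Yc: "Y \<subseteq> carrier G" "Y' \<subseteq> carrier G" using X(1) m by (auto simp: subgroup.subset)
    have c: "s \<in> carrier G" "s' \<in> carrier G" using Sc m by auto
    have "cj s Y = cj s' Y'" using ab(3) a by simp
    then have e: "cj (inv s' \<otimes> s) Y = Y'"
      using cj_cj[OF Yc(1), of "inv s'" s] cj_inv(1)[OF Yc(2) c(2)] c by simp
    \<comment> \<open>Both \<open>h\<close> and its conjugate by \<open>inv s' \<otimes> s\<close>
      lie in \<open>Y'\<close>, so \<open>key\<close> applies with \<open>y = h\<close>.\<close>
    have "(inv s' \<otimes> s) \<otimes> h \<otimes> inv (inv s' \<otimes> s) \<in> Y'" using cj_mem[OF m(5)] e by blast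
    then have "inv s' \<otimes> s = \<one>" using key[OF Ssub[OF m(2,1)] h m(6) _ m(4)] by simp
    then show "a = b" using a e eqI[OF _ m(1,2)] cj_one[OF Yc(1)] by simp
  qed
  moreover have "?f ` (S \<times> ?Xh) = \<X>"
  proof (intro equalityI subsetI)
    fix Y assume Y: "Y \<in> \<X>"
    obtain s where s': "s \<in> S" "h \<in> cj s Y" using surj[OF Y] by blast
    have "Y = cj (inv s) (cj s Y)" using cj_inv(1)[of Y s] X(1)[OF Y] Sc s' by (simp add: subgroup.subset)
    moreover have "inv s \<in> S" using s' s(1) by (simp add: subgroup.m_inv_closed)
    ultimately show "Y \<in> ?f ` (S \<times> ?Xh)" using s' X(2)[OF Y] by (intro image_eqI[of _ _ "(inv s, cj s Y)"]) auto
  qed (use X(2) in auto)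
  ultimately show ?thesis using p card_image[of ?f "S \<times> ?Xh"] by (simp add: card_cartesian_product)
qed

end

lemma (in group) normal_core:
  assumes N: "subgroup N G"
  shows "normal_in (\<Inter>g\<in>carrier G. cj g N) (carrier G)"
proof -
  define I where "I = (\<Inter>g\<in>carrier G. cj g N)"
  have "subgroup (\<Inter>((\<lambda>g. cj g N) ` carrier G)) G"
    using cj_subgroup[OF _ N(1)] by (intro subgroups_Inter) auto
  then have sI: "subgroup I G" by (simp add: I_def)
  have "cj k I \<subseteq> I" if k: "k \<in> carrier G" for k
  proof -
    have "cj k I \<subseteq> cj g N" if g: "g \<in> carrier G" for g
    proof -
      have "I \<subseteq> cj (inv k \<otimes> g) N" using k g by (auto simp: I_def)
      then have "cj k I \<subseteq> cj k (cj (inv k \<otimes> g) N)" by (rule cj_mono)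
      also have "\<dots> = cj g N" using k g subgroup.subset[OF N] by (simp add: cj_cj)
      finally show ?thesis .
    qed
    then show ?thesis by (auto simp: I_def)
  qed
  then show ?thesis unfolding I_def[symmetric]
    using sI subgroup_self subgroup.subset[OF sI] by (simp add: normal_in_def)
qed

lemma (in group) set_mult_subset:
  assumes "subgroup N G" "A \<subseteq> N" "B \<subseteq> N" shows "A <#> B \<subseteq> N"
proof
  fix x assume "x \<in> A <#> B"
  then obtain a b where "a \<in> N" "b \<in> N" "x = a \<otimes> b" using assms(2,3) by (auto simp: set_mult_def)
  then show "x \<in> N" using assms(1) by (simp add: subgroup.m_closed)
qed

section \<open>The Sylow subgroup of the largest prime\<close>

text \<open>A counterexample of minimal order with its induction hypotheses as assumptions. The
  prime in \<open>IH_sub\<close> is free, since a subgroup of order prime to \<open>r\<close> has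
  another largest prime. \<open>IH_quot\<close> expresses normality of the Sylow subgroup in the
  quotient by \<open>N\<close> through its full preimage \<open>S\<^sub>0 <#> N\<close>, so that the
  argument stays inside \<open>G\<close>.\<close>

locale largest_prime_counterexample = finite_group G for G (structure) +
  fixes r :: nat and S\<^sub>0 :: "'a set"
  assumes Z: "Z_in (carrier G)"
    and S0: "syl r S\<^sub>0 (carrier G)"
    and r_max: "\<And>s. prime_nat s \<Longrightarrow> s dvd card (carrier G) \<Longrightarrow> s \<le> r"
    and not_normal: "\<not> normal_in S\<^sub>0 (carrier G)"
    and IH_sub: "\<And>Y q Q. subgroup Y G \<Longrightarrow> Y \<noteq> carrier G \<Longrightarrow> syl q Q Y \<Longrightarrow>
      (\<And>s. prime_nat s \<Longrightarrow> s dvd card Y \<Longrightarrow> s \<le> q) \<Longrightarrow> normal_in Q Y"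
    and IH_quot: "\<And>N. normal_in N (carrier G) \<Longrightarrow> N \<noteq> {\<one>} \<Longrightarrow> normal_in (S\<^sub>0 <#> N) (carrier G)"
begin

lemma r_prime: "prime_nat r"
  using sylD(1)[OF S0] .

lemma dvd_order_trans: "subgroup Y G \<Longrightarrow> s dvd card Y \<Longrightarrow> s dvd card (carrier G)"
  using card_dvd[OF _ subgroup_self subgroup.subset] by (blast intro: dvd_trans)

lemma syl_not_normal: "syl r S (carrier G) \<Longrightarrow> \<not> normal_in S (carrier G)"
  using normal_syl_unique[of r S "carrier G" S\<^sub>0] S0 not_normal by auto

lemma nrm_proper:
  assumes "syl r S (carrier G)"
  shows "subgroup (nrm S) G" "nrm S \<noteq> carrier G" "S \<subseteq> nrm S" "normal_in S (nrm S)" "syl r S (nrm S)"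
proof -
  note s = sylD[OF assms]
  show n: "subgroup (nrm S) G" using s(4) by (rule nrm_subgroup)
  show sn: "S \<subseteq> nrm S" using s(3) by (rule subset_nrm)
  show "normal_in S (nrm S)" using s(3) by (rule normal_in_nrm)
  show "nrm S \<noteq> carrier G"
  proof
    assume "nrm S = carrier G"
    then have "normal_in S (carrier G)" using s(2,3,4) by (simp add: normal_in_iff_nrm)
    then show False using syl_not_normal[OF assms] by simp
  qed
  show "syl r S (nrm S)" by (rule syl_mono[OF assms n sn subgroup.subset[OF n]])
qed

lemma proper_normal:
  assumes S: "syl r S (carrier G)" and Y: "subgroup Y G" "S \<subseteq> Y" "Y \<noteq> carrier G"
  shows "normal_in S Y" "Y \<subseteq> nrm S"
proof -
  have "syl r S Y" by (rule syl_mono[OF S Y(1,2) subgroup.subset[OF Y(1)]])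
  from IH_sub[OF Y(1,3) this] show n: "normal_in S Y" using r_max dvd_order_trans[OF Y(1)] by simp
  then show "Y \<subseteq> nrm S" by (simp add: normal_in_iff_nrm)
qed

text \<open>Submodularity puts \<open>S\<close> into a proper modular subgroup \<open>M\<close>, and
  induction gives \<open>M \<subseteq> nrm S\<close>. If \<open>Y\<close> lies strictly above
  \<open>Z \<inter> nrm S\<close>, then \<open>join Y M\<close> contains \<open>S\<close> but is not
  inside \<open>nrm S\<close>, hence is the whole group; as
  \<open>M \<inter> Z \<subseteq> Y\<close>, the modular law returns \<open>Y = Z\<close>.\<close>

lemma nrm_Int_maximal:
  assumes S: "syl r S (carrier G)" and Z': "subgroup Z G" "\<not> Z \<subseteq> nrm S"
  shows "maximal_in (Z \<inter> nrm S) Z"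
proof -
  note n = nrm_proper[OF S] and s = sylD[OF S]
  have "submodular_in S (carrier G)" using Z S by (auto simp: Z_in_def)
  moreover have "S \<noteq> carrier G" using n subgroup.subset[OF n(1)] by blast
  ultimately obtain M where M: "modular_in M (carrier G)" "M \<noteq> carrier G" "S \<subseteq> M"
    using submodular_in_proper by blast
  note m = modular_inD[OF M(1)]
  have Mn: "M \<subseteq> nrm S" by (rule proper_normal(2)[OF S m(1) M(3,2)])
  show ?thesis
    unfolding maximal_in_def
  proof (intro conjI allI impI)
    show "subgroup (Z \<inter> nrm S) G" by (rule subgroups_Inter_pair[OF Z'(1) n(1)])
    show "Z \<inter> nrm S \<subset> Z" using Z'(2) by blast
    fix Y assume Y: "subgroup Y G" "Z \<inter> nrm S \<subset> Y" "Y \<subseteq> Z"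
    have j: "subgroup (join Y M) G" using Y(1) m(1) by (simp add: join_subgroup subgroup.subset)
    have "join Y M = carrier G"
    proof (rule ccontr)
      assume "join Y M \<noteq> carrier G"
      moreover have "S \<subseteq> join Y M" using M(3) join_upper(2)[where A = Y and B = M] by blast
      ultimately have "join Y M \<subseteq> nrm S" using proper_normal(2)[OF S j] by blast
      then have "Y \<subseteq> nrm S" using join_upper(1)[where A = Y and B = M] by blast
      then show False using Y(2,3) by blast
    qed
    moreover have "join Y M \<inter> Z = join Y (M \<inter> Z)"
      using Y Z' subgroup.subset[OF Z'(1)] by (intro m(4))
    moreover have "join Y (M \<inter> Z) \<subseteq> Y" using Y Mn by (intro join_least) auto
    ultimately show "Y = Z" using Y(3) subgroup.subset[OF Z'(1)] by auto
  qed (rule Z'(1))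
qed

text \<open>If the product were proper, \<open>S\<^sub>0\<close> would be a normal Sylow subgroup of
  it by induction, and the product itself is normal by \<open>IH_quot\<close>; then
  \<open>S\<^sub>0\<close> would be normal.\<close>

lemma set_mult_normal_eq_carrier:
  assumes N: "normal_in N (carrier G)" "N \<noteq> {\<one>}"
  shows "S\<^sub>0 <#> N = carrier G"
proof (rule ccontr)
  assume ne: "S\<^sub>0 <#> N \<noteq> carrier G"
  note s = sylD[OF S0]
  note m = subgroup_set_mult_normal[OF N(1) s(3,4)]
  have 1: "normal_in S\<^sub>0 (S\<^sub>0 <#> N)" by (rule proper_normal(1)[OF S0 m(1,2) ne])
  have "syl r S\<^sub>0 (S\<^sub>0 <#> N)" by (rule syl_mono[OF S0 m(1,2,4)])
  then have "normal_in S\<^sub>0 (carrier G)" by (rule normal_syl_trans[OF _ 1 IH_quot[OF N]])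
  then show False using not_normal by simp
qed

text \<open>A proper nontrivial normal subgroup yields a normal \<open>t\<close>-subgroup
  \<open>T\<close> with \<open>S\<^sub>0 <#> T\<close> the whole group, and comparing orders makes
  \<open>T\<close> minimal normal. The subgroup \<open>T \<inter> nrm S\<^sub>0\<close> is maximal
  in \<open>T\<close>, so it is normalized by \<open>T\<close> and by \<open>S\<^sub>0\<close> and
  must be trivial. Then \<open>T\<close> has order \<open>t < r\<close>, which is the index of
  \<open>S\<^sub>0\<close>: too small for \<open>S\<^sub>0\<close> not to be normal.\<close>

lemma simple:
  assumes N: "normal_in N (carrier G)" shows "N = {\<one>} \<or> N = carrier G"
proof (rule ccontr)
  assume "\<not> ?thesis"
  then have N1: "N \<noteq> {\<one>}" and NG: "N \<noteq> carrier G" by auto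
  note n = normal_inD[OF N]
  note s = sylD[OF S0]
  have "card N \<noteq> 1" using n(1) N1 card_eq_1 by simp
  then have "1 < card N" using card_subgroup_pos[OF n(1)] by simp
  then obtain t where t: "prime_nat t" "t dvd card N" "\<And>q. prime_nat q \<Longrightarrow> q dvd card N \<Longrightarrow> q \<le> t"
    using exists_max_prime by blast
  obtain T where T: "syl t T N" using syl_exists[OF n(1) t(1)] by blast
  note T' = sylD[OF T]
  have "normal_in T N" by (rule IH_sub[OF n(1) NG T t(3)])
  then have TG: "normal_in T (carrier G)" by (rule normal_syl_trans[OF T _ N])
  have T1: "T \<noteq> {\<one>}" by (rule syl_nontrivial(2)[OF T t(2)])
  have TC: "T \<subseteq> carrier G" by (rule subgroup.subset[OF T'(3)])
  have ST: "S\<^sub>0 <#> T = carrier G" by (rule set_mult_normal_eq_carrier[OF TG T1])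
  have S0C: "S\<^sub>0 \<noteq> carrier G"
  proof
    assume "S\<^sub>0 = carrier G"
    then have "normal_in S\<^sub>0 (carrier G)" using subset_nrm[OF s(3)] s(2,3) by (simp add: normal_in_iff_nrm)
    then show False using not_normal by simp
  qed
  have "t \<noteq> r"
  proof
    \<comment> \<open>In this case the normal subgroup \<open>T\<close> lies in a conjugate of
      \<open>S\<^sub>0\<close>, hence in \<open>S\<^sub>0\<close>, and the product would be no
      larger than \<open>S\<^sub>0\<close>.\<close>
    assume tr: "t = r"
    obtain k where k: "k \<in> carrier G" "T \<subseteq> cj k S\<^sub>0" using syl_contains[OF S0 T'(3) TC T'(5)[unfolded tr]] by blast
    have "cj (inv k) T \<subseteq> S\<^sub>0" using cj_subset_iff[of T S\<^sub>0 "inv k"] k TC s(4) by simp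
    moreover have "cj (inv k) T = T" using normal_in_cj[OF TG] k by simp
    ultimately have "S\<^sub>0 <#> T \<subseteq> S\<^sub>0" using s(3) by (intro set_mult_subset) auto
    then show False using ST S0C s(4) by blast
  qed
  then have tr: "t < r" using r_max[OF t(1)] dvd_order_trans[OF n(1) t(2)] by simp
  have coprime: "card (S\<^sub>0 \<inter> U) = 1" if U: "subgroup U G" "U \<subseteq> T" for U
  proof -
    have sI: "subgroup (S\<^sub>0 \<inter> U) G" by (rule subgroups_Inter_pair[OF s(3) U(1)])
    have "card (S\<^sub>0 \<inter> U) dvd card S\<^sub>0" "card (S\<^sub>0 \<inter> U) dvd card T"
      using U by (auto intro!: card_dvd sI s(3) T'(3))
    moreover have "coprime (card S\<^sub>0) (card T)"
      unfolding s(5) T'(5) using primes_coprime[OF s(1) t(1)] \<open>t \<noteq> r\<close> by simp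
    ultimately show ?thesis by (meson coprime_common_divisor_nat)
  qed
  have Tmin: "U = T" if U: "normal_in U (carrier G)" "U \<noteq> {\<one>}" "U \<subseteq> T" for U
  proof -
    note u = normal_inD[OF U(1)]
    have "card S\<^sub>0 * card U = card S\<^sub>0 * card T"
      using card_set_mult[OF s(3) u(1)] card_set_mult[OF s(3) T'(3)] coprime[OF u(1) U(3)] coprime[OF T'(3)]
        set_mult_normal_eq_carrier[OF U(1,2)] ST s(3) u(1) T'(3) finite_subgroup by simp
    then have "card U = card T" using card_subgroup_pos[OF s(3)] by simp
    then show ?thesis using U(3) T'(3) by (intro subgroup_card_eq) auto
  qed
  note ns = nrm_proper[OF S0]
  let ?T0 = "T \<inter> nrm S\<^sub>0"
  have Tn: "\<not> T \<subseteq> nrm S\<^sub>0"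
  proof
    assume "T \<subseteq> nrm S\<^sub>0"
    then have "S\<^sub>0 <#> T \<subseteq> nrm S\<^sub>0" using ns(1,3) by (intro set_mult_subset)
    then show False using ST ns(2) subgroup.subset[OF ns(1)] by blast
  qed
  have max: "maximal_in ?T0 T" by (rule nrm_Int_maximal[OF S0 T'(3) Tn])
  have n1: "normal_in ?T0 T" by (rule p_group_maximal_normal[OF t(1) T'(5) max])
  have sT0: "subgroup ?T0 G" by (rule normal_inD(1)[OF n1])
  have "normal_in (T \<inter> nrm S\<^sub>0) (nrm S\<^sub>0)" by (rule normal_in_Int[OF TG ns(1) subgroup.subset[OF ns(1)]])
  then have "S\<^sub>0 \<subseteq> nrm ?T0" "T \<subseteq> nrm ?T0" using n1 ns(3) by (auto simp: normal_in_iff_nrm)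
  moreover have sn: "subgroup (nrm ?T0) G" by (rule nrm_subgroup[OF subgroup.subset[OF sT0]])
  ultimately have "S\<^sub>0 <#> T \<subseteq> nrm ?T0" by (intro set_mult_subset)
  then have "normal_in ?T0 (carrier G)"
    using ST sT0 subgroup_self subgroup.subset[OF sT0] by (simp add: normal_in_iff_nrm)
  then have "?T0 = {\<one>}" using Tmin[of ?T0] Tn by auto
  then have "card T = t" using p_group_trivial_maximal[OF t(1) T'(5)] max by simp
  then have "card (carrier G) = card S\<^sub>0 * t"
    using card_set_mult[OF s(3) T'(3)] coprime[OF T'(3)] ST s(3) T'(3) finite_subgroup by simp
  moreover have "card (rcosets S\<^sub>0) * card S\<^sub>0 = card (carrier G)" using card_rcosets[OF s(3)] by (simp add: order_def)
  ultimately have "card (rcosets S\<^sub>0) = t" using card_subgroup_pos[OF s(3)] by simp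
  then have "normal_in S\<^sub>0 (carrier G)" using tr by (intro p_subgroup_small_index_normal[OF s(3,5,1)]) simp
  then show False using not_normal by simp
qed

text \<open>The intersection of all conjugates of \<open>N\<close> is normal and proper, so
  simplicity makes it trivial. Later a subgroup is eliminated by showing that it lies in every
  conjugate of a normalizer or of a modular maximal subgroup.\<close>

lemma core_trivial:
  assumes D: "\<And>g. g \<in> carrier G \<Longrightarrow> D \<subseteq> cj g N" and N: "subgroup N G" "N \<noteq> carrier G"
  shows "D \<subseteq> {\<one>}"
proof -
  define I where "I = (\<Inter>g\<in>carrier G. cj g N)"
  have Nc: "N \<subseteq> carrier G" by (rule subgroup.subset[OF N(1)])
  have IN: "I \<subseteq> N" using cj_one[OF Nc] unfolding I_def by (auto dest: bspec[of _ _ \<one>])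
  have "normal_in I (carrier G)" unfolding I_def by (rule normal_core[OF N(1)])
  from simple[OF this] have "I = {\<one>}" using IN N(2) Nc by auto
  moreover have "D \<subseteq> I" using D by (auto simp: I_def)
  ultimately show ?thesis by simp
qed

lemma nrm_not_carrier:
  assumes "subgroup H G" "H \<noteq> {\<one>}" "H \<noteq> carrier G" shows "nrm H \<noteq> carrier G"
proof
  assume "nrm H = carrier G"
  then have "normal_in H (carrier G)" using assms(1) subgroup_self subgroup.subset[OF assms(1)] by (simp add: normal_in_iff_nrm)
  then show False using simple assms by blast
qed

lemma nrm_eq_maximal:
  assumes M: "maximal_in M (carrier G)" and H: "normal_in H M" "H \<noteq> {\<one>}"
  shows "nrm H = M"
proof (rule ccontr)
  note m = maximal_inD[OF M] and h = normal_inD[OF H(1)]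
  assume "nrm H \<noteq> M"
  moreover have "subgroup (nrm H) G" "nrm H \<subseteq> carrier G"
    using nrm_subgroup[OF subgroup.subset[OF h(1)]] by (auto simp: subgroup.mem_carrier)
  moreover have "M \<subseteq> nrm H" using H(1) by (simp add: normal_in_iff_nrm)
  ultimately have "nrm H = carrier G" by (intro m(5))
  moreover have "H \<noteq> carrier G" using h(3) m(3,4) by auto
  ultimately show False using nrm_not_carrier[OF h(1) H(2)] by simp
qed

text \<open>For distinct Sylow \<open>r\<close>-subgroups \<open>P\<close> and \<open>Q\<close> one
  has \<open>P \<inter> nrm Q = P \<inter> Q\<close>, so the intersection is maximal, hence normal,
  in both. If it were nontrivial, its normalizer would be a proper subgroup with two different Sylow
  \<open>r\<close>-subgroups, against induction. So \<open>{\<one>}\<close> is maximal in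
  \<open>S\<close>.\<close>

lemma card_syl_r:
  assumes S: "syl r S (carrier G)" shows "card S = r"
proof -
  note s = sylD[OF S]
  have Int_max: "maximal_in (P \<inter> Q) P" if P: "syl r P (carrier G)" and Q: "syl r Q (carrier G)" and ne: "P \<noteq> Q" for P Q
  proof -
    note p = sylD[OF P] and q = sylD[OF Q] and n = nrm_proper[OF Q]
    have sub: "U \<subseteq> Q" if U: "subgroup U G" "U \<subseteq> P" "U \<subseteq> nrm Q" for U
    proof -
      obtain j where "card U = r ^ j" using p_subgroup_card[OF U(1,2) p(3,5) r_prime] by blast
      then show ?thesis by (rule normal_syl_contains[OF n(5,4) U(1,3)])
    qed
    have "\<not> P \<subseteq> nrm Q"
    proof
      assume "P \<subseteq> nrm Q"
      then have "P \<subseteq> Q" using sub[OF p(3)] by simp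
      then have "P = Q" using q(3) p(5) q(5) by (intro subgroup_card_eq) auto
      then show False using ne by simp
    qed
    then have m: "maximal_in (P \<inter> nrm Q) P" by (rule nrm_Int_maximal[OF Q p(3)])
    have "P \<inter> nrm Q \<subseteq> Q" using maximal_inD(1)[OF m] by (intro sub) auto
    then have "P \<inter> nrm Q = P \<inter> Q" using n(3) by auto
    then show ?thesis using m by simp
  qed
  obtain g where g: "g \<in> carrier G" "cj g S \<noteq> S"
    using syl_not_normal[OF S] s subgroup_self by (auto simp: normal_in_def)
  define P where "P = cj g S"
  have P: "syl r P (carrier G)" unfolding P_def by (rule cj_syl[OF S g(1)])
  have ne: "P \<noteq> S" using g by (simp add: P_def)
  note m1 = Int_max[OF P S ne] and m2 = Int_max[OF S P ne[symmetric], unfolded Int_commute[of S P]]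
  note p = sylD[OF P]
  have n1: "normal_in (P \<inter> S) P" by (rule p_group_maximal_normal[OF r_prime p(5) m1])
  have n2: "normal_in (P \<inter> S) S" by (rule p_group_maximal_normal[OF r_prime s(5) m2])
  have PS: "P \<inter> S = {\<one>}"
  proof (rule ccontr)
    let ?N = "nrm (P \<inter> S)"
    note d = normal_inD[OF n1]
    assume D: "P \<inter> S \<noteq> {\<one>}"
    have sub: "P \<subseteq> ?N" "S \<subseteq> ?N" using n1 n2 by (auto simp: normal_in_iff_nrm)
    have sN: "subgroup ?N G" using d(1) by (intro nrm_subgroup subgroup.subset)
    have "P \<inter> S \<noteq> carrier G" using nrm_proper(2,3)[OF S] s(4) subgroup.subset[OF nrm_proper(1)[OF S]] by blast
    then have NG: "?N \<noteq> carrier G" by (rule nrm_not_carrier[OF d(1) D])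
    have "normal_in S ?N" by (rule proper_normal(1)[OF S sN sub(2) NG])
    moreover have "syl r S ?N" by (rule syl_mono[OF S sN sub(2) subgroup.subset[OF sN]])
    moreover have "syl r P ?N" by (rule syl_mono[OF P sN sub(1) subgroup.subset[OF sN]])
    ultimately have "P = S" using normal_syl_unique by blast
    then show False using ne by simp
  qed
  show ?thesis using p_group_trivial_maximal[OF r_prime s(5)] m2 PS by simp
qed

text \<open>The centralizer \<open>C\<close> of \<open>S\<close> in \<open>H\<close> is normal in
  \<open>N\<close>: it is normalized by \<open>H\<close> and centralized by \<open>S\<close>. A
  maximal subgroup of \<open>N\<close> of order prime to \<open>p\<close> contains \<open>C\<close>,
  since otherwise its product with \<open>C\<close> would be \<open>N\<close>, whose order
  \<open>p\<close> divides. Thus \<open>C\<close> lies in every conjugate of \<open>M\<close> and is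
  trivial. The lemma serves for \<open>nrm S\<^sub>0\<close> as well as for \<open>M\<close>
  itself.\<close>

lemma faithful:
  assumes N: "subgroup N G" and S: "normal_in S N" and p: "prime_nat p" "card S = p"
    and M: "subgroup M G" "M \<noteq> carrier G"
    and H: "subgroup H G" "H \<subseteq> N" "N \<subseteq> H <#> S" "\<not> p dvd card H"
    and conj: "\<And>g. g \<in> carrier G \<Longrightarrow> N \<subseteq> cj g M \<or> maximal_in (N \<inter> cj g M) N \<and> \<not> p dvd card (N \<inter> cj g M)"
    and h: "h \<in> N - S" "s \<in> S" "h \<otimes> s = s \<otimes> h"
  shows "s = \<one>"
proof (rule ccontr)
  assume s1: "s \<noteq> \<one>"
  note s = normal_inD[OF S]
  have Nc: "x \<in> carrier G" if "x \<in> N" for x using subgroup.mem_carrier[OF N that] .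
  have Sc: "x \<in> carrier G" if "x \<in> S" for x using subgroup.mem_carrier[OF s(1) that] .
  have ps: "prime_nat (card S)" using p by simp
  have abel: "x \<otimes> y = y \<otimes> x" if "x \<in> S" "y \<in> S" for x y
  proof (cases "x = \<one>")
    case False
    show ?thesis by (rule prime_card_centralizes[OF s(1) ps Sc[OF that(1)] that(1) False refl that(2)])
  qed (use that Sc in simp)
  define C where "C = {c \<in> H. \<forall>x\<in>S. c \<otimes> x = x \<otimes> c}"
  have HN: "x \<in> N" "x \<in> carrier G" if "x \<in> H" for x using H(2) that Nc by auto
  have CC: "c \<in> carrier G" if "c \<in> C" for c using that HN by (auto simp: C_def)
  have Ccomm: "c \<otimes> x = x \<otimes> c" if "c \<in> C" "x \<in> S" for c x using that by (auto simp: C_def)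
  have C_eq: "C = H \<inter> (\<Inter>x\<in>S. {y \<in> H. x \<otimes> y = y \<otimes> x})"
    unfolding C_def by fastforce
  have "subgroup (\<Inter>(insert H ((\<lambda>x. {y \<in> H. x \<otimes> y = y \<otimes> x}) ` S))) G"
    using centralizer_Int_subgroup[OF H(1)] Sc H(1) by (intro subgroups_Inter) auto
  then have Cs: "subgroup C G" unfolding C_eq by simp
  have conjH: "k \<otimes> c \<otimes> inv k \<in> C" if k: "k \<in> H" and c: "c \<in> C" for k c
  proof -
    have "k \<otimes> c \<otimes> inv k \<in> H" using k c H(1) by (auto simp: C_def subgroup.m_closed subgroup.m_inv_closed)
    moreover have "k \<otimes> c \<otimes> inv k \<otimes> x = x \<otimes> (k \<otimes> c \<otimes> inv k)" if x: "x \<in> S" for x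
    proof -
      have kc: "k \<in> carrier G" "c \<in> carrier G" "x \<in> carrier G" using HN k CC c Sc x by auto
      have y: "inv k \<otimes> x \<otimes> k \<in> S" by (rule normal_in_inv[OF S HN(1)[OF k] x])
      have "k \<otimes> c \<otimes> inv k \<otimes> x = k \<otimes> (c \<otimes> (inv k \<otimes> x \<otimes> k)) \<otimes> inv k" using kc by (simp add: m_assoc)
      also have "\<dots> = k \<otimes> ((inv k \<otimes> x \<otimes> k) \<otimes> c) \<otimes> inv k" using Ccomm[OF c y] by simp
      also have "\<dots> = x \<otimes> (k \<otimes> c \<otimes> inv k)" using kc by (simp add: m_assoc)
      finally show ?thesis .
    qed
    ultimately show ?thesis by (simp add: C_def)
  qed
  have Cn: "normal_in C N"
  proof (rule normal_inI[OF Cs N])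
    show "C \<subseteq> N" using HN by (auto simp: C_def)
    fix k c assume k: "k \<in> N" and c: "c \<in> C"
    then obtain a b where ab: "a \<in> H" "b \<in> S" "k = a \<otimes> b" using H(3) by (auto simp: set_mult_def)
    have cc: "a \<in> carrier G" "b \<in> carrier G" "c \<in> carrier G" using HN ab Sc CC c by auto
    have "k \<otimes> c \<otimes> inv k = a \<otimes> ((b \<otimes> c) \<otimes> inv b) \<otimes> inv a" using ab(3) cc by (simp add: m_assoc inv_mult_group)
    also have "\<dots> = a \<otimes> c \<otimes> inv a" using Ccomm[OF c ab(2), symmetric] cc by (simp add: m_assoc)
    finally show "k \<otimes> c \<otimes> inv k \<in> C" using conjH[OF ab(1) c] by simp
  qed
  have "\<not> p dvd card C" using card_dvd[OF Cs H(1)] H(4) by (auto simp: C_def intro: dvd_trans)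
  have "C \<subseteq> cj g M" if g: "g \<in> carrier G" for g
  proof (cases "N \<subseteq> cj g M")
    case True then show ?thesis using HN by (auto simp: C_def)
  next
    case False
    then have m: "maximal_in (N \<inter> cj g M) N" and nd: "\<not> p dvd card (N \<inter> cj g M)" using conj[OF g] by auto
    let ?L = "N \<inter> cj g M"
    note mm = maximal_inD[OF m]
    note sm = subgroup_set_mult_normal[OF Cn mm(1,3)]
    have "?L <#> C \<noteq> N"
    proof
      assume "?L <#> C = N"
      then have "card N * card (?L \<inter> C) = card ?L * card C"
        using card_set_mult[OF mm(1) Cs] mm(1) Cs finite_subgroup by simp
      moreover have "p dvd card N" using card_dvd[OF s(1) N s(3)] p by simp
      ultimately have "p dvd card ?L * card C" by (metis dvd_mult2)
      then show False using p(1) nd \<open>\<not> p dvd card C\<close> by (simp add: prime_dvd_mult_iff)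
    qed
    then have "?L <#> C = ?L" using mm(5)[OF sm(1,2,4)] by blast
    then show ?thesis using sm(3) by auto
  qed
  then have C1: "C \<subseteq> {\<one>}" by (rule core_trivial[OF _ M])
  \<comment> \<open>As \<open>S\<close> has prime order, \<open>h\<close> centralizes all of
    \<open>S\<close>, and so does its factor \<open>b \<in> S\<close>. The factor
    \<open>a \<in> H\<close> is therefore in \<open>C\<close>, and \<open>h\<close> would lie in
    \<open>S\<close>.\<close>
  obtain a b where ab: "a \<in> H" "b \<in> S" "h = a \<otimes> b" using H(3) h(1) by (auto simp: set_mult_def)
  have cc: "a \<in> carrier G" "b \<in> carrier G" using HN ab Sc by auto
  have "a \<otimes> x = x \<otimes> a" if x: "x \<in> S" for x
  proof -
    have hx: "h \<otimes> y = y \<otimes> h" if "y \<in> S" for y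
      by (rule prime_card_centralizes[OF s(1) ps _ h(2) s1 h(3) that]) (use h Nc in auto)
    have xc: "x \<in> carrier G" using Sc x by simp
    have "h \<otimes> x = x \<otimes> h" by (rule hx[OF x])
    then have "x \<otimes> (a \<otimes> b) = a \<otimes> (b \<otimes> x)" using ab(3) cc xc by (simp add: m_assoc)
    then have "x \<otimes> (a \<otimes> b) = a \<otimes> (x \<otimes> b)" using abel[OF ab(2) x] by simp
    then have "x \<otimes> a \<otimes> b = a \<otimes> x \<otimes> b" using cc xc by (simp add: m_assoc)
    then show ?thesis using cc xc by simp
  qed
  then have "a \<in> C" using ab(1) by (simp add: C_def)
  then have "a = \<one>" using C1 by auto
  then show False using ab h(1) cc by simp
qed

end

section \<open>Modular maximal subgroups of order prime to \<open>r\<close>, and the final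
  count\<close>

context largest_prime_counterexample
begin

definition good :: "'a set \<Rightarrow> bool" where
  "good M \<longleftrightarrow> modular_in M (carrier G) \<and> maximal_in M (carrier G) \<and> \<not> r dvd card M"

text \<open>The division is exact because Sylow \<open>r\<close>-subgroups have order
  \<open>r\<close>. The value is the common order of the complements in \<open>nrm S\<close> and in
  every good subgroup.\<close>

definition l :: nat where
  "l = card (nrm S\<^sub>0) div r"

lemma syl_r_conj:
  assumes S: "syl r S (carrier G)"
  shows "\<exists>g\<in>carrier G. S = cj g S\<^sub>0 \<and> nrm S = cj g (nrm S\<^sub>0)"
proof -
  obtain g where g: "g \<in> carrier G" "S = cj g S\<^sub>0" using syl_conj[OF S0 S] by blast
  then show ?thesis using nrm_cj[of S\<^sub>0 g] sylD(4)[OF S0] by auto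
qed

lemma card_nrm:
  assumes S: "syl r S (carrier G)" shows "card (nrm S) = r * l"
proof -
  note n = nrm_proper[OF S0]
  obtain g where g: "g \<in> carrier G" "nrm S = cj g (nrm S\<^sub>0)" using syl_r_conj[OF S] by blast
  have "card (nrm S) = card (nrm S\<^sub>0)" using g card_cj[OF g(1) subgroup.subset[OF n(1)]] by simp
  moreover have "r dvd card (nrm S\<^sub>0)" using card_dvd[OF _ n(1,3)] card_syl_r[OF S0] sylD(3)[OF S0] by simp
  ultimately show ?thesis by (simp add: l_def)
qed

text \<open>For a prime \<open>t\<close> dividing the index of \<open>nrm S\<^sub>0\<close>, a Sylow
  \<open>t\<close>-subgroup lies in no normalizer of a Sylow \<open>r\<close>-subgroup, and neither
  does a proper modular \<open>M\<close> above it. If \<open>r\<close> divided its order,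
  \<open>M\<close> would contain a Sylow \<open>r\<close>-subgroup, whose order is \<open>r\<close>,
  and would lie in its normalizer. For maximality, a subgroup \<open>Y\<close> above
  \<open>M\<close> either contains \<open>S\<^sub>0\<close> or meets it trivially, and the second
  modular law turns the latter into \<open>Y = M\<close>.\<close>

lemma exists_good: "\<exists>M. good M"
proof -
  note n = nrm_proper[OF S0] and s = sylD[OF S0]
  have nC: "nrm S\<^sub>0 \<subseteq> carrier G" by (rule subgroup.subset[OF n(1)])
  let ?n = "card (carrier G) div card (nrm S\<^sub>0)"
  have idx: "card (carrier G) = card (nrm S\<^sub>0) * ?n" using card_dvd[OF n(1) subgroup_self nC] by simp
  have "?n \<noteq> 1"
  proof
    assume "?n = 1"
    then have "nrm S\<^sub>0 = carrier G" using idx nC subgroup_self by (intro subgroup_card_eq) auto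
    then show False using n(2) by simp
  qed
  then obtain t where t: "prime_nat t" "t dvd ?n" using prime_factor_nat by blast
  have "\<not> r dvd ?n" by (rule syl_not_dvd_index[OF S0 n(1,3) nC])
  then have tr: "t \<noteq> r" using t by auto
  obtain T where T: "syl t T (carrier G)" using syl_exists[OF subgroup_self t(1)] by blast
  note T' = sylD[OF T]
  have rS: "r dvd card (carrier G)" using card_dvd[OF s(3,2,4)] card_syl_r[OF S0] by simp
  have "T \<noteq> carrier G"
  proof
    assume "T = carrier G"
    then have "r dvd t ^ multiplicity t (card (carrier G))" using rS T'(5) by simp
    then have "r dvd t" using r_prime prime_dvd_power by blast
    then show False using tr t(1) r_prime primes_dvd_imp_eq by blast
  qed
  moreover have "submodular_in T (carrier G)" using Z T by (auto simp: Z_in_def)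
  ultimately obtain M where M: "modular_in M (carrier G)" "M \<noteq> carrier G" "T \<subseteq> M"
    using submodular_in_proper by blast
  note m = modular_inD[OF M(1)]
  have Mn: "\<not> M \<subseteq> nrm S" if S: "syl r S (carrier G)" for S
  proof
    assume "M \<subseteq> nrm S"
    then have "T \<subseteq> nrm S" using M(3) by simp
    then have "\<not> t dvd card (carrier G) div card (nrm S)"
      using nrm_proper(1)[OF S] by (intro syl_not_dvd_index[OF T] subgroup.subset)
    then show False using t(2) card_nrm[OF S] card_nrm[OF S0] by simp
  qed
  have rM: "\<not> r dvd card M"
  proof
    assume "r dvd card M"
    then obtain H where H: "subgroup H G" "H \<subseteq> M" "card H = r" using cauchy[OF m(1) r_prime] by blast
    obtain S where S: "syl r S (carrier G)" "H \<subseteq> S"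
      using p_subgroup_in_syl[OF subgroup_self r_prime H(1) subgroup.subset[OF H(1)], of 1] H(3) by auto
    have "H = S" using S H card_syl_r[OF S(1)] sylD(3)[OF S(1)] by (intro subgroup_card_eq) auto
    then have "M \<subseteq> nrm S" using proper_normal(2)[OF S(1) m(1) _ M(2)] H(2) by simp
    then show False using Mn[OF S(1)] by simp
  qed
  have jn: "join M S\<^sub>0 = carrier G"
  proof (rule ccontr)
    assume ne: "join M S\<^sub>0 \<noteq> carrier G"
    have "subgroup (join M S\<^sub>0) G" using m(1) s(4) by (simp add: join_subgroup subgroup.subset)
    then have "join M S\<^sub>0 \<subseteq> nrm S\<^sub>0"
      using proper_normal(2)[OF S0 _ _ ne] join_upper(2)[where A = M and B = "S\<^sub>0"] by blast
    then show False using Mn[OF S0] join_upper(1)[where A = M and B = "S\<^sub>0"] by blast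
  qed
  have "maximal_in M (carrier G)"
    unfolding maximal_in_def
  proof (intro conjI allI impI)
    show "M \<subset> carrier G" using m(3) M(2) by blast
    fix Y assume Y: "subgroup Y G" "M \<subset> Y" "Y \<subseteq> carrier G"
    have "S\<^sub>0 \<inter> Y \<noteq> {\<one>}"
    proof
      assume i: "S\<^sub>0 \<inter> Y = {\<one>}"
      have "join M S\<^sub>0 \<inter> Y = join M (S\<^sub>0 \<inter> Y)" using Y s by (intro m(5)) auto
      moreover have "join M (S\<^sub>0 \<inter> Y) \<subseteq> M" unfolding i using m(1) subgroup.one_closed[OF m(1)]
        by (intro join_least) auto
      ultimately show False using jn Y by auto
    qed
    then have "S\<^sub>0 \<inter> Y = S\<^sub>0" using r_prime card_syl_r[OF S0]
      by (intro prime_card_subgroup[OF s(3) _ subgroups_Inter_pair[OF s(3) Y(1)]]) auto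
    then have "join M S\<^sub>0 \<subseteq> Y" using Y by (intro join_least) auto
    then show "Y = carrier G" using jn Y(3) by simp
  qed (use m subgroup_self in auto)
  then show ?thesis using M rM by (auto simp: good_def)
qed

lemma goodD:
  assumes "good M"
  shows "modular_in M (carrier G)" "maximal_in M (carrier G)" "\<not> r dvd card M" "subgroup M G"
    "M \<subseteq> carrier G" "M \<noteq> carrier G"
  using assms maximal_inD[of M "carrier G"] by (auto simp: good_def subgroup.mem_carrier)

lemma good_cj:
  assumes M: "good M" and g: "g \<in> carrier G" shows "good (cj g M)"
  using goodD[OF M] g modular_in_cj[of M "carrier G" g] maximal_in_cj_carrier[of M g]
  by (simp add: good_def subgroup_cj_carrier card_cj)

text \<open>Each of \<open>M\<close> and \<open>nrm S\<close> cuts out a maximal subgroup of the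
  other, so the intersection is maximal in both. As \<open>r\<close> does not divide the order of
  \<open>M\<close>, the intersection meets \<open>S\<close> trivially and complements it in
  \<open>nrm S\<close>.\<close>

lemma good_nrm:
  assumes M: "good M" and S: "syl r S (carrier G)"
  shows "maximal_in (nrm S \<inter> M) (nrm S)" "maximal_in (nrm S \<inter> M) M" "S \<inter> M = {\<one>}"
    "(nrm S \<inter> M) <#> S = nrm S" "card (nrm S \<inter> M) = l"
proof -
  note m = goodD[OF M] and n = nrm_proper[OF S] and s = sylD[OF S]
  have rn: "r dvd card (nrm S)" using card_nrm[OF S] by simp
  show SM: "S \<inter> M = {\<one>}"
  proof (rule ccontr)
    assume "S \<inter> M \<noteq> {\<one>}"
    then have "S \<inter> M = S" using r_prime card_syl_r[OF S]
      by (intro prime_card_subgroup[OF s(3) _ subgroups_Inter_pair[OF s(3) m(4)]]) auto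
    then have "card S dvd card M" using s(3) m(4) by (intro card_dvd) auto
    then show False using card_syl_r[OF S] m(3) by simp
  qed
  have nM: "\<not> nrm S \<subseteq> M"
    using SM n(3) s(3) card_syl_r[OF S] r_prime card_eq_1[OF s(3)] by auto
  show max: "maximal_in (nrm S \<inter> M) (nrm S)" by (rule modular_maximal_Int[OF m(1,2) n(1) nM])
  have "\<not> M \<subseteq> nrm S"
  proof
    assume a: "M \<subseteq> nrm S"
    have "nrm S \<noteq> M" using nM by auto
    then have "nrm S = carrier G"
      using maximal_inD(5)[OF m(2) n(1) a subgroup.subset[OF n(1)]] by simp
    then show False using n(2) by simp
  qed
  then show "maximal_in (nrm S \<inter> M) M" using nrm_Int_maximal[OF S m(4)] by (simp add: Int_commute)
  note mm = maximal_inD[OF max]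
  note sm = subgroup_set_mult_normal[OF n(4) mm(1,3)]
  have "(nrm S \<inter> M) <#> S \<noteq> nrm S \<inter> M"
  proof
    assume "(nrm S \<inter> M) <#> S = nrm S \<inter> M"
    then have "S \<subseteq> M" using sm(3) by auto
    then have "S = {\<one>}" using SM by auto
    then show False using card_syl_r[OF S] r_prime by auto
  qed
  then show eq: "(nrm S \<inter> M) <#> S = nrm S" using mm(5)[OF sm(1,2,4)] by simp
  have "card (nrm S \<inter> M \<inter> S) = 1" using SM n(3) by (auto simp: card_1_singleton_iff)
  then have "card (nrm S) = card (nrm S \<inter> M) * r"
    using card_set_mult[OF mm(1) s(3)] eq mm(1) s(3) finite_subgroup card_syl_r[OF S] by simp
  then show "card (nrm S \<inter> M) = l" using card_nrm[OF S] r_prime by (simp add: mult.commute)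
qed

text \<open>\<open>T\<close> is the Sylow subgroup of \<open>M\<close> for its largest prime, normal
  in \<open>M\<close> by induction and with normalizer \<open>M\<close> by simplicity. Each
  \<open>nrm S\<close> cuts out a maximal subgroup of \<open>T\<close>; once this is trivial,
  \<open>T\<close> has prime order and \<open>nrm S \<inter> M\<close> complements it in
  \<open>M\<close>.\<close>

lemma good_structure:
  assumes M: "good M"
  shows "\<exists>t T. t < r \<and> syl t T M \<and> normal_in T M \<and> nrm T = M \<and> card T = t \<and> card M = t * l
    \<and> (\<forall>S. syl r S (carrier G) \<longrightarrow> T \<inter> nrm S = {\<one>} \<and> (nrm S \<inter> M) <#> T = M)"
proof -
  note m = goodD[OF M]
  have "M \<noteq> {\<one>}"
  proof
    assume "M = {\<one>}"
    moreover have "nrm S\<^sub>0 \<inter> M \<subset> M" using maximal_inD(3,4)[OF good_nrm(2)[OF M S0]] by auto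
    moreover have "\<one> \<in> nrm S\<^sub>0" by (rule subgroup.one_closed[OF nrm_proper(1)[OF S0]])
    ultimately show False by auto
  qed
  then have "1 < card M" using card_eq_1[OF m(4)] card_subgroup_pos[OF m(4)] by linarith
  then obtain t where t: "prime_nat t" "t dvd card M" "\<And>s. prime_nat s \<Longrightarrow> s dvd card M \<Longrightarrow> s \<le> t"
    using exists_max_prime by blast
  have tr: "t \<noteq> r" using t(2) m(3) by auto
  then have tlr: "t < r" using r_max[OF t(1) dvd_order_trans[OF m(4) t(2)]] by simp
  obtain T where T: "syl t T M" using syl_exists[OF m(4) t(1)] by blast
  note T' = sylD[OF T]
  have TM: "normal_in T M" by (rule IH_sub[OF m(4,6) T t(3)])
  have T1: "T \<noteq> {\<one>}" by (rule syl_nontrivial(2)[OF T t(2)])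
  have nT: "nrm T = M" by (rule nrm_eq_maximal[OF m(2) TM T1])
  \<comment> \<open>If \<open>T\<close> lay in one normalizer, its order would divide
    \<open>l\<close>, the order of \<open>nrm P \<inter> M\<close> for every \<open>P\<close>. The
    Sylow subgroup \<open>T \<inter> (nrm P \<inter> M)\<close> of that group would then be as large
    as \<open>T\<close>, and \<open>T\<close> would lie in all conjugates of
    \<open>nrm S\<^sub>0\<close>.\<close>
  have Tn: "\<not> T \<subseteq> nrm S" if S: "syl r S (carrier G)" for S
  proof
    assume a: "T \<subseteq> nrm S"
    have "T \<subseteq> nrm S \<inter> M" using a T'(4) by auto
    then have d: "card T dvd l"
      using card_dvd[OF T'(3) maximal_inD(1)[OF good_nrm(1)[OF M S]]] good_nrm(5)[OF M S] by simp
    have sub: "T \<subseteq> nrm P" if P: "syl r P (carrier G)" for P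
    proof -
      note i = maximal_inD[OF good_nrm(2)[OF M P]]
      note ti = normal_syl_Int[OF T TM i(1,3)]
      have l0: "l \<noteq> 0" using good_nrm(5)[OF M P] card_subgroup_pos[OF i(1)] by simp
      have "t ^ multiplicity t (card M) dvd l" using d T'(5) by simp
      then have "multiplicity t (card M) \<le> multiplicity t l"
        using l0 t(1) by (intro multiplicity_geI) auto
      then have "card T \<le> card (T \<inter> (nrm P \<inter> M))"
        using sylD(5)[OF ti(1)] T'(5) good_nrm(5)[OF M P] prime_gt_0_nat[OF t(1)]
        by (simp add: power_increasing)
      then have "T \<inter> (nrm P \<inter> M) = T" using T'(3) by (intro subgroup_card_eq) auto
      then show ?thesis by auto
    qed
    have "T \<subseteq> cj g (nrm S\<^sub>0)" if g: "g \<in> carrier G" for g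
      using sub[OF cj_syl[OF S0 g]] nrm_cj[of S\<^sub>0 g] sylD(4)[OF S0] g by simp
    then have "T \<subseteq> {\<one>}" using nrm_proper(1,2)[OF S0] by (rule core_trivial)
    then show False using T1 subgroup.one_closed[OF T'(3)] by blast
  qed
  have main: "T \<inter> nrm S = {\<one>} \<and> (nrm S \<inter> M) <#> T = M \<and> card T = t" if S: "syl r S (carrier G)" for S
  proof -
    \<comment> \<open>\<open>T \<inter> nrm P\<close> is normal in \<open>M\<close> and a Sylow subgroup of \<open>nrm P\<close>; Sylow's theorem in \<open>nrm P\<close>
      makes it independent of \<open>P\<close>, so it lies in a proper normal subgroup.\<close>
    have D: "maximal_in (T \<inter> nrm P) T" "normal_in (T \<inter> nrm P) M" "syl t (T \<inter> nrm P) (nrm P)"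
        "(nrm P \<inter> M) <#> T = M" "card (T \<inter> nrm P) * card M = card T * l"
      if P: "syl r P (carrier G)" for P
    proof -
      note i = maximal_inD[OF good_nrm(2)[OF M P]]
      note n = nrm_proper[OF P]
      show max: "maximal_in (T \<inter> nrm P) T" by (rule nrm_Int_maximal[OF P T'(3) Tn[OF P]])
      have n1: "normal_in (T \<inter> nrm P) T" by (rule p_group_maximal_normal[OF t(1) T'(5) max])
      have e: "T \<inter> (nrm P \<inter> M) = T \<inter> nrm P" using T'(4) by auto
      note ti = normal_syl_Int[OF T TM i(1,3), unfolded e]
      note sm = subgroup_set_mult_normal[OF TM i(1,3)]
      have "(nrm P \<inter> M) <#> T \<noteq> nrm P \<inter> M" using sm(3) Tn[OF P] by blast
      then show eq: "(nrm P \<inter> M) <#> T = M" using i(5)[OF sm(1,2,4)] by simp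
      have dG: "subgroup (T \<inter> nrm P) G" by (rule normal_inD(1)[OF n1])
      have "T \<subseteq> nrm (T \<inter> nrm P)" "nrm P \<inter> M \<subseteq> nrm (T \<inter> nrm P)"
        using n1 ti(2) by (auto simp: normal_in_iff_nrm)
      then have "(nrm P \<inter> M) <#> T \<subseteq> nrm (T \<inter> nrm P)"
        by (intro set_mult_subset nrm_subgroup subgroup.subset[OF dG])
      then show "normal_in (T \<inter> nrm P) M" using eq dG m(4) T'(4) by (auto simp: normal_in_iff_nrm)
      \<comment> \<open>Since \<open>t \<noteq> r\<close>, a Sylow \<open>t\<close>-subgroup of
        \<open>nrm P \<inter> M\<close>, which has order \<open>l\<close>, is also one of
        \<open>nrm P\<close>, which has order \<open>r * l\<close>.\<close>
      have "multiplicity t (r * l) = multiplicity t l"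
      proof -
        have "l \<noteq> 0" using good_nrm(5)[OF M P] card_subgroup_pos[OF i(1)] by simp
        moreover have "multiplicity t r = 0"
          using tr t(1) r_prime by (intro not_dvd_imp_multiplicity_0) (auto dest: primes_dvd_imp_eq)
        ultimately show ?thesis using t(1) r_prime
          by (subst prime_elem_multiplicity_mult_distrib) auto
      qed
      then show "syl t (T \<inter> nrm P) (nrm P)"
        using sylD[OF ti(1)] n(1) card_nrm[OF P] good_nrm(5)[OF M P] by (auto simp: syl_def)
      show "card (T \<inter> nrm P) * card M = card T * l"
        using card_set_mult[OF i(1) T'(3)] eq i(1) T'(3) finite_subgroup good_nrm(5)[OF M P] e
        by (simp add: Int_commute mult.commute)
    qed
    have "T \<inter> nrm S = {\<one>}"
    proof (rule ccontr)
      assume ne: "T \<inter> nrm S \<noteq> {\<one>}"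
      note dS = D[OF S] and s = sylD[OF S] and nS = nrm_proper[OF S]
      note nsub = subgroup.subset[OF nS(1)]
      have dG: "subgroup (T \<inter> nrm S) G" by (rule normal_inD(1)[OF dS(2)])
      have dC: "T \<inter> nrm S \<subseteq> carrier G" by (rule subgroup.subset[OF dG])
      have nD: "nrm (T \<inter> nrm S) = M" by (rule nrm_eq_maximal[OF m(2) dS(2) ne])
      have nrmM: "nrm M = M"
      proof (rule ccontr)
        assume "nrm M \<noteq> M"
        then have "nrm M = carrier G"
          using nrm_subgroup[OF m(5)] subset_nrm[OF m(4)] by (intro maximal_inD(5)[OF m(2)] subgroup.subset)
        then show False using nrm_not_carrier[OF m(4) \<open>M \<noteq> {\<one>}\<close> m(6)] by simp
      qed
      have "T \<inter> nrm S \<subseteq> cj g (nrm S)" if g: "g \<in> carrier G" for g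
      proof -
        let ?P = "cj g S"
        have P: "syl r ?P (carrier G)" by (rule cj_syl[OF S g])
        note dP = D[OF P]
        have nP: "nrm ?P = cj g (nrm S)" using nrm_cj[OF s(4) g] .
        have "syl t (cj g (T \<inter> nrm S)) (nrm ?P)"
          using sylD[OF dS(3)] g cj_mono[of "T \<inter> nrm S" "nrm S" g] nsub dC
          unfolding nP syl_def by (simp add: cj_subgroup card_cj)
        then obtain h where h: "h \<in> nrm ?P" "T \<inter> nrm ?P = cj h (cj g (T \<inter> nrm S))"
          using syl_conj[OF _ dP(3)] by blast
        have hc: "h \<in> carrier G" using h(1) by (simp add: nrm_def)
        then have e: "T \<inter> nrm ?P = cj (h \<otimes> g) (T \<inter> nrm S)" using h(2) cj_cj[OF dC hc g] by simp
        have "card (T \<inter> nrm ?P) = card (T \<inter> nrm S)" unfolding e using hc g dC by (intro card_cj) auto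
        then have "card (T \<inter> nrm ?P) \<noteq> 1" using ne card_eq_1[OF dG] by simp
        then have "T \<inter> nrm ?P \<noteq> {\<one>}" by auto
        then have "nrm (T \<inter> nrm ?P) = M" by (rule nrm_eq_maximal[OF m(2) dP(2)])
        \<comment> \<open>\<open>M\<close> is the normalizer of both intersections, so
          \<open>h \<otimes> g\<close> normalizes \<open>M\<close>. As \<open>M\<close> is
          self-normalizing, \<open>h \<otimes> g\<close> lies in \<open>M\<close> and normalizes
          \<open>T \<inter> nrm S\<close>, and the two intersections coincide.\<close>
        then have "cj (h \<otimes> g) M = M" unfolding e using nrm_cj[OF dC, of "h \<otimes> g"] nD hc g by simp
        then have "h \<otimes> g \<in> nrm M" using hc g by (simp add: nrm_def)
        then have "h \<otimes> g \<in> nrm (T \<inter> nrm S)" using nrmM nD by simp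
        then have "T \<inter> nrm ?P = T \<inter> nrm S" unfolding e by (simp add: nrm_def)
        then show ?thesis using nP by auto
      qed
      then have "T \<inter> nrm S \<subseteq> {\<one>}" using nS(1,2) by (rule core_trivial)
      then show False using ne subgroup.one_closed[OF dG] by blast
    qed
    moreover then have "card T = t" using p_group_trivial_maximal[OF t(1) T'(5)] D(1)[OF S] by simp
    ultimately show ?thesis using D(4)[OF S] by simp
  qed
  have "card M = t * l"
  proof -
    have "card ((nrm S\<^sub>0 \<inter> M) \<inter> T) = 1"
      using main[OF S0] T'(4) by (metis Int_absorb2 Int_assoc Int_commute is_singletonI is_singleton_altdef)
    then show ?thesis
      using card_set_mult[OF maximal_inD(1)[OF good_nrm(1)[OF M S0]] T'(3)] main[OF S0]
        good_nrm(5)[OF M S0] finite_subgroup T'(3) maximal_inD(1)[OF good_nrm(1)[OF M S0]] by (simp add: mult.commute)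
  qed
  then show ?thesis using tlr T TM nT main S0 by blast
qed

lemma contradiction: False
proof -
  obtain M where M: "good M" using exists_good by blast
  note m = goodD[OF M]
  obtain t T where t: "t < r" "syl t T M" "normal_in T M" "nrm T = M" "card T = t" "card M = t * l"
    and TS: "\<And>S. syl r S (carrier G) \<Longrightarrow> T \<inter> nrm S = {\<one>}" "\<And>S. syl r S (carrier G) \<Longrightarrow> (nrm S \<inter> M) <#> T = M"
    using good_structure[OF M] by blast
  note T' = sylD[OF t(2)] and n = nrm_proper[OF S0] and s = sylD[OF S0]
  have cS: "card S\<^sub>0 = r" by (rule card_syl_r[OF S0])
  have tl: "\<not> t dvd l"
    using syl_index[OF t(2)] t(5,6) T'(1) by (simp add: prime_gt_0_nat)
  define \<M> where "\<M> = (\<lambda>g. cj g M) ` carrier G"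
  have \<M>: "\<exists>g\<in>carrier G. X = cj g M" "good X" if "X \<in> \<M>" for X
    using that M good_cj by (auto simp: \<M>_def)
  have \<M>_cj: "cj k X \<in> \<M>" if "X \<in> \<M>" "k \<in> carrier G" for X k
    using that m(5) by (auto simp: \<M>_def cj_cj)
  have M\<M>: "M \<in> \<M>" unfolding \<M>_def using cj_one[OF m(5)] by (metis imageI one_closed)
  have f\<M>: "finite \<M>" by (simp add: \<M>_def)
  \<comment> \<open>\<open>X\<close> is the normalizer of its own normal Sylow subgroup, a conjugate
    of \<open>T\<close>. If \<open>X\<close> contained \<open>T\<close>, the two would coincide and
    so would their normalizers. Hence \<open>T\<close> meets \<open>X\<close> trivially, and
    \<open>M \<inter> X\<close> complements \<open>T\<close> in \<open>M\<close>.\<close>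
  have TInt: "T \<inter> X = {\<one>}" "maximal_in (M \<inter> X) M" "card (M \<inter> X) = l" if X: "X \<in> \<M>" and ne: "X \<noteq> M" for X
  proof -
    obtain g where g: "g \<in> carrier G" "X = cj g M" using \<M>(1)[OF X] by blast
    note x = goodD[OF \<M>(2)[OF X]]
    have TC: "T \<subseteq> carrier G" by (rule subgroup.subset[OF T'(3)])
    have tX: "nrm (cj g T) = X" using nrm_cj[OF TC g(1)] t(4) g(2) by simp
    have sX: "syl t (cj g T) X"
      using T' cj_subgroup[OF g(1)] card_cj[OF g(1)] cj_mono[OF T'(4), of g] g TC m(5)
      by (simp add: syl_def)
    have nX: "normal_in (cj g T) X" using normal_in_nrm[OF cj_subgroup[OF g(1) T'(3)]] tX by simp
    show TX: "T \<inter> X = {\<one>}"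
    proof (rule ccontr)
      assume "T \<inter> X \<noteq> {\<one>}"
      then have "T \<inter> X = T" using T'(1) t(5)
        by (intro prime_card_subgroup[OF T'(3) _ subgroups_Inter_pair[OF T'(3) x(4)]]) auto
      then have "T \<subseteq> cj g T" using T'(5) by (intro normal_syl_contains[OF sX nX T'(3)]) auto
      then have "T = cj g T" using T'(3) g(1) TC by (intro subgroup_card_eq cj_subgroup) (auto simp: card_cj)
      then show False using tX t(4) ne by simp
    qed
    have "\<not> M \<subseteq> X" using TX T'(4) t(5) T'(1) card_eq_1[OF T'(3)] by auto
    then show max: "maximal_in (M \<inter> X) M" by (rule modular_maximal_Int[OF x(1,2) m(4)])
    note mm = maximal_inD[OF max]
    note sm = subgroup_set_mult_normal[OF t(3) mm(1,3)]
    have "(M \<inter> X) <#> T \<noteq> M \<inter> X" using sm(3) TX t(5) T'(1) card_eq_1[OF T'(3)] by auto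
    then have "(M \<inter> X) <#> T = M" using mm(5)[OF sm(1,2,4)] by simp
    moreover have "card (M \<inter> X \<inter> T) = 1" using TX T'(4) by (auto simp: card_1_singleton_iff)
    ultimately have "card M = card (M \<inter> X) * t"
      using card_set_mult[OF mm(1) T'(3)] mm(1) T'(3) finite_subgroup t(5) by simp
    then show "card (M \<inter> X) = l" using t(6) T'(1) by (simp add: prime_gt_0_nat)
  qed
  have i: "subgroup (nrm S\<^sub>0 \<inter> M) G" by (rule subgroups_Inter_pair[OF n(1) m(4)])
  have rl: "\<not> r dvd l"
    using m(3) card_dvd[OF i m(4)] good_nrm(5)[OF M S0] by (auto intro: dvd_trans)
  have conjM: "cj g M \<in> \<M>" if "g \<in> carrier G" for g using that by (simp add: \<M>_def)
  have faith_S: "x = \<one>" if "h \<in> nrm S\<^sub>0 - S\<^sub>0" "x \<in> S\<^sub>0" "h \<otimes> x = x \<otimes> h" for h x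
  proof (rule faithful[OF n(1,4) r_prime cS m(4,6) i _ _ _ _ that])
    show "nrm S\<^sub>0 \<subseteq> (nrm S\<^sub>0 \<inter> M) <#> S\<^sub>0" using good_nrm(4)[OF M S0] by simp
    show "\<not> r dvd card (nrm S\<^sub>0 \<inter> M)" using good_nrm(5)[OF M S0] rl by simp
    show "nrm S\<^sub>0 \<subseteq> cj g M \<or> maximal_in (nrm S\<^sub>0 \<inter> cj g M) (nrm S\<^sub>0) \<and> \<not> r dvd card (nrm S\<^sub>0 \<inter> cj g M)"
      if "g \<in> carrier G" for g
      using good_nrm(1,5)[OF \<M>(2)[OF conjM[OF that]] S0] rl by simp
  qed auto
  have faith_T: "x = \<one>" if "h \<in> M - T" "x \<in> T" "h \<otimes> x = x \<otimes> h" for h x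
  proof (rule faithful[OF m(4) t(3) T'(1) t(5) m(4,6) i _ _ _ _ that])
    show "M \<subseteq> (nrm S\<^sub>0 \<inter> M) <#> T" using TS(2)[OF S0] by simp
    show "\<not> t dvd card (nrm S\<^sub>0 \<inter> M)" using good_nrm(5)[OF M S0] tl by simp
    show "M \<subseteq> cj g M \<or> maximal_in (M \<inter> cj g M) M \<and> \<not> t dvd card (M \<inter> cj g M)"
      if "g \<in> carrier G" for g
      using TInt(2,3)[OF conjM[OF that]] tl by (cases "cj g M = M") auto
  qed auto
  show False
  proof (cases "l = 1")
    case False
    then have "nrm S\<^sub>0 \<inter> M \<noteq> {\<one>}" using good_nrm(5)[OF M S0] by auto
    \<comment> \<open>This \<open>h\<close> lies in both complements and outside both kernels, so
      that one and the same number \<open>c\<close> occurs in both orbit counts.\<close>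
    then obtain h where h: "h \<in> nrm S\<^sub>0" "h \<in> M" "h \<noteq> \<one>" using subgroup.one_closed[OF i] by blast
    have hS: "h \<in> nrm S\<^sub>0 - S\<^sub>0" using h good_nrm(3)[OF M S0] by auto
    have hT: "h \<in> M - T" using h TS(1)[OF S0] by auto
    define c where "c = card {X \<in> \<M>. h \<in> X}"
    have 1: "card \<M> = r * c" unfolding c_def
    proof (rule card_conj_orbit[OF n(1,4) r_prime cS card_nrm[OF S0] _ _ _ _ _ hS])
      show "x = \<one>" if "k \<in> nrm S\<^sub>0 - S\<^sub>0" "x \<in> S\<^sub>0" "k \<otimes> x = x \<otimes> k" for k x
        by (rule faith_S[OF that])
    qed (use \<M>(2) goodD(4) \<M>_cj good_nrm(3,5)[OF _ S0] subgroup.mem_carrier[OF s(3)] in auto)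
    \<comment> \<open>Elements of \<open>T \<subseteq> M\<close> fix \<open>M\<close> under
      conjugation and hence permute the remaining conjugates.\<close>
    have cj_ne: "cj x X \<in> \<M> - {M}" if "X \<in> \<M> - {M}" "x \<in> T" for X x
    proof -
      have xc: "x \<in> carrier G" "x \<in> M" using that(2) T'(4) m(5) by auto
      have "cj x X \<noteq> M"
      proof
        assume "cj x X = M"
        then have "X = cj (inv x) M" using cj_inv(1)[of X x] goodD(5)[OF \<M>(2)] that(1) xc by auto
        also have "\<dots> = M" using xc m(4) by (intro cj_subgroup_eq) (auto simp: subgroup.m_inv_closed)
        finally show False using that(1) by simp
      qed
      then show ?thesis using \<M>_cj that(1) xc by simp
    qed
    have "card (\<M> - {M}) = t * card {X \<in> \<M> - {M}. h \<in> X}"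
    proof (rule card_conj_orbit[OF m(4) t(3) T'(1) t(5,6) _ _ _ _ _ hT])
      show "x = \<one>" if "k \<in> M - T" "x \<in> T" "k \<otimes> x = x \<otimes> k" for k x
        by (rule faith_T[OF that])
      show "cj x X \<in> \<M> - {M}" if "X \<in> \<M> - {M}" "x \<in> T" for X x
        by (rule cj_ne[OF that])
    qed (use \<M>(2) goodD(4) TInt in auto)
    moreover have "{X \<in> \<M> - {M}. h \<in> X} = {X \<in> \<M>. h \<in> X} - {M}" by auto
    then have "card {X \<in> \<M> - {M}. h \<in> X} = c - 1" using M\<M> h(2) f\<M> by (simp add: c_def)
    moreover have "card (\<M> - {M}) = card \<M> - 1" using M\<M> f\<M> by simp
    \<comment> \<open>Impossible, as \<open>t * (c - 1) < t * c < r * c\<close> leaves a gap of at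
      least 2 between \<open>t * (c - 1)\<close> and \<open>r * c\<close>.\<close>
    ultimately have "r * c - 1 = t * (c - 1)" using 1 by simp
    moreover have c0: "c > 0" unfolding c_def using M\<M> h(2) f\<M> by (subst card_gt_0_iff) auto
    moreover have "t * c < r * c" using t(1) c0 by simp
    moreover have "t * (c - 1) < t * c" using c0 T'(1) by (simp add: prime_gt_0_nat)
    ultimately show False by linarith
  next
    case True
    \<comment> \<open>With trivial complements both \<open>S\<^sub>0\<close> and
      \<open>M = T\<close> are self-normalizing of prime order, so the numbers of their conjugates
      are the group order divided by \<open>r\<close> and by \<open>t\<close>.\<close>
    have "nrm S\<^sub>0 = S\<^sub>0" using subgroup_card_eq[OF n(1,3)] card_nrm[OF S0] True cS by simp
    have TM: "T = M" using subgroup_card_eq[OF m(4) T'(4)] t(5,6) True by simp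
    define \<S> where "\<S> = (\<lambda>g. cj g S\<^sub>0) ` carrier G"
    have \<S>: "syl r X (carrier G)" if "X \<in> \<S>" for X using that cj_syl[OF S0] by (auto simp: \<S>_def)
    have cardS: "card \<S> * r = card (carrier G)"
      using card_conjugates[OF s(3)] card_nrm[OF S0] True by (simp add: \<S>_def order_def)
    have cardM: "card \<M> * t = card (carrier G)"
      using card_conjugates[OF T'(3)] t(4,6) True by (simp add: \<M>_def order_def TM)
    have pr: "subgroup X G \<and> prime_nat (card X)" if XU: "X \<in> \<S> \<union> \<M>" for X
    proof (cases "X \<in> \<S>")
      case True then show ?thesis using sylD(3)[OF \<S>] card_syl_r[OF \<S>] r_prime by auto
    next
      case False
      then have "X \<in> \<M>" using XU by simp
      then obtain g where g: "g \<in> carrier G" "X = cj g M" using \<M>(1) by blast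
      then show ?thesis using cj_subgroup[OF g(1) m(4)] card_cj[OF g(1) m(5)] t(5) T'(1) TM by simp
    qed
    have disj: "(X - {\<one>}) \<inter> (Y - {\<one>}) = {}" if "X \<in> \<S> \<union> \<M>" "Y \<in> \<S> \<union> \<M>" "X \<noteq> Y" for X Y
    proof (rule ccontr)
      assume ne: "(X - {\<one>}) \<inter> (Y - {\<one>}) \<noteq> {}"
      note x = pr[OF that(1)] and y = pr[OF that(2)]
      have sXY: "subgroup (X \<inter> Y) G" using x y by (simp add: subgroups_Inter_pair)
      have ne1: "X \<inter> Y \<noteq> {\<one>}" using ne by auto
      have "X \<inter> Y = X" using x sXY ne1 by (intro prime_card_subgroup) auto
      moreover have "X \<inter> Y = Y" using y sXY ne1 by (intro prime_card_subgroup) auto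
      ultimately show False using that(3) by simp
    qed
    have SM: "\<S> \<inter> \<M> = {}" using \<S> card_syl_r \<M>(2) goodD(3) by fastforce
    let ?U = "\<Union>X\<in>\<S> \<union> \<M>. X - {\<one>}"
    have fS: "finite \<S>" by (simp add: \<S>_def)
    have "card ?U = (\<Sum>X\<in>\<S> \<union> \<M>. card (X - {\<one>}))"
      using fS f\<M> pr disj finite_subgroup by (intro card_UN_disjoint) auto
    also have "\<dots> = (\<Sum>X\<in>\<S>. card (X - {\<one>})) + (\<Sum>X\<in>\<M>. card (X - {\<one>}))"
      using fS f\<M> SM by (intro sum.union_disjoint)
    also have "(\<Sum>X\<in>\<S>. card (X - {\<one>})) = card \<S> * (r - 1)"
    proof -
      have "card (X - {\<one>}) = r - 1" if "X \<in> \<S>" for X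
        using card_syl_r[OF \<S>[OF that]] subgroup.one_closed[OF sylD(3)[OF \<S>[OF that]]] by simp
      then show ?thesis by simp
    qed
    also have "(\<Sum>X\<in>\<M>. card (X - {\<one>})) = card \<M> * (t - 1)"
    proof -
      have "card (X - {\<one>}) = t - 1" if XM: "X \<in> \<M>" for X
      proof -
        obtain g where g: "g \<in> carrier G" "X = cj g M" using \<M>(1)[OF XM] by blast
        have "subgroup X G" "card X = t" using cj_subgroup[OF g(1) m(4)] card_cj[OF g(1) m(5)] g t(5) TM by auto
        then show ?thesis using subgroup.one_closed[of X G] by simp
      qed
      then show ?thesis by simp
    qed
    finally have "card ?U = card \<S> * (r - 1) + card \<M> * (t - 1)" .
    moreover have "card ?U < card (carrier G)"
    proof (rule psubset_card_mono)
      have "X \<subseteq> carrier G" if "X \<in> \<S> \<union> \<M>" for X using pr[OF that] by (simp add: subgroup.subset)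
      then have "?U \<subseteq> carrier G" by blast
      moreover have "\<one> \<notin> ?U" by simp
      ultimately show "?U \<subset> carrier G" using one_closed by blast
    qed simp
    ultimately have lt: "card \<S> * (r - 1) + card \<M> * (t - 1) < card (carrier G)" by simp
    \<comment> \<open>From \<open>t < r\<close> one gets \<open>r \<ge> 3\<close>. The conjugates
      then hold at least the fraction \<open>2/3 + 1/2\<close>, more than 1, of the group order in
      pairwise distinct nonidentity elements.\<close>
    have "2 \<le> t" "3 \<le> r" using prime_ge_2_nat[OF T'(1)] t(1) by auto
    then have "card \<S> * 3 \<le> card \<S> * r" "card \<M> * 2 \<le> card \<M> * t" by simp_all
    moreover have "card \<S> * (r - 1) + card \<S> = card \<S> * r" using \<open>3 \<le> r\<close> by (cases r) auto
    moreover have "card \<M> * (t - 1) + card \<M> = card \<M> * t" using \<open>2 \<le> t\<close> by (cases t) auto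
    ultimately show False using lt cardS cardM by linarith
  qed
qed

end

section \<open>The induction on the group order\<close>

lemma (in group_hom) preimage_image:
  assumes "S \<subseteq> carrier G"
  shows "{x \<in> carrier G. h x \<in> h ` S} = S <#> kernel G H h"
proof (intro equalityI subsetI)
  fix x assume "x \<in> {x \<in> carrier G. h x \<in> h ` S}"
  then obtain y where y: "x \<in> carrier G" "y \<in> S" "h x = h y" by auto
  have yc: "y \<in> carrier G" using y(2) assms by auto
  have "inv y \<otimes> x \<in> kernel G H h" using y yc by (auto simp: kernel_def)
  moreover have "x = y \<otimes> (inv y \<otimes> x)" using y(1) yc by simp
  ultimately show "x \<in> S <#> kernel G H h" using y(2) unfolding set_mult_def by blast
next
  fix x assume "x \<in> S <#> kernel G H h"
  then obtain y k where k: "y \<in> S" "k \<in> kernel G H h" "x = y \<otimes> k" by (auto simp: set_mult_def)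
  have "h k = \<one>\<^bsub>H\<^esub>" "k \<in> carrier G" "y \<in> carrier G" using k assms by (auto simp: kernel_def)
  then show "x \<in> {x \<in> carrier G. h x \<in> h ` S}" using k by auto
qed

lemma (in finite_group_epi) normal_in_set_mult_kernel:
  assumes S: "subgroup S G" and n: "H.normal_in (h ` S) (carrier H)"
  shows "G.normal_in (S <#> kernel G H h) (carrier G)"
proof -
  let ?N = "kernel G H h"
  have SC: "S \<subseteq> carrier G" by (rule subgroup.subset[OF S])
  have "G.normal_in ?N (carrier G)" using normal_kernel by (simp add: G.normal_in_iff)
  note m = G.subgroup_set_mult_normal[OF this S SC]
  have im: "h x \<in> h ` S \<longleftrightarrow> x \<in> S <#> ?N" if "x \<in> carrier G" for x
    using preimage_image[OF SC] that by blast
  show ?thesis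
  proof (rule G.normal_inI[OF m(1) G.subgroup_self m(4)])
    fix k x assume k: "k \<in> carrier G" and x: "x \<in> S <#> ?N"
    have xc: "x \<in> carrier G" using x m(4) by auto
    have "h x \<in> h ` S" using im[OF xc] x by simp
    then have "h k \<otimes>\<^bsub>H\<^esub> h x \<otimes>\<^bsub>H\<^esub> inv\<^bsub>H\<^esub> h k \<in> h ` S"
      using H.normal_inD(4)[OF n] k by simp
    then have "h (k \<otimes> x \<otimes> inv k) \<in> h ` S" using k xc by simp
    then show "k \<otimes> x \<otimes> inv k \<in> S <#> ?N" using im[of "k \<otimes> x \<otimes> inv k"] k xc by simp
  qed
qed

text \<open>Strong induction on the order, over all groups of the given type. The prime and the
  Sylow subgroup are generalized along with the group, because a proper subgroup may have a smaller
  largest prime.\<close>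

theorem largest_prime_sylow_normal:
  fixes G :: "('a, 'b) monoid_scheme"
  assumes "finite_group G" "class_Z G" "sylow_subgroup r S G"
    and "\<And>s. prime_nat s \<Longrightarrow> s dvd order G \<Longrightarrow> s \<le> r"
  shows "S \<lhd> G"
  using assms
proof (induction "order G" arbitrary: G r S rule: less_induct)
  case less
  interpret finite_group G by fact
  show ?case
  proof (rule ccontr)
    assume not: "\<not> S \<lhd> G"
    have S: "syl r S (carrier G)" using less.prems(3) by (simp add: syl_carrier_iff)
    note s = sylD[OF S]
    have Z: "Z_in (carrier G)" using less.prems(2) class_Z_iff by simp
    have "largest_prime_counterexample G r S"
    proof
      show "Z_in (carrier G)" "syl r S (carrier G)" by fact+
      show "s \<le> r" if "prime_nat s" "s dvd card (carrier G)" for s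
        using less.prems(4) that by (simp add: order_def)
      show "\<not> normal_in S (carrier G)" using not by (simp add: normal_in_iff)
    next
      fix Y q Q assume Y: "subgroup Y G" "Y \<noteq> carrier G" "syl q Q Y"
        and m: "\<And>s. prime_nat s \<Longrightarrow> s dvd card Y \<Longrightarrow> s \<le> q"
      let ?Y = "G\<lparr>carrier := Y\<rparr>"
      interpret Y: finite_group ?Y by (rule sub_finite_group[OF Y(1)])
      have YC: "Y \<subseteq> carrier G" by (rule subgroup.subset[OF Y(1)])
      have "card Y < card (carrier G)" using YC Y(2) by (intro psubset_card_mono) auto
      moreover have "class_Z ?Y" using Z_in_iff[OF Y(1)] Z_in_subgroup[OF Z Y(1) YC] by simp
      ultimately have "Q \<lhd> ?Y" using Y(3) m
        by (intro less.hyps[of ?Y q Q]) (auto simp: order_def syl_iff[OF Y(1)] Y.finite_group_axioms)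
      then have "Y.normal_in Q Y" using Y.normal_in_iff[of Q] by simp
      then show "normal_in Q Y"
        using sylD[OF Y(3)] by (auto simp: Y.normal_in_def normal_in_def cj_consistent[OF Y(1)])
    next
      fix N assume N: "normal_in N (carrier G)" "N \<noteq> {\<one>\<^bsub>G\<^esub>}"
      note n = normal_inD[OF N(1)]
      have "N \<lhd> G" using N(1) by (simp add: normal_in_iff)
      then obtain G' :: "('a, 'b) monoid_scheme" and \<rho> where e: "finite_group_epi G G' \<rho>" "kernel G G' \<rho> = N"
        using coset_representative_quotient by blast
      interpret E: finite_group_epi G G' \<rho> by (rule e(1))
      have c: "card (carrier G) = card (carrier G') * card N"
      proof -
        have "carrier G \<inter> N = N" using n(3) by auto
        then show ?thesis using E.card_img[OF subgroup_self] E.onto e(2) by simp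
      qed
      have "card N \<noteq> 1" using card_eq_1[OF n(1)] N(2) by simp
      then have "1 < card N" using card_subgroup_pos[OF n(1)] by linarith
      moreover have "card (carrier G') > 0" using E.H.card_subgroup_pos[OF E.H.subgroup_self] .
      ultimately have "order G' < order G" using c by (simp add: order_def)
      moreover have "class_Z G'" by (rule E.class_Z_image[OF less.prems(2)])
      moreover have "sylow_subgroup r (\<rho> ` S) G'" using E.syl_image[OF S] by (simp add: E.H.syl_carrier_iff)
      moreover have "s \<le> r" if "prime_nat s" "s dvd order G'" for s
        using that c by (intro less.prems(4)) (auto simp: order_def)
      ultimately have "\<rho> ` S \<lhd> G'" by (intro less.hyps[of G' r "\<rho> ` S"] E.H.finite_group_axioms)
      then have nG': "E.H.normal_in (\<rho> ` S) (carrier G')" by (simp add: E.H.normal_in_iff)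
      show "normal_in (S <#>\<^bsub>G\<^esub> N) (carrier G)"
        using E.normal_in_set_mult_kernel[OF s(3) nG'] e(2) by simp
    qed
    then show False by (rule largest_prime_counterexample.contradiction)
  qed
qed

section \<open>Modular subgroups acting on an elementary abelian normal subgroup\<close>

context group
begin

lemma normal_in_consistent:
  assumes K: "subgroup K G" and L: "L \<subseteq> K"
  shows "group.normal_in (G\<lparr>carrier := K\<rparr>) N L \<longleftrightarrow> normal_in N L"
proof -
  interpret K: group "G\<lparr>carrier := K\<rparr>" by (rule subgroup_imp_group[OF K])
  have "K.cj k N = cj k N" if "k \<in> L" for k using cj_consistent[OF K] L that by auto
  then show ?thesis
    unfolding K.normal_in_def normal_in_def subgroup_sub_iff[OF K] using L by auto
qed

text \<open>The modular law for \<open>generate G {u}\<close> inside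
  \<open>Q \<inter> join (generate G {u}) M\<close>: as \<open>Q\<close> is abelian,
  \<open>generate G {u} <#> (Q \<inter> M)\<close> is already a subgroup. Modulo
  \<open>Q \<inter> M\<close>, the part of \<open>Q\<close> in the join is thus cyclic, generated by
  \<open>u\<close>.\<close>

lemma modular_cyclic_decomposition:
  assumes Q: "subgroup Q G" "\<And>x y. x \<in> Q \<Longrightarrow> y \<in> Q \<Longrightarrow> x \<otimes> y = y \<otimes> x"
    and M: "modular_in M K" and u: "u \<in> Q" "u \<in> K"
    and v: "v \<in> Q" "v \<in> join (generate G {u}) M"
  shows "\<exists>i::int. \<exists>w\<in>Q \<inter> M. v = u [^] i \<otimes> w"
proof -
  note m = modular_inD[OF M]
  have uc: "u \<in> carrier G" using subgroup.mem_carrier[OF Q(1) u(1)] .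
  let ?X = "generate G {u}" and ?U = "join (generate G {u}) M"
  have X: "subgroup ?X G" using uc by (intro generate_is_subgroup) auto
  have XQ: "?X \<subseteq> Q" "?X \<subseteq> K" using generate_subgroup_incl[of "{u}" Q] generate_subgroup_incl[of "{u}" K] u Q(1) m(2) by simp_all
  have U: "subgroup ?U G" using X m(1) by (simp add: join_subgroup subgroup.subset)
  have UK: "?U \<subseteq> K" using XQ m by (intro join_least)
  have QU: "subgroup (Q \<inter> ?U) G" by (rule subgroups_Inter_pair[OF Q(1) U])
  have QM: "subgroup (Q \<inter> M) G" by (rule subgroups_Inter_pair[OF Q(1) m(1)])
  have "normal_in (Q \<inter> M) Q"
  proof (rule normal_inI[OF QM Q(1)])
    fix k n assume k: "k \<in> Q" and n: "n \<in> Q \<inter> M"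
    have "k \<otimes> n \<otimes> inv k = n" using Q(2)[OF k] n k subgroup.mem_carrier[OF Q(1)] by (simp add: m_assoc)
    then show "k \<otimes> n \<otimes> inv k \<in> Q \<inter> M" using n by simp
  qed auto
  note W = subgroup_set_mult_normal[OF this X XQ(1)]
  have "v \<in> ?U \<inter> (Q \<inter> ?U)" using v by auto
  also have "?U \<inter> (Q \<inter> ?U) = join ?X (M \<inter> (Q \<inter> ?U))"
    using XQ UK QU X join_upper(1)[where A = ?X and B = M] by (intro m(4)) auto
  also have "\<dots> \<subseteq> ?X <#> (Q \<inter> M)" using W by (intro join_least) auto
  finally obtain a w where aw: "a \<in> ?X" "w \<in> Q \<inter> M" "v = a \<otimes> w" by (auto simp: set_mult_def)
  obtain i :: int where "a = u [^] i" using aw(1) generate_pow[OF uc] by auto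
  then show ?thesis using aw by blast
qed

lemma conj_int_pow:
  assumes "x \<in> carrier G" "u \<in> carrier G"
  shows "x \<otimes> u [^] (i::int) \<otimes> inv x = (x \<otimes> u \<otimes> inv x) [^] i"
  using group_hom.hom_int_pow[OF cj_hom[OF assms(1)] assms(2)] .

lemma conj_nat_pow:
  assumes "x \<in> carrier G" "u \<in> carrier G"
  shows "x \<otimes> u [^] (i::nat) \<otimes> inv x = (x \<otimes> u \<otimes> inv x) [^] i"
  using group_hom.hom_nat_pow[OF cj_hom[OF assms(1)] assms(2)] .

lemma conj_mult:
  assumes "x \<in> carrier G" "u \<in> carrier G" "v \<in> carrier G"
  shows "x \<otimes> (u \<otimes> v) \<otimes> inv x = (x \<otimes> u \<otimes> inv x) \<otimes> (x \<otimes> v \<otimes> inv x)"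
  using assms by (simp add: m_assoc)

text \<open>Modulo \<open>Q \<inter> M\<close>, conjugation by \<open>x\<close> and by
  \<open>y\<close> sends \<open>u\<close> to \<open>u [^] i\<close> and to \<open>u [^] j\<close>.
  Exponents commute, so \<open>x \<otimes> y\<close> and \<open>y \<otimes> x\<close> act alike on
  \<open>u\<close>.\<close>

lemma modular_commutator:
  assumes Q: "normal_in Q (carrier G)" "\<And>x y. x \<in> Q \<Longrightarrow> y \<in> Q \<Longrightarrow> x \<otimes> y = y \<otimes> x"
    and M: "modular_in M K" and x: "x \<in> M" and y: "y \<in> M" and u0: "u\<^sub>0 \<in> Q" "u\<^sub>0 \<in> K"
  shows "(x \<otimes> y \<otimes> inv x \<otimes> inv y) \<otimes> u\<^sub>0 \<otimes> inv (x \<otimes> y \<otimes> inv x \<otimes> inv y) \<otimes> inv u\<^sub>0 \<in> M"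
proof -
  note m = modular_inD[OF M] and q = normal_inD[OF Q(1)]
  have Qc: "a \<in> carrier G" if "a \<in> Q" for a using subgroup.mem_carrier[OF q(1) that] .
  have c: "x \<in> carrier G" "y \<in> carrier G" "u\<^sub>0 \<in> carrier G"
    using subgroup.mem_carrier[OF m(1)] x y Qc u0 by auto
  have xyK: "x \<in> K" "y \<in> K" using x y m(3) by auto
  \<comment> \<open>Chosen so that conjugation by \<open>y \<otimes> x\<close> gives
    \<open>u\<^sub>0\<close>, while conjugation by \<open>x \<otimes> y\<close> gives the conjugate
    of \<open>u\<^sub>0\<close> under the commutator of \<open>x\<close> and
    \<open>y\<close>.\<close>
  define u where "u = inv (y \<otimes> x) \<otimes> u\<^sub>0 \<otimes> (y \<otimes> x)"
  have uQ: "u \<in> Q" unfolding u_def using normal_in_inv[OF Q(1), of "y \<otimes> x"] u0 c by simp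
  have uK: "u \<in> K" unfolding u_def using xyK u0(2) m(2) by (simp add: subgroup.m_closed subgroup.m_inv_closed)
  have uc: "u \<in> carrier G" using Qc uQ .
  let ?U = "join (generate G {u}) M"
  have U: "subgroup ?U G" by (rule join_subgroup[OF generate_incl subgroup.subset[OF m(1)]]) (use uc in auto)
  have "u \<in> ?U" using join_upper(1)[where A = "generate G {u}" and B = M] generate.incl[of u "{u}" G] by auto
  moreover have MU: "M \<subseteq> ?U" by (rule join_upper)
  ultimately have dec: "\<exists>i::int. \<exists>w\<in>Q \<inter> M. z \<otimes> u \<otimes> inv z = u [^] i \<otimes> w" if "z \<in> M" for z
    using that U q(4)[of z u] uQ subgroup.mem_carrier[OF m(1) that]
    by (intro modular_cyclic_decomposition[OF q(1) Q(2) M uQ uK])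
      (auto simp: subgroup.m_closed subgroup.m_inv_closed)
  obtain i :: int and w where i: "w \<in> Q \<inter> M" "x \<otimes> u \<otimes> inv x = u [^] i \<otimes> w" using dec[OF x] by blast
  obtain j :: int and w' where j: "w' \<in> Q \<inter> M" "y \<otimes> u \<otimes> inv y = u [^] j \<otimes> w'" using dec[OF y] by blast
  have QM: "subgroup (Q \<inter> M) G" by (rule subgroups_Inter_pair[OF q(1) m(1)])
  have wc: "w \<in> carrier G" "w' \<in> carrier G" using Qc i j by auto
  have powQ: "a [^] (k::int) \<in> Q" if "a \<in> Q" for a k using subgroup_int_pow_closed[OF q(1) that] .
  have two: "\<exists>a\<in>Q \<inter> M. z \<otimes> (z' \<otimes> u \<otimes> inv z') \<otimes> inv z = u [^] (i * j) \<otimes> a"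
    if z: "z \<in> M" "z \<otimes> u \<otimes> inv z = u [^] i \<otimes> w" "w \<in> Q \<inter> M" "z' \<otimes> u \<otimes> inv z' = u [^] j \<otimes> w'" "w' \<in> Q \<inter> M"
    for z z' w w' and i j :: int
  proof -
    have zc: "z \<in> carrier G" "w \<in> carrier G" "w' \<in> carrier G" using subgroup.mem_carrier[OF m(1) z(1)] z Qc by auto
    have "z \<otimes> (u [^] j \<otimes> w') \<otimes> inv z = (z \<otimes> u [^] j \<otimes> inv z) \<otimes> (z \<otimes> w' \<otimes> inv z)"
      using zc uc by (intro conj_mult) auto
    also have "z \<otimes> u [^] j \<otimes> inv z = (u [^] i \<otimes> w) [^] j" using conj_int_pow[OF zc(1) uc] z(2) by simp
    also have "\<dots> = (u [^] i) [^] j \<otimes> w [^] j"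
      using Q(2)[OF powQ[OF uQ]] z(3) uc zc by (intro int_pow_mult_distrib) auto
    also have "(u [^] i) [^] j = u [^] (i * j)" using uc by (simp add: int_pow_pow)
    also have "u [^] (i * j) \<otimes> w [^] j \<otimes> (z \<otimes> w' \<otimes> inv z) = u [^] (i * j) \<otimes> (w [^] j \<otimes> (z \<otimes> w' \<otimes> inv z))"
      using uc zc by (simp add: m_assoc)
    finally have "z \<otimes> (z' \<otimes> u \<otimes> inv z') \<otimes> inv z = u [^] (i * j) \<otimes> (w [^] j \<otimes> (z \<otimes> w' \<otimes> inv z))"
      using z(4) by simp
    moreover have "z \<otimes> w' \<otimes> inv z \<in> Q \<inter> M"
      using q(4)[OF zc(1)] z m(1) by (auto simp: subgroup.m_closed subgroup.m_inv_closed)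
    moreover have "w [^] j \<in> Q \<inter> M" by (rule subgroup_int_pow_closed[OF QM z(3)])
    ultimately show ?thesis using subgroup.m_closed[OF QM] by blast
  qed
  obtain a where a: "a \<in> Q \<inter> M" "x \<otimes> (y \<otimes> u \<otimes> inv y) \<otimes> inv x = u [^] (i * j) \<otimes> a"
    using two[OF x i(2,1) j(2,1)] by blast
  obtain b where b: "b \<in> Q \<inter> M" "y \<otimes> (x \<otimes> u \<otimes> inv x) \<otimes> inv y = u [^] (j * i) \<otimes> b"
    using two[OF y j(2,1) i(2,1)] by blast
  let ?c = "x \<otimes> y \<otimes> inv x \<otimes> inv y" and ?p = "u [^] (i * j)"
  have ab: "a \<in> carrier G" "b \<in> carrier G" using Qc a b by auto
  have e1: "y \<otimes> (x \<otimes> u \<otimes> inv x) \<otimes> inv y = u\<^sub>0" unfolding u_def using c by (simp add: m_assoc inv_mult_group)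
  have e2: "x \<otimes> (y \<otimes> u \<otimes> inv y) \<otimes> inv x = ?c \<otimes> u\<^sub>0 \<otimes> inv ?c" unfolding u_def using c by (simp add: m_assoc inv_mult_group)
  have pQ: "?p \<in> Q" "?p \<in> carrier G" using powQ[OF uQ] uc by auto
  have "?c \<otimes> u\<^sub>0 \<otimes> inv ?c \<otimes> inv u\<^sub>0 = (?p \<otimes> a) \<otimes> inv (?p \<otimes> b)"
    using a(2) b(2) e1 e2 by (simp add: mult.commute)
  also have "\<dots> = (a \<otimes> ?p) \<otimes> inv (b \<otimes> ?p)" using Q(2)[OF pQ(1)] a(1) b(1) by simp
  also have "\<dots> = a \<otimes> inv b" using ab pQ by (simp add: m_assoc inv_mult_group)
  finally show ?thesis using a(1) b(1) m(1) by (simp add: subgroup.m_closed subgroup.m_inv_closed)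
qed

lemma pow_coprime_in_subgroup:
  assumes H: "subgroup H G" and z: "z \<in> carrier G" "z [^] (m::nat) = \<one>" "z [^] (i::nat) \<in> H" "coprime i m" "m > 0"
  shows "z \<in> H"
proof -
  obtain s t where st: "s * int i + t * int m = 1"
    using z(4) bezout_int[of "int i" "int m"] by (auto simp flip: coprime_int_iff simp: coprime_iff_gcd_eq_1)
  have "z = z [^] (int i * s + int m * t)" using st z(1) by (simp add: mult.commute)
  also have "\<dots> = (z [^] i) [^] s \<otimes> (z [^] m) [^] t"
    using z(1) by (simp add: int_pow_mult int_pow_pow[symmetric] int_pow_int)
  also have "\<dots> \<in> H" using z(1,2,3) subgroup_int_pow_closed[OF H z(3)] by simp
  finally show ?thesis .
qed

text \<open>Compare \<open>x\<close> with its conjugate \<open>z\<close> under \<open>u\<close>. If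
  the commutator \<open>v\<close> of \<open>x [^] p\<close> and \<open>u\<close> were outside
  \<open>M\<close>, then the join of \<open>M\<close> with the powers of \<open>z [^] p\<close>
  would contain \<open>v\<close>, hence \<open>u\<close>, hence \<open>z\<close>. The modular law
  inside \<open>generate G {z}\<close> would then generate \<open>z\<close> from
  \<open>z [^] p\<close> and \<open>M \<inter> generate G {z}\<close>, both inside a proper subgroup
  of a cyclic \<open>p\<close>-group.\<close>

lemma modular_power:
  assumes Q: "normal_in Q (carrier G)" "\<And>x y. x \<in> Q \<Longrightarrow> y \<in> Q \<Longrightarrow> x \<otimes> y = y \<otimes> x"
    and q: "prime_nat q" "\<And>x. x \<in> Q \<Longrightarrow> x [^] q = \<one>"
    and M: "modular_in M K" and x: "x \<in> M" "x [^] (p ^ k) = \<one>" "prime_nat p" and u: "u \<in> Q" "u \<in> K"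
  shows "x [^] p \<otimes> u \<otimes> inv (x [^] p) \<otimes> inv u \<in> M"
proof (rule ccontr)
  note m = modular_inD[OF M] and Q' = normal_inD[OF Q(1)]
  have Qc: "a \<in> carrier G" if "a \<in> Q" for a using subgroup.mem_carrier[OF Q'(1) that] .
  have uc: "u \<in> carrier G" using Qc u by simp
  have xc: "x \<in> carrier G" using subgroup.mem_carrier[OF m(1) x(1)] .
  have xK: "x \<in> K" using x(1) m(3) by auto
  define v where "v = x [^] p \<otimes> u \<otimes> inv (x [^] p) \<otimes> inv u"
  assume "x [^] p \<otimes> u \<otimes> inv (x [^] p) \<otimes> inv u \<notin> M"
  then have vM: "v \<notin> M" by (simp add: v_def)
  have powM: "x [^] p \<in> M" using subgroup_int_pow_closed[OF m(1) x(1), of "int p"] by (simp add: int_pow_int)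
  have vQ: "v \<in> Q" unfolding v_def using Q'(4)[of "x [^] p" u] u xc Q'(1)
    by (simp add: subgroup.m_closed subgroup.m_inv_closed)
  define z where "z = u \<otimes> x \<otimes> inv u"
  have zc: "z \<in> carrier G" unfolding z_def using uc xc by simp
  have zK: "z \<in> K" unfolding z_def using xK u(2) m(2) by (simp add: subgroup.m_closed subgroup.m_inv_closed)
  have zp: "z [^] (n::nat) = u \<otimes> x [^] n \<otimes> inv u" for n unfolding z_def using conj_nat_pow[OF uc xc] by simp
  have zpk: "z [^] (p ^ k) = \<one>" using zp[of "p ^ k"] x(2) uc by simp
  let ?Z = "generate G {z}" and ?X = "generate G {z [^] p}"
  have Z: "subgroup ?Z G" and X: "subgroup ?X G" using zc by (auto intro!: generate_is_subgroup)
  have ZK: "?Z \<subseteq> K" using zK m(2) by (intro generate_subgroup_incl) auto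
  have zZ: "z \<in> ?Z" by (intro generate.incl) simp
  have zpZ: "z [^] p \<in> ?Z" using subgroup_int_pow_closed[OF Z zZ, of "int p"] by (simp add: int_pow_int)
  have XZ: "?X \<subseteq> ?Z" using zpZ Z by (intro generate_subgroup_incl) auto
  let ?J = "join ?X M"
  have J: "subgroup ?J G" using X m(1) by (simp add: join_subgroup subgroup.subset)
  have MJ: "M \<subseteq> ?J" and XJ: "?X \<subseteq> ?J" by (rule join_upper)+
  have zpJ: "z [^] p \<in> ?J" using XJ generate.incl[of "z [^] p" "{z [^] p}" G] by auto
  have "inv v = z [^] p \<otimes> inv (x [^] p)" unfolding zp v_def using uc xc by (simp add: m_assoc inv_mult_group)
  then have "inv v \<in> ?J" using zpJ powM MJ J by (auto simp: subgroup.m_closed subgroup.m_inv_closed)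
  then have vJ: "v \<in> ?J" using subgroup.m_inv_closed[OF J, of "inv v"] Qc[OF vQ] by simp
  \<comment> \<open>modulo \<open>Q \<inter> M\<close>, \<open>v\<close> is a nontrivial power of \<open>u\<close>, which has order \<open>q\<close>\<close>
  have "v \<in> join (generate G {u}) M"
  proof -
    let ?U = "join (generate G {u}) M"
    have U: "subgroup ?U G" by (rule join_subgroup[OF generate_incl subgroup.subset[OF m(1)]]) (use uc in auto)
    have "u \<in> ?U" using join_upper(1)[where A = "generate G {u}" and B = M] generate.incl[of u "{u}" G] by auto
    moreover have "x [^] p \<in> ?U" using powM join_upper(2)[where A = "generate G {u}" and B = M] by auto
    ultimately show ?thesis unfolding v_def using U by (simp add: subgroup.m_closed subgroup.m_inv_closed)
  qed
  from modular_cyclic_decomposition[OF Q'(1) Q(2) M u vQ this]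
  obtain i :: int and w where iw: "w \<in> Q \<inter> M" "v = u [^] i \<otimes> w" by blast
  have wc: "w \<in> carrier G" using Qc iw by auto
  have "u [^] i = v \<otimes> inv w" using iw(2) uc wc by (simp add: m_assoc)
  then have uiJ: "u [^] i \<in> ?J" using vJ iw(1) MJ J by (auto simp: subgroup.m_closed subgroup.m_inv_closed)
  have uq: "u [^] int q = \<one>" using q(2)[OF u(1)] by (simp add: int_pow_int)
  have "\<not> int q dvd i"
  proof
    assume "int q dvd i"
    then obtain d where "i = int q * d" by (auto simp: dvd_def)
    then have "u [^] i = \<one>" using uq uc int_pow_pow[OF uc, of "int q" d] by simp
    then show False using iw vM wc by simp
  qed
  then have "coprime i (int q)" using q(1) by (metis coprime_commute prime_imp_coprime prime_nat_int_transfer)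
  then obtain a b where ab: "a * i + b * int q = 1" using bezout_int[of i "int q"] by (auto simp: coprime_iff_gcd_eq_1)
  have "u = u [^] (i * a + int q * b)" using ab uc by (simp add: mult.commute)
  also have "\<dots> = (u [^] i) [^] a \<otimes> (u [^] int q) [^] b" using uc by (simp add: int_pow_mult int_pow_pow)
  also have "\<dots> = (u [^] i) [^] a" using uq uc by simp
  finally have "u \<in> ?J" using subgroup_int_pow_closed[OF J uiJ, of a] by simp
  then have "u \<otimes> x \<otimes> inv u \<in> ?J"
    using subsetD[OF MJ x(1)] J by (simp add: subgroup.m_closed subgroup.m_inv_closed)
  then have "z \<in> ?J" by (simp only: z_def[symmetric])
  then have "z \<in> ?J \<inter> ?Z" using zZ by simp
  also have "?J \<inter> ?Z = join ?X (M \<inter> ?Z)" by (rule m(4)[OF X Z XZ ZK])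
  finally have zj: "z \<in> join ?X (M \<inter> ?Z)" .
  have zM: "z \<notin> M"
  proof
    assume "z \<in> M"
    then have "z [^] p \<in> M" using subgroup_int_pow_closed[OF m(1), of z "int p"] by (simp add: int_pow_int)
    then have "inv v \<in> M" using \<open>inv v = _\<close> powM m(1) by (simp add: subgroup.m_closed subgroup.m_inv_closed)
    then show False using vM subgroup.m_inv_closed[OF m(1), of "inv v"] Qc[OF vQ] by simp
  qed
  \<comment> \<open>A power of \<open>z\<close> with exponent prime to \<open>p\<close> generates
    all of \<open>?Z\<close>, so only powers of \<open>z [^] p\<close> can lie in
    \<open>M\<close>.\<close>
  have "M \<inter> ?Z \<subseteq> ?X"
  proof
    fix y assume y: "y \<in> M \<inter> ?Z"
    then obtain n :: int where n: "y = z [^] n" using generate_pow[OF zc] by auto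
    show "y \<in> ?X"
    proof (cases "int p dvd n")
      case True
      then obtain d where "n = int p * d" by (auto simp: dvd_def)
      then have "y = (z [^] p) [^] d" using n zc by (simp add: int_pow_pow[symmetric] int_pow_int)
      then show ?thesis using generate_pow[of "z [^] p"] zc by auto
    next
      case False
      \<comment> \<open>Reduction modulo \<open>p ^ k\<close> replaces the integer exponent by the
        natural one that \<open>pow_coprime_in_subgroup\<close> takes.\<close>
      define n' where "n' = nat (n mod int (p ^ k))"
      have pk: "int (p ^ k) > 0" using x(3) prime_gt_0_nat by simp
      have n'eq: "int n' = n mod int (p ^ k)" unfolding n'_def using pk by simp
      have "y = z [^] (int (p ^ k) * (n div int (p ^ k)) + int n')" unfolding n n'eq by simp
      also have "\<dots> = (z [^] (p ^ k)) [^] (n div int (p ^ k)) \<otimes> z [^] n'"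
        using zc by (simp only: int_pow_mult int_pow_pow[symmetric] int_pow_int)
      also have "\<dots> = z [^] n'" using zpk zc by simp
      finally have yn: "y = z [^] n'" .
      have "coprime n' (p ^ k)"
      proof (cases "k = 0")
        case False
        have "\<not> p dvd n'"
        proof
          assume "p dvd n'"
          then have "int p dvd n mod int (p ^ k)" using n'eq by (metis int_dvd_int_iff)
          moreover have "int p dvd int (p ^ k)" using False by simp
          ultimately have "int p dvd n" by (metis dvd_mod_iff)
          then show False using \<open>\<not> int p dvd n\<close> by simp
        qed
        then show ?thesis using x(3) by (metis coprime_commute coprime_power_left_iff prime_imp_coprime)
      qed simp
      then have "z \<in> M"
        using y yn pk by (intro pow_coprime_in_subgroup[OF m(1) zc zpk]) auto
      then show ?thesis using zM by simp
    qed
  qed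
  then have "join ?X (M \<inter> ?Z) \<subseteq> ?X" using X by (intro join_least) auto
  then have "z \<in> ?X" using zj by auto
  then obtain d :: int where "z = (z [^] p) [^] d" using generate_pow[of "z [^] p"] zc by auto
  \<comment> \<open>\<open>z\<close> is annihilated by \<open>p * d - 1\<close> as well as by
    \<open>p ^ k\<close>; these are coprime, so \<open>z = \<one>\<close>, which lies in
    \<open>M\<close>.\<close>
  then have e: "z [^] (1 :: int) = z [^] (int p * d)" using zc by (simp add: int_pow_pow[symmetric] int_pow_int)
  have "z [^] (int p * d - 1) = \<one>" using zc e by (simp add: int_pow_diff)
  then have z1: "z [^] (int p * d - 1) \<in> {\<one>}" by simp
  have "coprime (int p * d - 1) (int (p ^ k))"
  proof -
    have "coprime (int p * d - 1) (int p)"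
      by (rule coprimeI) (metis dvd_diff_commute dvd_mult2 dvd_diff_right_iff)
    then show ?thesis by simp
  qed
  then obtain a b where ab: "a * (int p * d - 1) + b * int (p ^ k) = 1"
    using bezout_int[of "int p * d - 1" "int (p ^ k)"] by (auto simp: coprime_iff_gcd_eq_1)
  have "z = z [^] ((int p * d - 1) * a + int (p ^ k) * b)" using ab zc by (simp add: mult.commute)
  also have "\<dots> = (z [^] (int p * d - 1)) [^] a \<otimes> (z [^] int (p ^ k)) [^] b" using zc by (simp only: int_pow_mult int_pow_pow)
  also have "z [^] int (p ^ k) = \<one>" using zpk by (simp only: int_pow_int)
  also have "(z [^] (int p * d - 1)) [^] a \<otimes> \<one> [^] b = \<one>" using z1 by simp
  finally show False using zM subgroup.one_closed[OF m(1)] by simp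
qed

text \<open>Induction up the modular chain, starting from the trivial \<open>S \<inter> Q\<close>.
  If \<open>x\<close> centralizes \<open>Q \<inter> M\<close>, then for
  \<open>u \<in> Q \<inter> K\<close> the commutator \<open>w\<close> lies in
  \<open>Q \<inter> M\<close> and commutes with \<open>x\<close>, whence
  \<open>x [^] n \<otimes> u = w [^] n \<otimes> u \<otimes> x [^] n\<close>. So \<open>w\<close> is
  annihilated by the coprime numbers \<open>n\<close> and \<open>q\<close>.\<close>

lemma submodular_centralizes:
  assumes Q: "normal_in Q (carrier G)" "\<And>x y. x \<in> Q \<Longrightarrow> y \<in> Q \<Longrightarrow> x \<otimes> y = y \<otimes> x"
    and q: "\<And>x. x \<in> Q \<Longrightarrow> x [^] (q::nat) = \<one>"
    and S: "submodular_in S (carrier G)" "S \<inter> Q \<subseteq> {\<one>}" "x \<in> S" "x [^] (n::nat) = \<one>" "coprime n q" "q > 0"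
    and step: "\<And>M K u. modular_in M K \<Longrightarrow> S \<subseteq> M \<Longrightarrow> u \<in> Q \<Longrightarrow> u \<in> K \<Longrightarrow> x \<otimes> u \<otimes> inv x \<otimes> inv u \<in> M"
    and u: "u \<in> Q"
  shows "x \<otimes> u = u \<otimes> x"
proof -
  note Q' = normal_inD[OF Q(1)] and s = submodular_inD[OF S(1)]
  have Qc: "a \<in> carrier G" if "a \<in> Q" for a using subgroup.mem_carrier[OF Q'(1) that] .
  have xc: "x \<in> carrier G" using subgroup.mem_carrier[OF s(1) S(3)] .
  have "modular_in\<^sup>*\<^sup>* S (carrier G)" using S(1) by (simp add: submodular_in_def)
  then have "\<forall>u\<in>Q \<inter> carrier G. x \<otimes> u = u \<otimes> x"
  proof (induction)
    case base
    then show ?case using S(2) xc by auto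
  next
    case (step M K)
    have SM: "S \<subseteq> M"
      using step(1) modular_inD(1)[OF step(2)] s(1) submodular_inD(3)[of S M] by (simp add: submodular_in_def)
    show ?case
    proof
      fix u assume u: "u \<in> Q \<inter> K"
      define w where "w = x \<otimes> u \<otimes> inv x \<otimes> inv u"
      have uc: "u \<in> carrier G" using Qc u by simp
      have wM: "w \<in> M" unfolding w_def using assms(10)[OF step(2) SM] u by simp
      have wQ: "w \<in> Q" unfolding w_def using Q'(4)[OF xc, of u] u Q'(1)
        by (simp add: subgroup.m_closed subgroup.m_inv_closed)
      have wc: "w \<in> carrier G" using Qc wQ .
      have xw: "x \<otimes> w = w \<otimes> x" using step(3) wM wQ by simp
      have xu: "x \<otimes> u = w \<otimes> u \<otimes> x" unfolding w_def using xc uc by (simp add: m_assoc)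
      have pw: "x \<otimes> w [^] (i::nat) = w [^] i \<otimes> x" for i
        by (induction i) (use xc wc xw in \<open>simp_all add: m_assoc[symmetric]\<close>, use xc wc xw in \<open>simp add: m_assoc\<close>)
      have "x [^] (i::nat) \<otimes> u = w [^] i \<otimes> u \<otimes> x [^] i" for i
      proof (induction i)
        case (Suc i)
        have "x [^] Suc i \<otimes> u = x \<otimes> (x [^] i \<otimes> u)" using xc uc by (simp only: nat_pow_Suc2) (simp add: m_assoc)
        also have "\<dots> = (x \<otimes> w [^] i) \<otimes> u \<otimes> x [^] i" unfolding Suc.IH using xc uc wc by (simp add: m_assoc)
        also have "\<dots> = w [^] i \<otimes> (x \<otimes> u) \<otimes> x [^] i" unfolding pw using xc uc wc by (simp add: m_assoc)
        also have "\<dots> = w [^] i \<otimes> w \<otimes> u \<otimes> (x \<otimes> x [^] i)" unfolding xu using xc uc wc by (simp add: m_assoc)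
        also have "x \<otimes> x [^] i = x [^] Suc i" using xc by (simp only: nat_pow_Suc2)
        finally show ?case by simp
      qed (use xc uc in simp)
      from this[of n] have "w [^] n = \<one>" using S(4) uc wc xc by simp
      then have "w \<in> {\<one>}"
        using q[OF wQ] wc S(5,6) by (intro pow_coprime_in_subgroup[OF triv_subgroup wc, of q n]) auto
      then show "x \<otimes> u = u \<otimes> x" using xu xc uc by simp
    qed
  qed
  then show ?thesis using u Qc by simp
qed

end

section \<open>Quotients with elementary abelian Sylow subgroups\<close>

context finite_group
begin

lemma pow_card_subgroup:
  assumes "subgroup H G" "x \<in> H" shows "x [^] card H = \<one>"
proof -
  interpret H: finite_group "G\<lparr>carrier := H\<rparr>" by (rule sub_finite_group[OF assms(1)])
  have "x [^]\<^bsub>G\<lparr>carrier := H\<rparr>\<^esub> order (G\<lparr>carrier := H\<rparr>) = \<one>\<^bsub>G\<lparr>carrier := H\<rparr>\<^esub>"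
    using assms(2) by (intro H.pow_order_eq_1) simp
  then show ?thesis by (simp add: order_def nat_pow_consistent[symmetric])
qed

lemma p_group_center:
  assumes P: "subgroup P G" "card P = p ^ k" "prime_nat p" "p dvd card P"
  shows "p dvd card {x \<in> P. \<forall>y\<in>P. x \<otimes> y = y \<otimes> x}"
proof -
  interpret H: finite_group "G\<lparr>carrier := P\<rparr>" by (rule sub_finite_group[OF P(1)])
  have Pc: "x \<in> carrier G" if "x \<in> P" for x using subgroup.mem_carrier[OF P(1) that] .
  have "card P mod p = card {x \<in> P. \<forall>g\<in>carrier (G\<lparr>carrier := P\<rparr>). g \<otimes> x \<otimes> inv g = x} mod p"
  proof (rule H.p_group_fixed_points[where a = "\<lambda>g x. g \<otimes> x \<otimes> inv g" and k = k, OF P(3)])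
    show "order (G\<lparr>carrier := P\<rparr>) = p ^ k" using P by (simp add: order_def)
    show "finite P" by (rule finite_subgroup[OF P(1)])
  next
    fix g x assume "g \<in> carrier (G\<lparr>carrier := P\<rparr>)" "x \<in> P"
    then show "g \<otimes> x \<otimes> inv g \<in> P" using P(1) by (simp add: subgroup.m_closed subgroup.m_inv_closed)
  next
    fix x assume "x \<in> P"
    then show "\<one>\<^bsub>G\<lparr>carrier := P\<rparr>\<^esub> \<otimes> x \<otimes> inv \<one>\<^bsub>G\<lparr>carrier := P\<rparr>\<^esub> = x" using Pc by simp
  next
    fix g h x assume "g \<in> carrier (G\<lparr>carrier := P\<rparr>)" "h \<in> carrier (G\<lparr>carrier := P\<rparr>)" "x \<in> P"
    then show "g \<otimes>\<^bsub>G\<lparr>carrier := P\<rparr>\<^esub> h \<otimes> x \<otimes> inv (g \<otimes>\<^bsub>G\<lparr>carrier := P\<rparr>\<^esub> h) = g \<otimes> (h \<otimes> x \<otimes> inv h) \<otimes> inv g"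
      using Pc by (simp add: m_assoc inv_mult_group)
  qed
  moreover have "{x \<in> P. \<forall>g\<in>carrier (G\<lparr>carrier := P\<rparr>). g \<otimes> x \<otimes> inv g = x} = {x \<in> P. \<forall>y\<in>P. x \<otimes> y = y \<otimes> x}"
  proof -
    have "g \<otimes> x \<otimes> inv g = x \<longleftrightarrow> x \<otimes> g = g \<otimes> x" if "x \<in> P" "g \<in> P" for x g
      using inv_solve_right'[of x "g \<otimes> x" g] Pc that by auto
    then show ?thesis by auto
  qed
  ultimately show ?thesis using P(4) by (simp add: dvd_eq_mod_eq_0)
qed

lemma centralizer_subgroup:
  assumes "H \<subseteq> carrier G" "subgroup K G"
  shows "subgroup {x \<in> K. \<forall>y\<in>H. x \<otimes> y = y \<otimes> x} G"
proof -
  have "subgroup (\<Inter>(insert K ((\<lambda>y. {x \<in> K. y \<otimes> x = x \<otimes> y}) ` H))) G"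
    using centralizer_Int_subgroup[OF assms(2)] assms by (intro subgroups_Inter) auto
  moreover have "\<Inter>(insert K ((\<lambda>y. {x \<in> K. y \<otimes> x = x \<otimes> y}) ` H)) = {x \<in> K. \<forall>y\<in>H. x \<otimes> y = y \<otimes> x}"
    by (auto simp: eq_commute)
  ultimately show ?thesis by simp
qed

lemma centralizer_normal:
  assumes H: "normal_in H (carrier G)" and K: "normal_in K (carrier G)"
  shows "normal_in {x \<in> K. \<forall>y\<in>H. x \<otimes> y = y \<otimes> x} (carrier G)"
proof (rule normal_inI)
  note h = normal_inD[OF H] and n = normal_inD[OF K]
  show "subgroup {x \<in> K. \<forall>y\<in>H. x \<otimes> y = y \<otimes> x} G" by (rule centralizer_subgroup[OF h(3) n(1)])
  show "{x \<in> K. \<forall>y\<in>H. x \<otimes> y = y \<otimes> x} \<subseteq> carrier G" using n(3) by auto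
  fix k c assume k: "k \<in> carrier G" and c: "c \<in> {x \<in> K. \<forall>y\<in>H. x \<otimes> y = y \<otimes> x}"
  have cc: "c \<in> carrier G" using c n(3) by auto
  have "k \<otimes> c \<otimes> inv k \<otimes> y = y \<otimes> (k \<otimes> c \<otimes> inv k)" if y: "y \<in> H" for y
  proof -
    have yc: "y \<in> carrier G" using y h(3) by auto
    have "inv k \<otimes> y \<otimes> k \<in> H" by (rule normal_in_inv[OF H k y])
    then have e: "c \<otimes> (inv k \<otimes> y \<otimes> k) = inv k \<otimes> y \<otimes> k \<otimes> c" using c by auto
    have "k \<otimes> c \<otimes> inv k \<otimes> y = k \<otimes> (c \<otimes> (inv k \<otimes> y \<otimes> k)) \<otimes> inv k" using k cc yc by (simp add: m_assoc)
    also have "\<dots> = y \<otimes> (k \<otimes> c \<otimes> inv k)" unfolding e using k cc yc by (simp add: m_assoc)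
    finally show ?thesis .
  qed
  then show "k \<otimes> c \<otimes> inv k \<in> {x \<in> K. \<forall>y\<in>H. x \<otimes> y = y \<otimes> x}" using n(4)[OF k] c by auto
qed (rule subgroup_self)

text \<open>The exponent is square-free if and only if no element order is divisible by the square
  of a prime, that is, if \<open>x [^] p = \<one>\<close> on every Sylow \<open>p\<close>-subgroup.
  Commutativity is written with commutators so that in a quotient both conditions become memberships
  in the kernel.\<close>

lemma class_A1_iff:
  "class_A1 G \<longleftrightarrow> (\<forall>p P. syl p P (carrier G) \<longrightarrow>
     (\<forall>x\<in>P. x [^] p = \<one> \<and> (\<forall>y\<in>P. x \<otimes> y \<otimes> inv x \<otimes> inv y = \<one>)))"
proof -
  have comm: "x \<otimes> y \<otimes> inv x \<otimes> inv y = \<one> \<longleftrightarrow> x \<otimes> y = y \<otimes> x" if "x \<in> carrier G" "y \<in> carrier G" for x y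
  proof
    assume a: "x \<otimes> y \<otimes> inv x \<otimes> inv y = \<one>"
    have "x \<otimes> y = (x \<otimes> y \<otimes> inv x \<otimes> inv y) \<otimes> (y \<otimes> x)" using that by (simp add: m_assoc)
    then show "x \<otimes> y = y \<otimes> x" unfolding a using that by simp
  next
    assume a: "x \<otimes> y = y \<otimes> x"
    show "x \<otimes> y \<otimes> inv x \<otimes> inv y = \<one>" unfolding a using that by (simp add: m_assoc)
  qed
  define e where "e = group_exponent G"
  have "0 < order G \<and> (\<forall>x\<in>carrier G. x [^] order G = \<one>)"
    using pow_order_eq_1 by (simp add: order_gt_0_iff_finite)
  then have ex: "0 < e \<and> (\<forall>x\<in>carrier G. x [^] e = \<one>)" unfolding e_def group_exponent_def by (rule LeastI)
  show ?thesis
  proof (intro iffI allI impI ballI conjI)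
    fix p P x assume A: "class_A1 G" and P: "syl p P (carrier G)" and x: "x \<in> P"
    note s = sylD[OF P]
    have xc: "x \<in> carrier G" using s(4) x by auto
    have sq: "squarefree e" using A by (simp add: class_A1_def e_def)
    have "ord x dvd p ^ multiplicity p (card (carrier G))"
      using pow_card_subgroup[OF s(3) x] s(5) pow_eq_id[OF xc] by simp
    then obtain j where j: "ord x = p ^ j" using divides_primepow_nat[OF s(1)] by auto
    have "j \<le> 1"
    proof (rule ccontr)
      assume "\<not> j \<le> 1"
      then have "p ^ 2 dvd p ^ j" by (intro le_imp_power_dvd) simp
      also have "p ^ j dvd e" using ex xc pow_eq_id[OF xc, of e] unfolding j by blast
      finally have "p dvd 1" using sq by (auto simp: squarefree_def)
      then show False using s(1) by simp
    qed
    then have "ord x dvd p" unfolding j using le_imp_power_dvd[of j 1 p] by simp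
    then show "x [^] p = \<one>" using pow_eq_id[OF xc] by simp
    fix y assume y: "y \<in> P"
    have "sylow_subgroup p P G" using P by (simp add: syl_carrier_iff)
    then have "comm_group (G\<lparr>carrier := P\<rparr>)" using A by (simp add: class_A1_def class_A_def)
    then interpret P: comm_group "G\<lparr>carrier := P\<rparr>" .
    have "x \<otimes> y = y \<otimes> x" using P.m_comm x y by simp
    then show "x \<otimes> y \<otimes> inv x \<otimes> inv y = \<one>" using comm[OF xc, of y] y s(4) by blast
  next
    assume A: "\<forall>p P. syl p P (carrier G) \<longrightarrow> (\<forall>x\<in>P. x [^] p = \<one> \<and> (\<forall>y\<in>P. x \<otimes> y \<otimes> inv x \<otimes> inv y = \<one>))"
    have "class_A G"
      unfolding class_A_def
    proof (intro conjI allI impI)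
      fix p P assume "sylow_subgroup p P G"
      then have P: "syl p P (carrier G)" by (simp add: syl_carrier_iff)
      note s = sylD[OF P]
      interpret P: group "G\<lparr>carrier := P\<rparr>" by (rule subgroup_imp_group[OF s(3)])
      have "x \<otimes> y = y \<otimes> x" if "x \<in> P" "y \<in> P" for x y using A P that comm s(4) by blast
      then show "comm_group (G\<lparr>carrier := P\<rparr>)" by (intro P.group_comm_groupI) simp
    qed auto
    moreover have "squarefree e"
      unfolding squarefree_def
    proof (intro allI impI)
      fix d assume d: "d ^ 2 dvd e"
      show "d dvd 1"
      proof (rule ccontr)
        assume "\<not> d dvd 1"
        then obtain p where p: "prime_nat p" "p dvd d" using prime_factor_nat[of d] by auto
        have pe: "p ^ 2 dvd e" using d p(2) by (meson dvd_power_same dvd_trans)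
        \<comment> \<open>If \<open>p ^ 2\<close> divides \<open>e\<close>, then the smaller number
          \<open>p * f\<close> already annihilates every element, against the minimality of the
          exponent.\<close>
        then obtain f where f: "e = p * (p * f)" by (auto simp: dvd_def power2_eq_square mult.assoc)
        have "x [^] (p * f) = \<one>" if xc: "x \<in> carrier G" for x
        proof -
          have xe: "ord x dvd e" using ex xc pow_eq_id[OF xc, of e] by blast
          have np: "\<not> p ^ 2 dvd ord x"
          proof
            assume "p ^ 2 dvd ord x"
            then obtain m where m: "ord x = p * p * m" by (auto simp: dvd_def power2_eq_square)
            have m0: "m > 0" using xe ex m by (metis dvd_0_left_iff less_not_refl2 mult_0_right neq0_conv)
            \<comment> \<open>The cyclic group of \<open>y\<close> has order dividing
              \<open>p ^ 2\<close> and lies in a Sylow \<open>p\<close>-subgroup, so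
              \<open>y [^] p = \<one>\<close>; then \<open>m * p\<close> annihilates
              \<open>x\<close>, although \<open>x\<close> has order
              \<open>p * p * m\<close>.\<close>
            define y where "y = x [^] m"
            have yc: "y \<in> carrier G" unfolding y_def using xc by simp
            have "y [^] (p * p) = x [^] ord x" unfolding y_def m using xc by (simp add: nat_pow_pow mult.commute)
            then have "y [^] (p * p) = \<one>" using xc by simp
            then have "ord y dvd p ^ 2" using pow_eq_id[OF yc] by (simp add: power2_eq_square)
            then obtain j where j: "ord y = p ^ j" using divides_primepow_nat[OF p(1)] by auto
            have Y: "subgroup (generate G {y}) G" using yc by (intro generate_is_subgroup) simp
            have "card (generate G {y}) = p ^ j" using generate_pow_card[OF yc] j by simp
            then obtain P where P: "syl p P (carrier G)" "generate G {y} \<subseteq> P"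
              using p_subgroup_in_syl[OF subgroup_self p(1) Y] subgroup.subset[OF Y] by blast
            have "y \<in> P" using P(2) generate.incl[of y "{y}" G] by auto
            then have "y [^] p = \<one>" using A P(1) by blast
            then have "x [^] (m * p) = \<one>" unfolding y_def using xc by (simp add: nat_pow_pow)
            then have "p * p * m dvd m * p" using pow_eq_id[OF xc] m by simp
            then have "p dvd 1" using m0 p(1) prime_gt_0_nat[OF p(1)] by (simp add: ac_simps)
            then show False using p(1) by simp
          qed
          have "ord x dvd p * f"
          proof (cases "p dvd ord x")
            case False
            then have "coprime (ord x) p" using p(1) prime_imp_coprime coprime_commute by blast
            then show ?thesis using xe f coprime_dvd_mult_right_iff by blast
          next
            case True
            then obtain n where n: "ord x = p * n" by (auto simp: dvd_def)
            have "\<not> p dvd n" using np n by (auto simp: power2_eq_square dvd_def)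
            then have c: "coprime n p" using p(1) prime_imp_coprime coprime_commute by blast
            have "n dvd p * f" using xe prime_gt_0_nat[OF p(1)] unfolding n f by simp
            then have "n dvd f" using c coprime_dvd_mult_right_iff by blast
            then show ?thesis unfolding n by (rule mult_dvd_mono[OF dvd_refl])
          qed
          then show ?thesis using pow_eq_id[OF xc] by simp
        qed
        moreover have pf: "0 < p * f" using ex f by (cases "f = 0") auto
        ultimately have "e \<le> p * f" unfolding e_def group_exponent_def by (intro Least_le) simp
        then show False using f pf prime_gt_1_nat[OF p(1)] by simp
      qed
    qed
    ultimately show "class_A1 G" by (simp add: class_A1_def e_def)
  qed
qed

text \<open>A nontrivial normal subgroup has index prime to \<open>q\<close>, hence order divisible
  by \<open>q\<close>. Applied to the normal Sylow subgroup of the largest prime, this identifies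
  that prime as \<open>q\<close>; applied to central elements it makes \<open>Q\<close> elementary
  abelian; applied inside the centralizer of \<open>Q\<close> it gives \<open>C = Q\<close>. In the
  other Sylow subgroups, whatever centralizes \<open>Q\<close> is therefore trivial.\<close>

theorem class_A1_of_minimal:
  assumes Z: "class_Z G" and q: "prime_nat q" "q dvd card (carrier G)"
    and minimal: "\<And>M. normal_in M (carrier G) \<Longrightarrow> M \<noteq> {\<one>} \<Longrightarrow> \<not> q dvd card (carrier G) div card M"
  shows "class_A1 G"
proof -
  have index: "q dvd card (carrier G) div card M" if M: "subgroup M G" "\<not> q dvd card M" for M
  proof -
    have "card (carrier G) = card M * (card (carrier G) div card M)"
      using card_dvd[OF M(1) subgroup_self subgroup.subset[OF M(1)]] by simp
    then show ?thesis using q M(2) prime_dvd_mult_iff by metis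
  qed
  have C0: "card (carrier G) > 0" using card_subgroup_pos[OF subgroup_self] .
  have "1 < card (carrier G)" using q C0 by (cases "card (carrier G) = 1") auto
  then obtain r where r: "prime_nat r" "r dvd card (carrier G)"
    "\<And>s. prime_nat s \<Longrightarrow> s dvd card (carrier G) \<Longrightarrow> s \<le> r" using exists_max_prime by blast
  obtain Q where R: "syl r Q (carrier G)" using syl_exists[OF subgroup_self r(1)] by blast
  have "Q \<lhd> G" using R r(3) finite_group_axioms Z
    by (intro largest_prime_sylow_normal[of G r Q]) (auto simp: syl_carrier_iff order_def)
  then have Qn: "normal_in Q (carrier G)" by (simp add: normal_in_iff)
  have "q dvd card Q" using index[OF sylD(3)[OF R]] minimal[OF Qn syl_nontrivial(2)[OF R r(2)]] by blast
  then have "q dvd r" using sylD(5)[OF R] q(1) prime_dvd_power by metis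
  then have qr: "q = r" using q(1) r(1) primes_dvd_imp_eq by blast
  have QS: "syl q Q (carrier G)" using R qr by simp
  note Q = sylD[OF QS]
  have Qc: "x \<in> carrier G" if "x \<in> Q" for x using Q(4) that by auto
  define Zq where "Zq = {x \<in> Q. \<forall>y\<in>Q. x \<otimes> y = y \<otimes> x}"
  have Zn: "normal_in Zq (carrier G)" unfolding Zq_def by (rule centralizer_normal[OF Qn Qn])
  note z = normal_inD[OF Zn]
  have "q dvd card Zq" unfolding Zq_def by (rule p_group_center[OF Q(3,5,1) syl_nontrivial(1)[OF QS q(2)]])
  then obtain X where X: "subgroup X G" "X \<subseteq> Zq" "card X = q" using cauchy[OF z(1) q(1)] by blast
  \<comment> \<open>The elements of the center of \<open>Q\<close> annihilated by \<open>q\<close>.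
    Since \<open>minimal\<close> forces \<open>E = Q\<close>, one application yields both
    commutativity and exponent \<open>q\<close>.\<close>
  define E where "E = {x \<in> Zq. x [^] q = \<one>}"
  have comm: "x \<otimes> y = y \<otimes> x" if "x \<in> Zq" "y \<in> Q" for x y using that by (simp add: Zq_def)
  have ZQ: "x \<in> Q" "x \<in> carrier G" if "x \<in> Zq" for x using that Qc by (auto simp: Zq_def)
  have Es: "subgroup E G"
  proof (rule subgroupI)
    show "E \<subseteq> carrier G" using ZQ by (auto simp: E_def)
    have "\<one> \<in> E" using subgroup.one_closed[OF z(1)] by (simp add: E_def)
    then show "E \<noteq> {}" by blast
  next
    fix a assume "a \<in> E"
    then show "inv a \<in> E" using ZQ z(1) by (auto simp: E_def subgroup.m_inv_closed nat_pow_inv)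
  next
    fix a b assume ab: "a \<in> E" "b \<in> E"
    then have "(a \<otimes> b) [^] q = a [^] q \<otimes> b [^] q"
      using comm ZQ by (intro pow_mult_distrib) (auto simp: E_def)
    then show "a \<otimes> b \<in> E" using ab z(1) by (simp add: E_def subgroup.m_closed)
  qed
  have En: "normal_in E (carrier G)"
  proof (rule normal_inI[OF Es subgroup_self subgroup.subset[OF Es]])
    fix k n assume k: "k \<in> carrier G" and n: "n \<in> E"
    have nc: "n \<in> carrier G" "n \<in> Zq" using n ZQ by (auto simp: E_def)
    have "(k \<otimes> n \<otimes> inv k) [^] q = k \<otimes> n [^] q \<otimes> inv k" using conj_nat_pow[OF k nc(1)] by simp
    then show "k \<otimes> n \<otimes> inv k \<in> E" using n k z(4)[OF k nc(2)] by (simp add: E_def)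
  qed
  have XE: "X \<subseteq> E"
  proof
    fix x assume x: "x \<in> X"
    then show "x \<in> E" using X pow_card_subgroup[OF X(1) x] by (auto simp: E_def)
  qed
  have EQ: "E \<subseteq> Q" using ZQ by (auto simp: E_def)
  have "E \<noteq> {\<one>}"
  proof
    assume "E = {\<one>}"
    then have "card X \<le> 1" using card_mono[OF _ XE] by simp
    then show False using X(3) prime_gt_1_nat[OF q(1)] by simp
  qed
  then have "\<not> q dvd card (carrier G) div card E" by (rule minimal[OF En])
  moreover obtain j where "card E = q ^ j" using p_subgroup_card[OF Es EQ Q(3,5,1)] by blast
  ultimately have "syl q E (carrier G)" using sylI[OF q(1) subgroup_self Es] subgroup.subset[OF Es] by blast
  then have "card E = card Q" using sylD(5) Q(5) by metis
  then have QE: "E = Q" using EQ Q(3) by (intro subgroup_card_eq) auto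
  have Qab: "x \<otimes> y = y \<otimes> x" and Qexp: "x [^] q = \<one>" if "x \<in> Q" "y \<in> Q" for x y
    using that comm unfolding QE[symmetric] E_def by auto
  define C where "C = {x \<in> carrier G. \<forall>y\<in>Q. x \<otimes> y = y \<otimes> x}"
  have "normal_in (carrier G) (carrier G)" by (rule normal_inI[OF subgroup_self subgroup_self]) auto
  then have Cn: "normal_in C (carrier G)" unfolding C_def by (rule centralizer_normal[OF Qn])
  note c = normal_inD[OF Cn]
  have QC: "Q \<subseteq> C" using Qab Qc by (auto simp: C_def)
  have "C = Q"
  proof (rule ccontr)
    \<comment> \<open>The quotient of \<open>C\<close> by \<open>Q\<close> has a normal Sylow
      subgroup for its largest prime \<open>s\<close>, so \<open>S <#> Q\<close> is normal in
      \<open>C\<close>. Since \<open>C\<close> centralizes \<open>Q\<close>, \<open>S\<close> is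
      normal in \<open>S <#> Q\<close>, hence in \<open>C\<close> and in \<open>G\<close>, although
      \<open>q\<close> does not divide its order.\<close>
    assume CQ: "C \<noteq> Q"
    let ?C = "G\<lparr>carrier := C\<rparr>"
    interpret C: finite_group ?C by (rule sub_finite_group[OF c(1)])
    have QnC: "normal_in Q C" by (rule normal_in_subset[OF Qn c(1) QC c(3)])
    then have "Q \<lhd> ?C" using normal_in_consistent[OF c(1), of C Q] C.normal_in_iff[of Q] by simp
    then obtain H :: "('a, 'b) monoid_scheme" and h where e: "finite_group_epi ?C H h" "kernel ?C H h = Q"
      using C.coset_representative_quotient by blast
    interpret e: finite_group_epi ?C H h by (rule e(1))
    have cC: "card C = card (carrier H) * card Q"
      using e.card_img[OF C.subgroup_self] e.onto e(2) QC finite_subgroup[OF c(1)] by (simp add: Int_absorb1)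
    have H0: "card (carrier H) > 0" using e.H.card_subgroup_pos[OF e.H.subgroup_self] .
    have "card (carrier H) \<noteq> 1"
    proof
      assume "card (carrier H) = 1"
      then have "Q = C" using cC QC c(1) by (intro subgroup_card_eq) auto
      then show False using CQ by simp
    qed
    then have "1 < card (carrier H)" using H0 by linarith
    then obtain s where s: "prime_nat s" "s dvd card (carrier H)"
      "\<And>t. prime_nat t \<Longrightarrow> t dvd card (carrier H) \<Longrightarrow> t \<le> s" using exists_max_prime by blast
    have QsC: "syl q Q C" by (rule syl_mono[OF QS c(1) QC c(3)])
    have "\<not> q dvd card (carrier H)" using syl_index[OF QsC] cC card_subgroup_pos[OF Q(3)] by simp
    then have sq: "s \<noteq> q" using s(2) by auto
    obtain S where S: "syl s S C" using syl_exists[OF c(1) s(1)] by blast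
    note S' = sylD[OF S]
    have SC': "C.syl s S C" using S syl_iff[OF c(1), of s S] C.syl_carrier_iff[of s S] by simp
    then have SH: "e.H.syl s (h ` S) (carrier H)" using e.syl_image[of s S] by simp
    have "class_Z ?C" using Z_in_iff[OF c(1)] Z_in_subgroup[OF _ c(1,3)] Z class_Z_iff by simp
    then have "class_Z H" by (rule e.class_Z_image)
    then have "h ` S \<lhd> H" using SH s(3) e.H.finite_group_axioms
      by (intro largest_prime_sylow_normal[of H s "h ` S"]) (auto simp: e.H.syl_carrier_iff order_def)
    then have "e.H.normal_in (h ` S) (carrier H)" by (simp add: e.H.normal_in_iff)
    moreover have sS: "subgroup S ?C" using S' c(1) subgroup_sub_iff[OF c(1), of S] by simp
    ultimately have "C.normal_in (S <#>\<^bsub>?C\<^esub> Q) (carrier ?C)"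
      using e.normal_in_set_mult_kernel[of S] e(2) by simp
    then have SQn: "normal_in (S <#> Q) C" using normal_in_consistent[OF c(1), of C "S <#> Q"] by simp
    note m = subgroup_set_mult_normal[OF QnC S'(3,4)]
    have "normal_in S (S <#> Q)"
    proof (rule normal_inI[OF S'(3) m(1,2)])
      fix k x assume k: "k \<in> S <#> Q" and x: "x \<in> S"
      obtain a b where ab: "a \<in> S" "b \<in> Q" "k = a \<otimes> b" using k by (auto simp: set_mult_def)
      have xC: "x \<in> C" using x S'(4) by auto
      have cc: "a \<in> carrier G" "b \<in> carrier G" "x \<in> carrier G"
        using subgroup.mem_carrier[OF S'(3)] x ab Qc by auto
      have "x \<otimes> b = b \<otimes> x" using xC ab(2) by (simp add: C_def)
      have "k \<otimes> x \<otimes> inv k = a \<otimes> ((b \<otimes> x) \<otimes> inv b) \<otimes> inv a" unfolding ab(3) using cc by (simp add: m_assoc inv_mult_group)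
      also have "\<dots> = a \<otimes> x \<otimes> inv a" unfolding \<open>x \<otimes> b = b \<otimes> x\<close>[symmetric] using cc by (simp add: m_assoc)
      finally show "k \<otimes> x \<otimes> inv k \<in> S" using ab x S'(3) by (simp add: subgroup.m_closed subgroup.m_inv_closed)
    qed
    then have "normal_in S C" by (rule normal_syl_trans[OF syl_mono[OF S m(1,2,4)] _ SQn])
    then have SG: "normal_in S (carrier G)" by (rule normal_syl_trans[OF S _ Cn])
    have "s dvd card C" using s(2) cC by simp
    then have "S \<noteq> {\<one>}" by (rule syl_nontrivial(2)[OF S])
    moreover have "\<not> q dvd card S"
    proof
      assume "q dvd card S"
      then have "q dvd s" using S'(5) q(1) prime_dvd_power by metis
      then show False using sq q(1) s(1) primes_dvd_imp_eq by blast
    qed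
    ultimately show False using index[OF S'(3)] minimal[OF SG] by blast
  qed
  show ?thesis
    unfolding class_A1_iff
  proof (intro allI impI ballI conjI)
    fix p P x y assume P: "syl p P (carrier G)" and x: "x \<in> P"
    note P' = sylD[OF P]
    have Pc: "a \<in> carrier G" if "a \<in> P" for a using P'(4) that by auto
    have PQ: "P = Q" if "p = q" using normal_syl_unique[OF QS Qn] P that by simp
    have sub: "submodular_in P (carrier G)" using Z P by (auto simp: class_Z_iff Z_in_def)
    \<comment> \<open>By \<open>submodular_centralizes\<close> such an \<open>a\<close> centralizes
      \<open>Q\<close>, so it lies in \<open>C = Q\<close> and thus in the trivial intersection of
      \<open>P\<close> and \<open>Q\<close>.\<close>
    have triv: "a = \<one>" if pq: "p \<noteq> q" and a: "a \<in> P"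
      and st: "\<And>M K u. modular_in M K \<Longrightarrow> P \<subseteq> M \<Longrightarrow> u \<in> Q \<Longrightarrow> u \<in> K \<Longrightarrow> a \<otimes> u \<otimes> inv a \<otimes> inv u \<in> M" for a
    proof -
      have cop: "coprime (card P) q"
        unfolding P'(5) using primes_coprime[OF P'(1) q(1) pq] by simp
      have i: "subgroup (P \<inter> Q) G" by (rule subgroups_Inter_pair[OF P'(3) Q(3)])
      have "card (P \<inter> Q) dvd card P" "card (P \<inter> Q) dvd card Q"
        using i P'(3) Q(3) by (auto intro: card_dvd)
      moreover have "coprime (card P) (card Q)" using cop unfolding Q(5) by simp
      ultimately have "card (P \<inter> Q) = 1" by (meson coprime_common_divisor_nat)
      then have PQ1: "P \<inter> Q = {\<one>}" using card_eq_1[OF i] by simp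
      have "a \<otimes> u = u \<otimes> a" if u: "u \<in> Q" for u
      proof (rule submodular_centralizes[OF Qn Qab _ sub _ a pow_card_subgroup[OF P'(3) a] cop _ _ u])
        show "a \<otimes> u \<otimes> inv a \<otimes> inv u \<in> M" if "modular_in M K" "P \<subseteq> M" "u \<in> Q" "u \<in> K" for M K u
          by (rule st[OF that])
      qed (use Qexp PQ1 prime_gt_0_nat[OF q(1)] in auto)
      then have "a \<in> C" using Pc a by (simp add: C_def)
      then show ?thesis using PQ1 a \<open>C = Q\<close> by blast
    qed
    show "x [^] p = \<one>"
    proof (cases "p = q")
      case True then show ?thesis using PQ Qexp x by simp
    next
      case False
      show ?thesis
      proof (rule triv[OF False])
        show "x [^] p \<in> P" using subgroup_int_pow_closed[OF P'(3) x, of "int p"] by (simp add: int_pow_int)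
        have xp: "x [^] (p ^ multiplicity p (card (carrier G))) = \<one>" using pow_card_subgroup[OF P'(3) x] P'(5) by simp
        fix M K u assume a: "modular_in M K" "P \<subseteq> M" "u \<in> Q" "u \<in> K"
        then show "x [^] p \<otimes> u \<otimes> inv (x [^] p) \<otimes> inv u \<in> M"
          using x Qexp by (intro modular_power[OF Qn Qab q(1) _ a(1) _ xp P'(1)]) auto
      qed
    qed
    assume y: "y \<in> P"
    show "x \<otimes> y \<otimes> inv x \<otimes> inv y = \<one>"
    proof (cases "p = q")
      case True
      then have "x \<otimes> y = y \<otimes> x" using PQ Qab x y by simp
      then show ?thesis using Pc x y by (simp add: m_assoc)
    next
      case False
      show ?thesis
      proof (rule triv[OF False])
        show "x \<otimes> y \<otimes> inv x \<otimes> inv y \<in> P" using x y P'(3) by (simp add: subgroup.m_closed subgroup.m_inv_closed)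
        fix M K u assume a: "modular_in M K" "P \<subseteq> M" "u \<in> Q" "u \<in> K"
        then show "x \<otimes> y \<otimes> inv x \<otimes> inv y \<otimes> u \<otimes> inv (x \<otimes> y \<otimes> inv x \<otimes> inv y) \<otimes> inv u \<in> M"
          using x y by (intro modular_commutator[OF Qn Qab a(1)]) auto
      qed
    qed
  qed
qed

end

section \<open>The product theorem\<close>

context finite_group
begin

lemma factor_group_epi:
  assumes N: "N \<lhd> G"
  shows "finite_group_epi G (G Mod N) (\<lambda>x. N #> x)" "kernel G (G Mod N) (\<lambda>x. N #> x) = N"
proof -
  interpret N: normal N G by fact
  have c: "carrier (G Mod N) = (\<lambda>x. N #> x) ` carrier G" by (rule carrier_FactGroup)
  show "finite_group_epi G (G Mod N) (\<lambda>x. N #> x)"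
    by (intro finite_group_epi.intro group_hom.intro group_hom_axioms.intro finite_group.intro
        finite_group_axioms.intro finite_group_epi_axioms.intro)
      (use N.factorgroup_is_group N.r_coset_hom_Mod c in auto)
  have "N #> x = N \<longleftrightarrow> x \<in> N" if "x \<in> carrier G" for x
    using coset_join1[OF _ that N.subgroup_axioms] coset_join2[OF that N.subgroup_axioms] by auto
  then show "kernel G (G Mod N) (\<lambda>x. N #> x) = N" using N.subset by (auto simp: kernel_def)
qed

text \<open>\<open>H <#> N\<close> is the full preimage of the image of \<open>H\<close> in
  \<open>G Mod N\<close>, and submodularity passes to images and to preimages.\<close>

lemma submodular_set_mult_normal:
  assumes H: "submodular_in H (carrier G)" and N: "normal_in N (carrier G)"
  shows "submodular_in (H <#> N) (carrier G)"
proof -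
  have N': "N \<lhd> G" using N by (simp add: normal_in_iff)
  interpret e: finite_group_epi G "G Mod N" "\<lambda>x. N #> x" by (rule factor_group_epi(1)[OF N'])
  note k = factor_group_epi(2)[OF N']
  have "e.H.submodular_in ((\<lambda>x. N #> x) ` H) (carrier (G Mod N))"
    using e.submodular_in_image[OF H] e.onto by simp
  moreover have "{x \<in> carrier G. N #> x \<in> carrier (G Mod N)} = carrier G" using e.hom_closed by blast
  ultimately show ?thesis
    using e.submodular_in_preimage[of "(\<lambda>x. N #> x) ` H" "carrier (G Mod N)"]
      e.preimage_image[OF submodular_inD(3)[OF H]] k e.onto by simp
qed

lemma all_syl_submodular:
  assumes P: "syl p P (carrier G)" "submodular_in P (carrier G)" and Q: "syl p Q (carrier G)"
  shows "submodular_in Q (carrier G)"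
proof -
  obtain g where g: "g \<in> carrier G" "Q = cj g P" using syl_conj[OF P(1) Q] by blast
  show ?thesis unfolding g(2) using submodular_in_cj[OF P(2) g(1)] subgroup_cj_carrier[OF g(1)] by simp
qed

section \<open>The Fitting subgroup and condition (1)\<close>

text \<open>The terms of the lower central series are placed in \<open>nrm P\<close> one after
  another, beginning with the trivial one. If the next term is in \<open>nrm P\<close> and
  \<open>x\<close> lies in the present one, then all commutators of \<open>x\<close> with
  \<open>P\<close> are in \<open>nrm P\<close>, so \<open>cj x P \<subseteq> nrm P\<close>, where
  \<open>P\<close> is the only Sylow \<open>p\<close>-subgroup.\<close>

lemma nilpotent_syl_normal:
  assumes "nilpotent_group G" and P: "syl p P (carrier G)"
  shows "normal_in P (carrier G)"
proof -
  note s = sylD[OF P]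
  obtain n where n: "lower_central G n = {\<one>}" using assms(1) by (auto simp: nilpotent_group_def)
  have N: "subgroup (nrm P) G" by (rule nrm_subgroup[OF s(4)])
  have PN: "syl p P (nrm P)" by (rule syl_mono[OF P N subset_nrm[OF s(3)] subgroup.subset[OF N]])
  have "lower_central G k \<subseteq> carrier G" for k
  proof (induction k)
    case (Suc k)
    then show ?case by (simp, intro generate_incl) auto
  qed simp
  note lc = this
  have "lower_central G k \<subseteq> nrm P" if "k \<le> n" for k
    using that
  proof (induction rule: inc_induct)
    case base
    show ?case using n subgroup.one_closed[OF N] by simp
  next
    case (step k)
    show ?case
    proof
      fix x assume x: "x \<in> lower_central G k"
      have xc: "x \<in> carrier G" using lc x by blast
      have "x \<otimes> y \<otimes> inv x \<in> nrm P" if y: "y \<in> P" for y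
      proof -
        have yc: "y \<in> carrier G" using y s(4) by blast
        have "x \<otimes> y \<otimes> inv x \<otimes> inv y \<in> lower_central G (Suc k)"
          unfolding lower_central.simps using x yc by (intro generate.incl) blast
        then have "x \<otimes> y \<otimes> inv x \<otimes> inv y \<in> nrm P" using step.IH by blast
        moreover have "y \<in> nrm P" using subset_nrm[OF s(3)] y by blast
        ultimately have "x \<otimes> y \<otimes> inv x \<otimes> inv y \<otimes> y \<in> nrm P" by (rule subgroup.m_closed[OF N])
        then show ?thesis using xc yc by (simp add: m_assoc)
      qed
      then have "cj x P \<subseteq> nrm P" by (auto simp: cj_def)
      then have "cj x P \<subseteq> P"
        by (intro normal_syl_contains[OF PN normal_in_nrm[OF s(3)] cj_subgroup[OF xc s(3)]])
          (use card_cj[OF xc s(4)] s(5) in auto)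
      then have "cj x P = P" using card_cj[OF xc s(4)] s(3) by (intro subgroup_card_eq) auto
      then show "x \<in> nrm P" using xc by (simp add: nrm_def)
    qed
  qed
  from this[of 0] have "carrier G \<subseteq> nrm P" by simp
  then show ?thesis using s by (simp add: normal_in_iff_nrm)
qed

lemma not_dvd_index_trans:
  assumes s: "subgroup H G" "subgroup L G" "subgroup K G" "H \<subseteq> L" "L \<subseteq> K"
    and p: "prime_nat p" "\<not> p dvd card L div card H" "\<not> p dvd card K div card L"
  shows "\<not> p dvd card K div card H"
  using index_mult[OF s] p by (simp add: prime_dvd_mult_iff)

text \<open>\<open>c\<close> stands for the order of the product of \<open>X\<close> and
  \<open>Y\<close>. The index of \<open>X\<close> in it equals that of \<open>X \<inter> Y\<close>
  in \<open>Y\<close>, a divisor of the index of \<open>H\<close> in \<open>Y\<close>.\<close>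

lemma not_dvd_index_mult:
  assumes s: "subgroup X G" "subgroup Y G" "subgroup H G" "H \<subseteq> X \<inter> Y"
    and c: "c * card (X \<inter> Y) = card X * card Y" and p: "\<not> p dvd card Y div card H"
  shows "\<not> p dvd c div card X"
proof -
  have i: "subgroup (X \<inter> Y) G" by (rule subgroups_Inter_pair[OF s(1,2)])
  obtain a where a: "card (X \<inter> Y) = card H * a" using card_dvd[OF s(3) i s(4)] by (auto simp: dvd_def)
  obtain b where b: "card Y = card (X \<inter> Y) * b" using card_dvd[OF i s(2)] by (auto simp: dvd_def)
  have "card Y div card H = a * b" using a b card_subgroup_pos[OF s(3)] by simp
  then have "\<not> p dvd b" using p by auto
  moreover have "c = card X * b" using c b card_subgroup_pos[OF i] by simp
  ultimately show ?thesis using card_subgroup_pos[OF s(1)] by simp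
qed

lemma normal_set_mult:
  assumes M: "normal_in M (carrier G)" and N: "normal_in N (carrier G)"
  shows "normal_in (M <#> N) (carrier G)"
proof -
  note m = normal_inD[OF M] and n = normal_inD[OF N]
  note s = subgroup_set_mult_normal[OF N m(1,3)]
  show ?thesis
  proof (rule normal_inI[OF s(1) subgroup_self s(4)])
    fix k x assume k: "k \<in> carrier G" and "x \<in> M <#> N"
    then obtain a b where ab: "a \<in> M" "b \<in> N" "x = a \<otimes> b" by (auto simp: set_mult_def)
    have "k \<otimes> x \<otimes> inv k = (k \<otimes> a \<otimes> inv k) \<otimes> (k \<otimes> b \<otimes> inv k)"
      unfolding ab(3) using k ab m(3) n(3) by (intro conj_mult) auto
    then show "k \<otimes> x \<otimes> inv k \<in> M <#> N"
      using m(4)[OF k ab(1)] n(4)[OF k ab(2)] unfolding set_mult_def by blast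
  qed
qed

lemma fitting_subgroup_normal: "normal_in (fitting_subgroup G) (carrier G)"
proof -
  have "fitting_subgroup G \<lhd> G"
    unfolding fitting_subgroup_def
  proof (rule normal_generateI)
    show "\<Union>{N. N \<lhd> G \<and> nilpotent_group (G\<lparr>carrier := N\<rparr>)} \<subseteq> carrier G"
      using normal_imp_subgroup subgroup.subset by blast
    fix h g assume "h \<in> \<Union>{N. N \<lhd> G \<and> nilpotent_group (G\<lparr>carrier := N\<rparr>)}" and g: "g \<in> carrier G"
    then obtain N where N: "N \<lhd> G" "nilpotent_group (G\<lparr>carrier := N\<rparr>)" "h \<in> N" by blast
    then have "g \<otimes> h \<otimes> inv g \<in> N" using g normal_inv_iff by blast
    then show "g \<otimes> h \<otimes> inv g \<in> \<Union>{N. N \<lhd> G \<and> nilpotent_group (G\<lparr>carrier := N\<rparr>)}" using N by blast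
  qed
  then show ?thesis by (simp add: normal_in_iff)
qed

text \<open>Here \<open>Q\<close> is \<open>O\<^sub>p(G)\<close>.\<close>

lemma fitting_subgroup_p_part:
  assumes p: "prime_nat p"
  shows "\<exists>Q W k. normal_in Q (carrier G) \<and> card Q = p ^ k \<and> normal_in W (carrier G) \<and> Q \<subseteq> W
    \<and> \<not> p dvd card W div card Q \<and> fitting_subgroup G \<subseteq> W"
proof -
  obtain P where P: "syl p P (carrier G)" using syl_exists[OF subgroup_self p] by blast
  note P' = sylD[OF P]
  define Q where "Q = (\<Inter>g\<in>carrier G. cj g P)"
  have Qn: "normal_in Q (carrier G)" unfolding Q_def by (rule normal_core[OF P'(3)])
  note Q' = normal_inD[OF Qn]
  have "Q \<subseteq> P" using cj_one[OF P'(4)] unfolding Q_def by (auto dest: bspec[of _ _ \<one>])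
  then obtain k where k: "card Q = p ^ k" using p_subgroup_card[OF Q'(1) _ P'(3,5) p] by blast
  \<comment> \<open>A normal \<open>p\<close>-subgroup lies in one conjugate of \<open>P\<close>,
    hence in all of them.\<close>
  have inQ: "R \<subseteq> Q" if R: "normal_in R (carrier G)" "card R = p ^ j" for R j
  proof -
    note r = normal_inD[OF R(1)]
    obtain g where g: "g \<in> carrier G" "R \<subseteq> cj g P" using syl_contains[OF P r(1,3) R(2)] by blast
    have "R \<subseteq> cj h P" if h: "h \<in> carrier G" for h
    proof -
      have "cj (h \<otimes> inv g) R \<subseteq> cj (h \<otimes> inv g) (cj g P)" by (rule cj_mono[OF g(2)])
      also have "\<dots> = cj h P" using g h P'(4) by (simp add: cj_cj m_assoc)
      finally show ?thesis using normal_in_cj[OF R(1), of "h \<otimes> inv g"] g h by simp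
    qed
    then show ?thesis by (auto simp: Q_def)
  qed
  \<comment> \<open>\<open>W\<close> has largest order among the normal subgroups containing
    \<open>Q\<close> with index over \<open>Q\<close> prime to \<open>p\<close>. A nilpotent normal
    \<open>N\<close> has its Sylow \<open>p\<close>-subgroup inside \<open>Q\<close>, so
    \<open>W <#> N\<close> is again of this kind and \<open>N \<subseteq> W\<close>.\<close>
  let ?\<W> = "{W. normal_in W (carrier G) \<and> Q \<subseteq> W \<and> \<not> p dvd card W div card Q}"
  have "Q \<in> ?\<W>" using Qn card_subgroup_pos[OF Q'(1)] prime_gt_1_nat[OF p] by simp
  moreover have "card W < Suc (card (carrier G))" if "W \<in> ?\<W>" for W
    using that normal_inD(3) by (intro le_imp_less_Suc card_mono) auto
  ultimately obtain W where W: "W \<in> ?\<W>" and max: "\<And>V. V \<in> ?\<W> \<Longrightarrow> card V \<le> card W"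
    using ex_has_greatest_nat[of "\<lambda>W. W \<in> ?\<W>" Q card "Suc (card (carrier G))"] by blast
  have Wn: "normal_in W (carrier G)" "Q \<subseteq> W" "\<not> p dvd card W div card Q" using W by auto
  note w = normal_inD[OF Wn(1)]
  have "N \<subseteq> W" if N: "N \<lhd> G" "nilpotent_group (G\<lparr>carrier := N\<rparr>)" for N
  proof -
    have Nn: "normal_in N (carrier G)" using N by (simp add: normal_in_iff)
    note n = normal_inD[OF Nn]
    interpret N: finite_group "G\<lparr>carrier := N\<rparr>" by (rule sub_finite_group[OF n(1)])
    obtain R where R: "syl p R N" using syl_exists[OF n(1) p] by blast
    note r = sylD[OF R]
    have "N.syl p R N" using R syl_iff[OF n(1), of p R] N.syl_carrier_iff[of p R] by simp
    then have "N.normal_in R N" using N.nilpotent_syl_normal[OF N(2), of p R] by simp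
    then have "normal_in R N" using normal_in_consistent[OF n(1), of N R] by simp
    then have "normal_in R (carrier G)" by (rule normal_syl_trans[OF R _ Nn])
    then have RQ: "R \<subseteq> Q" by (rule inQ[OF _ r(5)])
    note s = subgroup_set_mult_normal[OF Nn w(1,3)]
    have "\<not> p dvd card (W <#> N) div card W"
      using RQ Wn(2) r(4) syl_index[OF R] finite_subgroup w(1) n(1)
      by (intro not_dvd_index_mult[OF w(1) n(1) r(3) _ card_set_mult]) auto
    then have "\<not> p dvd card (W <#> N) div card Q"
      by (rule not_dvd_index_trans[OF Q'(1) w(1) s(1) Wn(2) s(2) p Wn(3)])
    then have "W <#> N \<in> ?\<W>" using normal_set_mult[OF Wn(1) Nn] Wn(2) s(2) by blast
    then have "W = W <#> N" using max s(1,2) by (intro subgroup_card_eq) auto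
    then show ?thesis using s(3) by simp
  qed
  then have "fitting_subgroup G \<subseteq> W"
    unfolding fitting_subgroup_def using w(1) by (intro generate_subgroup_incl) auto
  then show ?thesis using Qn k Wn by blast
qed

text \<open>The index of \<open>P <#> Q\<close> is the product of the indices along \<open>P <#> Q
  \<subseteq> A <#> Q \<subseteq> A <#> W \<subseteq> carrier G\<close>. These divide the index of
  \<open>P\<close> in \<open>A\<close>, of \<open>Q\<close> in \<open>W\<close>, and of
  \<open>A <#> fitting_subgroup G\<close> in \<open>G\<close>, all prime to
  \<open>p\<close>.\<close>

lemma syl_submodular_of_fitting_index:
  assumes A: "submodular_in A (carrier G)" "Z_in A" and p: "prime_nat p"
    and i: "\<not> p dvd subgroup_index G (A <#> fitting_subgroup G)"
  shows "\<exists>P. syl p P (carrier G) \<and> submodular_in P (carrier G)"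
proof -
  note a = submodular_inD[OF A(1)]
  let ?F = "fitting_subgroup G"
  note f = normal_inD[OF fitting_subgroup_normal]
  note AF = subgroup_set_mult_normal[OF fitting_subgroup_normal a(1,3)]
  obtain Q W k where Q: "normal_in Q (carrier G)" "card Q = p ^ k" and W: "normal_in W (carrier G)" "Q \<subseteq> W"
    "\<not> p dvd card W div card Q" "?F \<subseteq> W" using fitting_subgroup_p_part[OF p] by blast
  note q = normal_inD[OF Q(1)] and w = normal_inD[OF W(1)]
  note AQ = subgroup_set_mult_normal[OF Q(1) a(1,3)]
  note AW = subgroup_set_mult_normal[OF W(1) a(1,3)]
  obtain P where P: "syl p P A" using syl_exists[OF a(1) p] by blast
  note P' = sylD[OF P]
  have PC: "P \<subseteq> carrier G" by (rule subgroup.subset[OF P'(3)])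
  note PQ = subgroup_set_mult_normal[OF Q(1) P'(3) PC]
  have "submodular_in P (carrier G)"
    using A(2) P submodular_in_trans[OF _ A(1)] by (auto simp: Z_in_def)
  then have sub: "submodular_in (P <#> Q) (carrier G)" by (rule submodular_set_mult_normal[OF _ Q(1)])
  have "card (rcosets (A <#> ?F)) * card (A <#> ?F) = card (carrier G)"
    using card_rcosets[OF AF(1)] by (simp add: order_def)
  then have "subgroup_index G (A <#> ?F) = card (carrier G) div card (A <#> ?F)"
    using card_subgroup_pos[OF AF(1)] unfolding subgroup_index_def by (metis less_not_refl nonzero_mult_div_cancel_right)
  then have i1: "\<not> p dvd card (carrier G) div card (A <#> ?F)" using i by simp
  have i2: "\<not> p dvd card (carrier G) div card (A <#> W)"
  proof -
    have AFW: "A <#> ?F \<subseteq> A <#> W" using W(4) by (intro mono_set_mult) auto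
    show ?thesis using i1 index_mult[OF AF(1) AW(1) subgroup_self AFW AW(4)] by auto
  qed
  have AQW: "(A <#> Q) <#> W = A <#> W"
  proof -
    have "Q <#> W = W"
    proof (intro equalityI)
      show "Q <#> W \<subseteq> W" using W(2) w(1) by (intro set_mult_subset) auto
      show "W \<subseteq> Q <#> W" by (rule subgroup_set_mult_normal(3)[OF W(1) q(1,3)])
    qed
    then show ?thesis using set_mult_assoc[OF a(3) q(3) w(3)] by simp
  qed
  have i3: "\<not> p dvd card (A <#> W) div card (A <#> Q)"
    using W(2,3) AQ(3) finite_subgroup AQ(1) w(1) card_set_mult[OF AQ(1) w(1)] AQW
    by (intro not_dvd_index_mult[OF AQ(1) w(1) q(1)]) auto
  have APQ: "A <#> (P <#> Q) = A <#> Q"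
  proof -
    have "A <#> P = A"
    proof (intro equalityI)
      show "A <#> P \<subseteq> A" using P'(4) a(1) by (intro set_mult_subset) auto
      show "A \<subseteq> A <#> P"
      proof
        fix x assume x: "x \<in> A"
        then have "x \<otimes> \<one> \<in> A <#> P" unfolding set_mult_def using subgroup.one_closed[OF P'(3)] by blast
        then show "x \<in> A <#> P" using x a(3) by auto
      qed
    qed
    then show ?thesis using set_mult_assoc[OF a(3) PC q(3)] by simp
  qed
  have i4: "\<not> p dvd card (A <#> Q) div card (P <#> Q)"
  proof (rule not_dvd_index_mult[OF PQ(1) a(1) P'(3)])
    show "P \<subseteq> (P <#> Q) \<inter> A" using PQ(2) P'(4) by auto
    show "card (A <#> Q) * card ((P <#> Q) \<inter> A) = card (P <#> Q) * card A"
      using card_set_mult[OF a(1) PQ(1)] APQ finite_subgroup a(1) PQ(1) by (simp add: Int_commute mult.commute)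
    show "\<not> p dvd card A div card P" by (rule syl_index[OF P])
  qed
  have PA: "P <#> Q \<subseteq> A <#> Q" using P'(4) by (intro mono_set_mult) auto
  have QA: "A <#> Q \<subseteq> A <#> W" using W(2) by (intro mono_set_mult) auto
  have "\<not> p dvd card (A <#> W) div card (P <#> Q)"
    by (rule not_dvd_index_trans[OF PQ(1) AQ(1) AW(1) PA QA p i4 i3])
  then have i5: "\<not> p dvd card (carrier G) div card (P <#> Q)"
    using PA QA by (intro not_dvd_index_trans[OF PQ(1) AW(1) subgroup_self _ AW(4) p _ i2]) auto
  have "card (P <#> Q) * card (P \<inter> Q) = card P * card Q"
    using card_set_mult[OF P'(3) q(1)] finite_subgroup P'(3) q(1) by simp
  then have "card (P <#> Q) dvd p ^ (multiplicity p (card A) + k)"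
    using P'(5) Q(2) by (metis dvd_triv_left power_add)
  then obtain j where "card (P <#> Q) = p ^ j" using divides_primepow_nat[OF p] by auto
  then have "syl p (P <#> Q) (carrier G)" by (rule sylI[OF p subgroup_self PQ(1,4) _ i5])
  then show ?thesis using sub by blast
qed

section \<open>The residual of \<open>class_A1\<close> and condition (2)\<close>

lemma class_A1_factor_iff:
  assumes N: "N \<lhd> G"
  shows "class_A1 (G Mod N) \<longleftrightarrow> (\<forall>p P. syl p P (carrier G) \<longrightarrow>
     (\<forall>x\<in>P. x [^] p \<in> N \<and> (\<forall>y\<in>P. x \<otimes> y \<otimes> inv x \<otimes> inv y \<in> N)))"
proof -
  let ?h = "\<lambda>x. N #> x"
  interpret e: finite_group_epi G "G Mod N" ?h by (rule factor_group_epi(1)[OF N])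
  have ker: "?h x = \<one>\<^bsub>G Mod N\<^esub> \<longleftrightarrow> x \<in> N" if "x \<in> carrier G" for x
    using factor_group_epi(2)[OF N] that unfolding kernel_def by auto
  have "(\<forall>x\<in>?h ` P. x [^]\<^bsub>G Mod N\<^esub> p = \<one>\<^bsub>G Mod N\<^esub> \<and> (\<forall>y\<in>?h ` P.
      x \<otimes>\<^bsub>G Mod N\<^esub> y \<otimes>\<^bsub>G Mod N\<^esub> inv\<^bsub>G Mod N\<^esub> x \<otimes>\<^bsub>G Mod N\<^esub> inv\<^bsub>G Mod N\<^esub> y = \<one>\<^bsub>G Mod N\<^esub>))
      \<longleftrightarrow> (\<forall>x\<in>P. x [^] p \<in> N \<and> (\<forall>y\<in>P. x \<otimes> y \<otimes> inv x \<otimes> inv y \<in> N))"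
    if P: "P \<subseteq> carrier G" for P and p :: nat
  proof -
    have "?h x [^]\<^bsub>G Mod N\<^esub> p = \<one>\<^bsub>G Mod N\<^esub> \<longleftrightarrow> x [^] p \<in> N" if "x \<in> P" for x
      using ker[of "x [^] p"] e.hom_nat_pow[of x p] that P by auto
    moreover have "?h x \<otimes>\<^bsub>G Mod N\<^esub> ?h y \<otimes>\<^bsub>G Mod N\<^esub> inv\<^bsub>G Mod N\<^esub> ?h x \<otimes>\<^bsub>G Mod N\<^esub> inv\<^bsub>G Mod N\<^esub> ?h y = \<one>\<^bsub>G Mod N\<^esub>
        \<longleftrightarrow> x \<otimes> y \<otimes> inv x \<otimes> inv y \<in> N" if xy: "x \<in> P" "y \<in> P" for x y
    proof -
      have c: "x \<in> carrier G" "y \<in> carrier G" using xy P by auto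
      have "?h (x \<otimes> y \<otimes> inv x \<otimes> inv y) = ?h x \<otimes>\<^bsub>G Mod N\<^esub> ?h y \<otimes>\<^bsub>G Mod N\<^esub> inv\<^bsub>G Mod N\<^esub> ?h x \<otimes>\<^bsub>G Mod N\<^esub> inv\<^bsub>G Mod N\<^esub> ?h y"
        using c by (simp only: e.hom_mult e.hom_inv m_closed inv_closed)
      then show ?thesis using ker[of "x \<otimes> y \<otimes> inv x \<otimes> inv y"] c by simp
    qed
    ultimately show ?thesis by blast
  qed
  note eq = this
  show ?thesis
    unfolding e.H.class_A1_iff
  proof (intro iffI allI impI)
    fix p P assume A: "\<forall>p P. e.H.syl p P (carrier (G Mod N)) \<longrightarrow> (\<forall>x\<in>P. x [^]\<^bsub>G Mod N\<^esub> p = \<one>\<^bsub>G Mod N\<^esub> \<and> (\<forall>y\<in>P.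
      x \<otimes>\<^bsub>G Mod N\<^esub> y \<otimes>\<^bsub>G Mod N\<^esub> inv\<^bsub>G Mod N\<^esub> x \<otimes>\<^bsub>G Mod N\<^esub> inv\<^bsub>G Mod N\<^esub> y = \<one>\<^bsub>G Mod N\<^esub>))"
      and P: "syl p P (carrier G)"
    show "\<forall>x\<in>P. x [^] p \<in> N \<and> (\<forall>y\<in>P. x \<otimes> y \<otimes> inv x \<otimes> inv y \<in> N)"
      using A e.syl_image[OF P] eq[OF sylD(4)[OF P], of p] by blast
  next
    fix p P' assume A: "\<forall>p P. syl p P (carrier G) \<longrightarrow> (\<forall>x\<in>P. x [^] p \<in> N \<and> (\<forall>y\<in>P. x \<otimes> y \<otimes> inv x \<otimes> inv y \<in> N))"
      and P': "e.H.syl p P' (carrier (G Mod N))"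
    obtain P where P: "syl p P (carrier G)" "P' = ?h ` P" using e.syl_lift[OF P'] by blast
    show "\<forall>x\<in>P'. x [^]\<^bsub>G Mod N\<^esub> p = \<one>\<^bsub>G Mod N\<^esub> \<and> (\<forall>y\<in>P'.
      x \<otimes>\<^bsub>G Mod N\<^esub> y \<otimes>\<^bsub>G Mod N\<^esub> inv\<^bsub>G Mod N\<^esub> x \<otimes>\<^bsub>G Mod N\<^esub> inv\<^bsub>G Mod N\<^esub> y = \<one>\<^bsub>G Mod N\<^esub>)"
      unfolding P(2) using A P(1) eq[OF sylD(4)[OF P(1)], of p] by blast
  qed
qed

text \<open>By \<open>class_A1_factor_iff\<close> the condition on \<open>N\<close> consists of
  memberships in \<open>N\<close>, so it survives arbitrary intersections. The intersection of all
  admissible \<open>N\<close> is therefore the least one, which gives the \<open>LEAST\<close> in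
  \<open>residual\<close> its intended value.\<close>

lemma residual_class_A1:
  "residual class_A1 G \<lhd> G" "\<And>N. N \<lhd> G \<Longrightarrow> class_A1 (G Mod N) \<Longrightarrow> residual class_A1 G \<subseteq> N"
proof -
  let ?\<N> = "{N. N \<lhd> G \<and> class_A1 (G Mod N)}"
  define R where "R = \<Inter>?\<N>"
  have "class_A1 (G Mod carrier G)"
    unfolding class_A1_factor_iff[OF normal_self]
    using sylD(4) by (intro allI impI ballI conjI) blast+
  then have ne: "carrier G \<in> ?\<N>" using normal_self by simp
  have sub: "N \<lhd> G" "normal_in N (carrier G)" if "N \<in> ?\<N>" for N using that by (auto simp: normal_in_iff)
  have Rs: "subgroup R G" unfolding R_def using ne sub normal_imp_subgroup by (intro subgroups_Inter) blast+
  have "normal_in R (carrier G)"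
    using normal_inD(4)[OF sub(2)] by (intro normal_inI[OF Rs subgroup_self subgroup.subset[OF Rs]]) (auto simp: R_def)
  then have Rn: "R \<lhd> G" by (simp add: normal_in_iff)
  have "class_A1 (G Mod R)"
    unfolding class_A1_factor_iff[OF Rn]
  proof (intro allI impI ballI conjI)
    fix p P x y assume P: "syl p P (carrier G)" and x: "x \<in> P"
    show "x [^] p \<in> R" unfolding R_def using class_A1_factor_iff P x by blast
    assume "y \<in> P"
    then show "x \<otimes> y \<otimes> inv x \<otimes> inv y \<in> R" unfolding R_def using class_A1_factor_iff P x by blast
  qed
  then have "residual class_A1 G = R"
    unfolding residual_def using Rn by (intro Least_equality) (auto simp: R_def)
  then show "residual class_A1 G \<lhd> G" "\<And>N. N \<lhd> G \<Longrightarrow> class_A1 (G Mod N) \<Longrightarrow> residual class_A1 G \<subseteq> N"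
    using Rn by (auto simp: R_def)
qed

lemma order_factor_group: "N \<lhd> G \<Longrightarrow> order (G Mod N) = card (carrier G) div card N"
  using card_rcosets[OF normal_imp_subgroup] card_subgroup_pos[OF normal_imp_subgroup]
  by (simp add: order_def FactGroup_def) (metis less_not_refl nonzero_mult_div_cancel_right)

text \<open>\<open>N\<close> has largest order among the normal subgroups whose index is divisible
  by \<open>q\<close>, which is exactly the hypothesis \<open>minimal\<close> for the quotient by
  \<open>N\<close>. This quotient is in \<open>class_A1\<close>, so the residual lies in
  \<open>N\<close> and its index is a multiple of that of \<open>N\<close>.\<close>

theorem prime_dvd_order_factor_residual:
  assumes Z: "class_Z G" and q: "prime_nat q" "q dvd card (carrier G)"
  shows "q dvd order (G Mod residual class_A1 G)"
proof -
  let ?\<N> = "{N. normal_in N (carrier G) \<and> q dvd card (carrier G) div card N}"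
  have "normal_in {\<one>} (carrier G)" using one_is_normal by (simp add: normal_in_iff)
  then have "{\<one>} \<in> ?\<N>" using q by simp
  moreover have "card N < Suc (card (carrier G))" if "N \<in> ?\<N>" for N
    using that normal_inD(3) by (intro le_imp_less_Suc card_mono) auto
  ultimately obtain N where N: "N \<in> ?\<N>" and max: "\<And>V. V \<in> ?\<N> \<Longrightarrow> card V \<le> card N"
    using ex_has_greatest_nat[of "\<lambda>N. N \<in> ?\<N>" "{\<one>}" card "Suc (card (carrier G))"] by blast
  have Nn: "normal_in N (carrier G)" and Nq: "q dvd card (carrier G) div card N" using N by auto
  note n = normal_inD[OF Nn]
  have N': "N \<lhd> G" using Nn by (simp add: normal_in_iff)
  let ?h = "\<lambda>x. N #> x"
  interpret e: finite_group_epi G "G Mod N" ?h by (rule factor_group_epi(1)[OF N'])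
  note ker = factor_group_epi(2)[OF N']
  have cG: "card (carrier G) = card (carrier (G Mod N)) * card N"
    using e.card_img[OF subgroup_self] e.onto n(3) unfolding ker by (simp add: Int_absorb1)
  have cQ: "card (carrier (G Mod N)) = card (carrier G) div card N" using cG card_subgroup_pos[OF n(1)] by simp
  have "class_A1 (G Mod N)"
  proof (rule e.H.class_A1_of_minimal[OF e.class_Z_image[OF Z] q(1)])
    show "q dvd card (carrier (G Mod N))" using cQ Nq by simp
    fix M assume M: "e.H.normal_in M (carrier (G Mod N))" "M \<noteq> {\<one>\<^bsub>G Mod N\<^esub>}"
    note m = e.H.normal_inD[OF M(1)]
    let ?M = "{x \<in> carrier G. ?h x \<in> M}"
    have Ms: "subgroup ?M G" by (rule e.preimage_subgroup[OF m(1)])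
    have "normal_in ?M (carrier G)"
      using m(4) by (intro normal_inI[OF Ms subgroup_self]) auto
    have NM: "N \<subseteq> ?M"
    proof
      fix x assume "x \<in> N"
      then have "x \<in> carrier G" "?h x = \<one>\<^bsub>G Mod N\<^esub>" using ker unfolding kernel_def by blast+
      then show "x \<in> ?M" using subgroup.one_closed[OF m(1)] by simp
    qed
    have hM: "?h ` ?M = M"
    proof (intro equalityI subsetI)
      fix X assume X: "X \<in> M"
      then have "X \<in> ?h ` carrier G" using m(3) e.onto by blast
      then show "X \<in> ?h ` ?M" using X by (elim imageE) simp
    qed auto
    have "?M \<inter> N = N" using NM by auto
    then have cM: "card ?M = card M * card N"
      using e.card_img[OF Ms] hM finite_subgroup[OF Ms] unfolding ker by simp
    have "card M \<noteq> 1" using e.H.card_eq_1[OF m(1)] M(2) by simp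
    then have "card N < card ?M"
      using cM card_subgroup_pos[OF n(1)] e.H.card_subgroup_pos[OF m(1)] by (cases "card M") auto
    then have "?M \<notin> ?\<N>" using max[of ?M] by auto
    then have "\<not> q dvd card (carrier G) div card ?M" using \<open>normal_in ?M (carrier G)\<close> by simp
    moreover have "card (carrier G) div card ?M = card (carrier (G Mod N)) div card M"
      unfolding cM cG using card_subgroup_pos[OF n(1)] by simp
    ultimately show "\<not> q dvd card (carrier (G Mod N)) div card M" by simp
  qed
  note R = residual_class_A1(1) residual_class_A1(2)[OF N' this]
  let ?R = "residual class_A1 G"
  have Rs: "subgroup ?R G" by (rule normal_imp_subgroup[OF R(1)])
  show ?thesis
    using Nq order_factor_group[OF R(1)] index_mult[OF Rs n(1) subgroup_self R(2) n(3)] by simp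
qed

text \<open>The index of \<open>A\<close> in \<open>G\<close> divides the order of \<open>B\<close>
  and is prime to \<open>p\<close>, so a Sylow \<open>p\<close>-subgroup of \<open>A\<close> is
  already one of \<open>G\<close>.\<close>

lemma syl_submodular_of_coprime:
  assumes A: "submodular_in A (carrier G)" "Z_in A" and B: "subgroup B G" and AB: "carrier G = A <#> B"
    and p: "prime_nat p" "\<not> p dvd card B"
  shows "\<exists>P. syl p P (carrier G) \<and> submodular_in P (carrier G)"
proof -
  note a = submodular_inD[OF A(1)]
  obtain P where P: "syl p P A" using syl_exists[OF a(1) p(1)] by blast
  note P' = sylD[OF P]
  have "\<not> p dvd card B div card {\<one>}" using p(2) by simp
  then have "\<not> p dvd card (A <#> B) div card A"
    using subgroup.one_closed[OF a(1)] subgroup.one_closed[OF B] finite_subgroup a(1) B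
    by (intro not_dvd_index_mult[OF a(1) B triv_subgroup _ card_set_mult]) auto
  then have "\<not> p dvd card (carrier G) div card P"
    using AB by (intro not_dvd_index_trans[OF P'(3) a(1) subgroup_self P'(4) a(3) p(1) syl_index[OF P]]) simp
  then have "syl p P (carrier G)" using P'(3,4,5) a(3) by (intro sylI[OF p(1) subgroup_self]) auto
  moreover have "submodular_in P (carrier G)"
    using A(2) P submodular_in_trans[OF _ A(1)] by (auto simp: Z_in_def)
  ultimately show ?thesis by blast
qed

end

theorem theorem1:
  fixes G :: "('a, 'b) monoid_scheme" and A B :: "'a set"
  assumes "group G" and "finite (carrier G)"
    and "submodular_subgroup A G" and "submodular_subgroup B G"
    and "carrier G = A <#>\<^bsub>G\<^esub> B"
    and "class_Z (G\<lparr>carrier := A\<rparr>)" and "class_Z (G\<lparr>carrier := B\<rparr>)"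
    and "coprime (subgroup_index G (A <#>\<^bsub>G\<^esub> fitting_subgroup G))
                 (subgroup_index G (B <#>\<^bsub>G\<^esub> fitting_subgroup G)) \<or>
         coprime
           (Coset.order (G\<lparr>carrier := A\<rparr> Mod residual class_A1 (G\<lparr>carrier := A\<rparr>)))
           (Coset.order (G\<lparr>carrier := B\<rparr> Mod residual class_A1 (G\<lparr>carrier := B\<rparr>)))"
  shows "class_Z G"
proof -
  interpret finite_group G using assms(1,2) by (simp add: finite_group_def finite_group_axioms_def)
  have A: "submodular_in A (carrier G)" and B: "submodular_in B (carrier G)"
    using assms(3,4) by (simp_all add: submodular_carrier_iff)
  note a = submodular_inD[OF A] and b = submodular_inD[OF B]
  have ZA: "Z_in A" and ZB: "Z_in B" using assms(6,7) a(1) b(1) by (simp_all add: Z_in_iff)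
  have not_both: "\<not> (p dvd x \<and> p dvd y)" if "coprime x y" "prime_nat p" for x y p :: nat
    using coprime_common_divisor_nat[OF that(1)] that(2) by (metis not_prime_1)
  have "\<exists>P. syl p P (carrier G) \<and> submodular_in P (carrier G)" if p: "prime_nat p" for p
    using assms(8)
  proof
    assume "coprime (subgroup_index G (A <#>\<^bsub>G\<^esub> fitting_subgroup G))
                 (subgroup_index G (B <#>\<^bsub>G\<^esub> fitting_subgroup G))"
    from not_both[OF this p] show ?thesis
      using syl_submodular_of_fitting_index[OF A ZA p] syl_submodular_of_fitting_index[OF B ZB p] by blast
  next
    interpret A: finite_group "G\<lparr>carrier := A\<rparr>" by (rule sub_finite_group[OF a(1)])
    interpret B: finite_group "G\<lparr>carrier := B\<rparr>" by (rule sub_finite_group[OF b(1)])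
    assume "coprime
           (Coset.order (G\<lparr>carrier := A\<rparr> Mod residual class_A1 (G\<lparr>carrier := A\<rparr>)))
           (Coset.order (G\<lparr>carrier := B\<rparr> Mod residual class_A1 (G\<lparr>carrier := B\<rparr>)))"
    from not_both[OF this p] have "\<not> p dvd card A \<or> \<not> p dvd card B"
      using A.prime_dvd_order_factor_residual[OF assms(6) p] B.prime_dvd_order_factor_residual[OF assms(7) p] by auto
    \<comment> \<open>Taking inverses turns \<open>G = AB\<close> into \<open>G = BA\<close>; this
      order of the factors is used when \<open>p\<close> does not divide the order of
      \<open>A\<close>.\<close>
    moreover have "carrier G = B <#>\<^bsub>G\<^esub> A"
    proof (intro equalityI subsetI)
      fix x assume x: "x \<in> carrier G"
      then have "inv\<^bsub>G\<^esub> x \<in> A <#>\<^bsub>G\<^esub> B" using assms(5) inv_closed by blast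
      then obtain y z where yz: "y \<in> A" "z \<in> B" "inv\<^bsub>G\<^esub> x = y \<otimes>\<^bsub>G\<^esub> z" by (auto simp: set_mult_def)
      have c: "y \<in> carrier G" "z \<in> carrier G" using yz a(3) b(3) by auto
      have "x = inv\<^bsub>G\<^esub> (inv\<^bsub>G\<^esub> x)" using x by simp
      also have "\<dots> = inv\<^bsub>G\<^esub> z \<otimes>\<^bsub>G\<^esub> inv\<^bsub>G\<^esub> y" unfolding yz(3) using c by (simp add: inv_mult_group)
      finally show "x \<in> B <#>\<^bsub>G\<^esub> A"
        using subgroup.m_inv_closed[OF a(1) yz(1)] subgroup.m_inv_closed[OF b(1) yz(2)]
        unfolding set_mult_def by blast
    next
      fix x assume "x \<in> B <#>\<^bsub>G\<^esub> A"
      then show "x \<in> carrier G" using a(3) b(3) by (auto simp: set_mult_def)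
    qed
    ultimately show ?thesis
      using syl_submodular_of_coprime[OF A ZA b(1) assms(5) p]
        syl_submodular_of_coprime[OF B ZB a(1) _ p] by blast
  qed
  then show ?thesis
    unfolding class_Z_iff Z_in_def using all_syl_submodular sylD(1) subgroup_self by blast
qed

end
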